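(* Let $(n_k)_{k\ge1}$ be a sequence of positive integers satisfying Condition $\mathbf R$. Then for every permutation $\sigma:\mathbb N\to\mathbb N$, $$N^{-1/2}\sum_{k=1}^N \cos 2\pi n_{\sigma(k)}x \xrightarrow{\ \mathcal D\ } \mathcal N(0,1/2).$$ If moreover $(n_k)_{k\ge1}$ satisfies Condition $\mathbf R^*$, then for every permutation $\sigma$, $$\limsup_{N\to\infty}\frac{\sum_{k=1}^N\cos 2\pi n_{\sigma(k)}x}{\sqrt{N\log\log N}}=1\quad\text{for a.e. }x\in[0,1].$$
   Context: Condition $\mathbf R$: for every $p\ge2$ and every fixed choice of nonzero integers $a_1,\dots,a_p$ with $|a_i|\le p$ for all $i$, the equation $a_1n_{k_1}+\dots+a_pn_{k_p}=0$ has only finitely many solutions $(k_1,\dots,k_p)$ with $k_1<k_2<\dots<k_p$. Condition $\mathbf R^*$: there are constants $C,\alpha>0$ such that for every $p\ge 2$ and every such choice of $a_1,\dots,a_p$ the number of these solutions is at most $C\exp(p^\alpha)$. Convergence in distribution and "a.e." refer to the probability space $([0,1],\mathcal B,\lambda)$ with Lebesgue measure $\lambda$. *)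

theory Defs
  imports "HOL-Probability.Probability"
begin

text \<open>Sequences are indexed from 1: n :: nat => nat, only values n k with k >= 1 matter.
  A tuple (k_1,...,k_p) is a list ks of length p; coefficients a_1..a_p a list as.\<close>

definition sol_set :: "(nat \<Rightarrow> nat) \<Rightarrow> int list \<Rightarrow> nat list set" where
  "sol_set n as = {ks. length ks = length as \<and> (\<forall>k\<in>set ks. 1 \<le> k) \<and> sorted_wrt (<) ks \<and>
      (\<Sum>i<length as. as ! i * int (n (ks ! i))) = 0}"

definition admissible_coeffs :: "nat \<Rightarrow> int list \<Rightarrow> bool" where
  "admissible_coeffs p as \<longleftrightarrow> length as = p \<and> (\<forall>a\<in>set as. a \<noteq> 0 \<and> \<bar>a\<bar> \<le> int p)"

definition condR :: "(nat \<Rightarrow> nat) \<Rightarrow> bool" where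
  "condR n \<longleftrightarrow> (\<forall>p as. p \<ge> 2 \<and> admissible_coeffs p as \<longrightarrow> finite (sol_set n as))"

definition condRstar :: "(nat \<Rightarrow> nat) \<Rightarrow> bool" where
  "condRstar n \<longleftrightarrow> (\<exists>C \<alpha>::real. C > 0 \<and> \<alpha> > 0 \<and>
     (\<forall>p as. p \<ge> 2 \<and> admissible_coeffs p as \<longrightarrow>
        finite (sol_set n as) \<and> real (card (sol_set n as)) \<le> C * exp (real p powr \<alpha>)))"

definition unit_interval_measure :: "real measure" where
  "unit_interval_measure = restrict_space lborel {0..1}"

definition trig_sum :: "(nat \<Rightarrow> nat) \<Rightarrow> (nat \<Rightarrow> nat) \<Rightarrow> nat \<Rightarrow> real \<Rightarrow> real" where
  "trig_sum n \<sigma> N x = (\<Sum>k=1..N. cos (2 * pi * real (n (\<sigma> k)) * x))"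

end

theory Submission
  imports Defs "HOL-Real_Asymp.Real_Asymp"
begin

text \<open>With \<open>c k = cos (2 * pi * n (\<sigma> k) * x)\<close> the proof works with the products \<open>\<Prod>k. 1 + z * c k\<close>, which agree with
  \<open>exp (z * S - z\<^sup>2 * N / 4)\<close>, \<open>S = \<Sum>k. c k\<close>, up to a small error, because \<open>\<Sum>k. (c k)\<^sup>2\<close> is close to \<open>N / 2\<close> with high probability.
  Expanded in elementary symmetric polynomials and truncated at a degree \<open>D\<close>, their means, and the means of their squares,
  only involve linear relations between at most \<open>4 * D\<close> frequencies with coefficients in \<open>{-2..2}\<close>;
  Condition R (for fixed \<open>D\<close>) and Condition R* (for \<open>D\<close> a small power of \<open>ln N\<close>) make the contribution of these relations negligible,
  whatever the order of the frequencies.  The truncation error is controlled by Cauchy's estimate wherever \<open>S\<close> is not too large.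
  Imaginary \<open>z\<close> gives the characteristic function and hence the central limit theorem.
  Real \<open>z\<close> gives the sub-Gaussian bound behind the upper half of the law of the iterated logarithm, with dyadic chaining between
  checkpoints; the lower half is a second moment argument for exponentially tilted indicators over disjoint blocks, which are
  asymptotically uncorrelated.\<close>

text \<open>The obstacle is that Condition R limits each coefficient by the number of terms:
  relations with few terms and large coefficients are not controlled. Powers of
  \<open>\<Sum>k. c k\<close> produce such relations, whereas products over distinct indices and
  their squares give no coefficient beyond 2, which is admissible from two terms on. This is why
  even the moments are reached through elementary symmetric polynomials. Positivity of the
  frequencies excludes relations with one term. Truncation destroys positivity, so upper bounds for
  exponential moments use the square of a truncated product at half the parameter: it is nonnegative
  everywhere and has the right exponential size. For a block of at least \<open>2 ^ t\<close>
  frequencies, \<open>z\<close> has order at most \<open>sqrt (ln t / 2 ^ t)\<close>. The degree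
  \<open>t powr gam\<close> keeps the number of relations below \<open>exp\<close> of a multiple of
  \<open>sqrt t\<close>, which loses against \<open>2 ^ t\<close>, and yet it outgrows the bound for
  \<open>z * S\<close> on the good set, of order
  \<open>t powr (gam / 2) * sqrt (ln t)\<close>.\<close>

abbreviation (input) mean :: "(real \<Rightarrow> 'b) \<Rightarrow> 'b::{banach, second_countable_topology}" (binder \<open>\<E>\<close> [60] 60) where
  "mean f \<equiv> integral\<^sup>L unit_interval_measure f"

section \<open>Elementary symmetric polynomials\<close>

definition esum :: "('a \<Rightarrow> 'b::comm_semiring_1) \<Rightarrow> 'a set \<Rightarrow> nat \<Rightarrow> 'b" where
  "esum c I p = (\<Sum>A | A \<subseteq> I \<and> card A = p. \<Prod>k\<in>A. c k)"

definition tsum :: "('a \<Rightarrow> 'b::comm_semiring_1) \<Rightarrow> 'a set \<Rightarrow> nat \<Rightarrow> 'b \<Rightarrow> 'b" where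
  "tsum c I D z = (\<Sum>p\<le>D. z ^ p * esum c I p)"

lemma esum_0 [simp]: "finite I \<Longrightarrow> esum c I 0 = 1"
proof -
  assume "finite I"
  then have "{A. A \<subseteq> I \<and> card A = 0} = {{}}"
    by (auto dest: finite_subset)
  then show ?thesis by (simp add: esum_def)
qed

lemma esum_1: "esum c I (Suc 0) = (\<Sum>k\<in>I. c k)"
proof -
  have "{A. A \<subseteq> I \<and> card A = Suc 0} = (\<lambda>k. {k}) ` I"
    by (auto simp: card_Suc_eq)
  then show ?thesis by (simp add: esum_def sum.reindex)
qed

lemma esum_eq_0: "finite I \<Longrightarrow> card I < p \<Longrightarrow> esum c I p = 0"
proof -
  assume "finite I" "card I < p"
  then have *: "{A. A \<subseteq> I \<and> card A = p} = {}"
    by (auto dest: card_mono[OF \<open>finite I\<close>])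
  show ?thesis unfolding esum_def * by simp
qed

lemma esum_of_real:
  "esum (\<lambda>k. of_real (c k) :: 'b::{comm_semiring_1,real_algebra_1}) I p = of_real (esum c I p)"
  by (simp add: esum_def)

lemma esum_scale: "esum (\<lambda>k. z * c k) I p = z ^ p * esum c I p"
  unfolding esum_def sum_distrib_left
  by (intro sum.cong) (auto simp: prod.distrib)

lemma tsum_of_real:
  "tsum (\<lambda>k. of_real (c k) :: 'b::{comm_semiring_1,real_algebra_1}) I D (of_real z) = of_real (tsum c I D z)"
  by (simp add: tsum_def esum_of_real)

lemma prod_one_plus:
  fixes z :: "'b::comm_semiring_1"
  assumes "finite I"
  shows "(\<Prod>k\<in>I. 1 + z * c k) = tsum c I (card I) z"
proof -
  have "(\<Prod>k\<in>I. 1 + z * c k) = (\<Prod>k\<in>I. z * c k + 1)" by (simp add: add.commute)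
  also have "\<dots> = (\<Sum>X\<in>Pow I. z ^ card X * (\<Prod>k\<in>X. c k))"
    using assms by (subst prod_add) (auto simp: prod.distrib)
  also have "\<dots> = (\<Sum>p\<le>card I. \<Sum>X | X \<in> Pow I \<and> card X = p. z ^ card X * (\<Prod>k\<in>X. c k))"
    using assms by (intro sum.group [symmetric]) (auto intro: card_mono)
  also have "\<dots> = (\<Sum>p\<le>card I. z ^ p * esum c I p)"
    unfolding esum_def sum_distrib_left by (intro sum.cong) auto
  finally show ?thesis by (simp add: tsum_def)
qed

text \<open>With \<open>h i q = (\<Sum>k\<in>I. c k ^ i * esum c (I - {k}) q)\<close>, Newton's identities follow by iterating
  \<open>power sum i * esum q = h i q + h (i + 1) (q - 1)\<close> from \<open>h 1 q = (q + 1) * esum (q + 1)\<close>.\<close>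

lemma esum_remove:
  fixes c :: "'a \<Rightarrow> 'b::comm_semiring_1"
  assumes "finite I" "k \<in> I"
  shows "esum c I (Suc q) = esum c (I - {k}) (Suc q) + c k * esum c (I - {k}) q"
proof -
  let ?X = "{A. A \<subseteq> I - {k} \<and> card A = Suc q}" and ?Y = "{A. A \<subseteq> I - {k} \<and> card A = q}"
  have fin: "finite ?X" "finite ?Y" using assms by auto
  have *: "{A. A \<subseteq> I \<and> card A = Suc q} = ?X \<union> insert k ` ?Y"
  proof (intro equalityI subsetI)
    fix A assume A: "A \<in> {A. A \<subseteq> I \<and> card A = Suc q}"
    show "A \<in> ?X \<union> insert k ` ?Y"
    proof (cases "k \<in> A")
      case True
      then have "A = insert k (A - {k})" "A - {k} \<in> ?Y" using A by auto
      then show ?thesis by blast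
    qed (use A in auto)
  next
    fix A assume "A \<in> ?X \<union> insert k ` ?Y"
    then show "A \<in> {A. A \<subseteq> I \<and> card A = Suc q}"
      using assms by (auto simp: card_insert_if dest: finite_subset)
        (metis DiffD2 card_insert_disjoint finite_Diff finite_subset insertI1 subsetD)
  qed
  have inj: "inj_on (insert k) ?Y" by (auto simp: inj_on_def)
  have "esum c I (Suc q) = (\<Sum>A\<in>?X. \<Prod>k\<in>A. c k) + (\<Sum>A\<in>insert k ` ?Y. \<Prod>k\<in>A. c k)"
    unfolding esum_def * using fin by (intro sum.union_disjoint) auto
  also have "(\<Sum>A\<in>insert k ` ?Y. \<Prod>k\<in>A. c k) = (\<Sum>A\<in>?Y. c k * (\<Prod>k\<in>A. c k))"
    unfolding sum.reindex [OF inj] comp_def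
  proof (intro sum.cong refl)
    fix A assume "A \<in> ?Y"
    then have "finite A" "k \<notin> A" using assms by (auto intro: finite_subset)
    then show "prod c (insert k A) = c k * prod c A" by simp
  qed
  finally show ?thesis by (simp add: esum_def sum_distrib_left)
qed

text \<open>Double counting of pairs \<open>(A, k)\<close> with \<open>k \<in> A\<close>: each
  subset of size \<open>q + 1\<close> arises once for every choice of its distinguished
  element.\<close>

lemma sum_mult_esum_remove:
  fixes c :: "'a \<Rightarrow> 'b::comm_semiring_1"
  assumes "finite I"
  shows "(\<Sum>k\<in>I. c k * esum c (I - {k}) q) = of_nat (Suc q) * esum c I (Suc q)"
proof -
  let ?Y = "\<lambda>k. {A. A \<subseteq> I - {k} \<and> card A = q}" and ?X = "{A. A \<subseteq> I \<and> card A = Suc q}"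
  have "(\<Sum>k\<in>I. c k * esum c (I - {k}) q) = (\<Sum>k\<in>I. \<Sum>A\<in>?Y k. prod c (insert k A))"
    unfolding esum_def sum_distrib_left
  proof (intro sum.cong refl)
    fix k A assume "k \<in> I" "A \<in> ?Y k"
    then have "finite A" "k \<notin> A" using assms by (auto intro: finite_subset)
    then show "c k * prod c A = prod c (insert k A)" by simp
  qed
  also have "\<dots> = (\<Sum>(k,A)\<in>Sigma I ?Y. prod c (insert k A))"
    using assms by (subst sum.Sigma) auto
  also have "\<dots> = (\<Sum>(A,k)\<in>Sigma ?X (\<lambda>A. A). prod c A)"
  proof (rule sum.reindex_bij_witness[where i = "\<lambda>(A,k). (k, A - {k})" and j = "\<lambda>(k,A). (insert k A, k)"])
    fix a assume "a \<in> Sigma I ?Y"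
    then obtain k A where a: "a = (k,A)" "k \<in> I" "A \<subseteq> I - {k}" "card A = q" by auto
    then have "finite A" using assms by (auto intro: finite_subset)
    with a show "(case case a of (k,A) \<Rightarrow> (insert k A, k) of (A,k) \<Rightarrow> (k, A - {k})) = a"
      "(case a of (k,A) \<Rightarrow> (insert k A, k)) \<in> Sigma ?X (\<lambda>A. A)"
      by (auto simp: card_insert_if)
    show "(case case a of (k,A) \<Rightarrow> (insert k A, k) of (A,k) \<Rightarrow> prod c A) = (case a of (k,A) \<Rightarrow> prod c (insert k A))"
      using a by auto
  next
    fix b assume "b \<in> Sigma ?X (\<lambda>A. A)"
    then obtain k A where a: "b = (A,k)" "k \<in> A" "A \<subseteq> I" "card A = Suc q" by auto
    then have "finite A" using assms by (auto intro: finite_subset)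
    with a show "(case b of (A,k) \<Rightarrow> (k, A - {k})) \<in> Sigma I ?Y" by auto
    show "(case case b of (A,k) \<Rightarrow> (k, A - {k}) of (k,A) \<Rightarrow> (insert k A, k)) = b"
      using a by auto
  qed
  also have "\<dots> = (\<Sum>A\<in>?X. \<Sum>k\<in>A. prod c A)"
    using assms by (subst sum.Sigma) (auto intro: finite_subset)
  also have "\<dots> = of_nat (Suc q) * esum c I (Suc q)"
    unfolding esum_def sum_distrib_left by (intro sum.cong) auto
  finally show ?thesis .
qed

lemma abs_power_sum_le_1:
  fixes c :: "'a \<Rightarrow> real"
  assumes "finite I" "(\<Sum>k\<in>I. (c k)\<^sup>2) \<le> 1" "i \<ge> 2"
  shows "\<bar>\<Sum>k\<in>I. c k ^ i\<bar> \<le> 1"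
proof -
  have *: "\<bar>c k\<bar> \<le> 1" if "k \<in> I" for k
  proof -
    have "(c k)\<^sup>2 \<le> (\<Sum>k\<in>I. (c k)\<^sup>2)" using assms that by (intro member_le_sum) auto
    then show ?thesis using assms(2) abs_square_le_1 by (meson order_trans)
  qed
  have "\<bar>\<Sum>k\<in>I. c k ^ i\<bar> \<le> (\<Sum>k\<in>I. \<bar>c k\<bar> ^ i)"
    by (rule order_trans[OF sum_abs]) (simp add: power_abs)
  also have "\<dots> \<le> (\<Sum>k\<in>I. \<bar>c k\<bar> ^ 2)"
    using * assms by (intro sum_mono power_decreasing) auto
  finally show ?thesis using assms by simp
qed

text \<open>The recursion lowers \<open>q\<close> and raises \<open>i\<close>. Started at
  \<open>i \<ge> 2\<close>, it meets only power sums bounded by 1 under the normalisation, never the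
  uncontrolled first power sum.\<close>

lemma abs_sum_power_mult_esum_le:
  fixes c :: "'a \<Rightarrow> real"
  assumes "finite I" "(\<Sum>k\<in>I. (c k)\<^sup>2) \<le> 1" "i \<ge> 2"
  shows "\<bar>\<Sum>k\<in>I. c k ^ i * esum c (I - {k}) q\<bar> \<le> (\<Sum>j\<le>q. \<bar>esum c I j\<bar>)"
  using \<open>i \<ge> 2\<close>
proof (induction q arbitrary: i)
  case 0
  then show ?case using abs_power_sum_le_1[OF assms(1,2), of i] assms by simp
next
  case (Suc q)
  have "(\<Sum>k\<in>I. c k ^ i * esum c I (Suc q)) =
     (\<Sum>k\<in>I. c k ^ i * esum c (I - {k}) (Suc q) + c k ^ Suc i * esum c (I - {k}) q)"
    using assms by (intro sum.cong refl) (simp add: esum_remove[of I _ c q] algebra_simps)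
  then have "(\<Sum>k\<in>I. c k ^ i * esum c (I - {k}) (Suc q)) =
     (\<Sum>k\<in>I. c k ^ i) * esum c I (Suc q) - (\<Sum>k\<in>I. c k ^ Suc i * esum c (I - {k}) q)"
    by (simp add: sum.distrib sum_distrib_right)
  then have "\<bar>\<Sum>k\<in>I. c k ^ i * esum c (I - {k}) (Suc q)\<bar> \<le>
     \<bar>\<Sum>k\<in>I. c k ^ i\<bar> * \<bar>esum c I (Suc q)\<bar> + \<bar>\<Sum>k\<in>I. c k ^ Suc i * esum c (I - {k}) q\<bar>"
    by (simp only: abs_mult[symmetric] abs_triangle_ineq4)
  also have "\<dots> \<le> 1 * \<bar>esum c I (Suc q)\<bar> + (\<Sum>j\<le>q. \<bar>esum c I j\<bar>)"
    using Suc.IH[of "Suc i"] Suc.prems abs_power_sum_le_1[OF assms(1,2), of i]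
    by (intro add_mono mult_right_mono) auto
  finally show ?case by simp
qed

text \<open>Multiplication by the first power sum raises the degree by one; the factor
  \<open>q + 1\<close> comes from the top term of Newton's identity, and all remaining terms contain
  power sums of order at least 2.\<close>

lemma abs_sum_mult_esum_le:
  fixes c :: "'a \<Rightarrow> real"
  assumes "finite I" "(\<Sum>k\<in>I. (c k)\<^sup>2) \<le> 1"
  shows "\<bar>\<Sum>k\<in>I. c k\<bar> * \<bar>esum c I q\<bar> \<le> real (Suc q) * (\<Sum>j\<le>Suc q. \<bar>esum c I j\<bar>)"
proof (cases q)
  case 0
  then show ?thesis using assms by (simp add: esum_1 sum_nonneg)
next
  case (Suc r)
  have "(\<Sum>k\<in>I. c k * esum c I (Suc r)) =
     (\<Sum>k\<in>I. c k * esum c (I - {k}) (Suc r) + c k ^ 2 * esum c (I - {k}) r)"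
    using assms by (intro sum.cong refl) (simp add: esum_remove[of I _ c r] algebra_simps power2_eq_square)
  then have "(\<Sum>k\<in>I. c k) * esum c I (Suc r) = real (Suc q) * esum c I (Suc q) + (\<Sum>k\<in>I. c k ^ 2 * esum c (I - {k}) r)"
    using sum_mult_esum_remove[OF assms(1), of c "Suc r"] Suc
    by (simp add: sum.distrib sum_distrib_right)
  then have "\<bar>\<Sum>k\<in>I. c k\<bar> * \<bar>esum c I q\<bar> \<le> real (Suc q) * \<bar>esum c I (Suc q)\<bar> + \<bar>\<Sum>k\<in>I. c k ^ 2 * esum c (I - {k}) r\<bar>"
    unfolding abs_mult[symmetric] Suc using abs_triangle_ineq[of "real (Suc q) * esum c I (Suc q)"] by (simp add: abs_mult Suc)
  also have "\<dots> \<le> real (Suc q) * \<bar>esum c I (Suc q)\<bar> + 1 * (\<Sum>j\<le>r. \<bar>esum c I j\<bar>)"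
    using abs_sum_power_mult_esum_le[OF assms, of 2 r] by simp
  also have "\<dots> \<le> real (Suc q) * \<bar>esum c I (Suc q)\<bar> + real (Suc q) * (\<Sum>j\<le>q. \<bar>esum c I j\<bar>)"
    using Suc by (intro add_left_mono mult_mono sum_mono2 sum_nonneg) auto
  finally show ?thesis by (simp add: algebra_simps)
qed

text \<open>This replaces the expansion of a power of the sum, whose linear relations could have
  large coefficients on few frequencies. The right-hand side is multilinear in the
  \<open>c k\<close>, so its mean squares involve coefficients up to 2 only. Each multiplication by
  the sum costs \<open>(q + 1) * (q + 1)\<close>, whence the squared factorial.\<close>

lemma abs_sum_power_le_esum:
  fixes c :: "'a \<Rightarrow> real"
  assumes "finite I" "(\<Sum>k\<in>I. (c k)\<^sup>2) \<le> 1"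
  shows "\<bar>\<Sum>k\<in>I. c k\<bar> ^ q \<le> (fact q)\<^sup>2 * (\<Sum>j\<le>q. \<bar>esum c I j\<bar>)"
proof (induction q)
  case 0
  then show ?case using assms by simp
next
  case (Suc q)
  let ?B = "\<lambda>q. \<Sum>j\<le>q. \<bar>esum c I j\<bar>"
  have *: "\<bar>\<Sum>k\<in>I. c k\<bar> * \<bar>esum c I j\<bar> \<le> real (Suc q) * ?B (Suc q)" if "j \<le> q" for j
  proof -
    have "\<bar>\<Sum>k\<in>I. c k\<bar> * \<bar>esum c I j\<bar> \<le> real (Suc j) * ?B (Suc j)"
      by (rule abs_sum_mult_esum_le[OF assms])
    also have "\<dots> \<le> real (Suc q) * ?B (Suc q)"
      using that by (intro mult_mono sum_mono2 sum_nonneg) auto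
    finally show ?thesis .
  qed
  have "\<bar>\<Sum>k\<in>I. c k\<bar> ^ Suc q \<le> \<bar>\<Sum>k\<in>I. c k\<bar> * ((fact q)\<^sup>2 * ?B q)"
    using Suc by (simp add: mult_left_mono)
  also have "\<dots> = (fact q)\<^sup>2 * (\<Sum>j\<le>q. \<bar>\<Sum>k\<in>I. c k\<bar> * \<bar>esum c I j\<bar>)"
    by (simp add: sum_distrib_left mult_ac)
  also have "\<dots> \<le> (fact q)\<^sup>2 * (\<Sum>j\<le>q. real (Suc q) * ?B (Suc q))"
    using * by (intro mult_left_mono sum_mono) auto
  also have "\<dots> = (fact (Suc q))\<^sup>2 * ?B (Suc q)"
    by (simp add: power2_eq_square algebra_simps)
  finally show ?case .
qed

section \<open>Logarithms of products of factors close to 1\<close>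

text \<open>Both the remainder \<open>f\<close> and \<open>x ^ 3 - f x\<close> are nondecreasing on
  the interval and vanish at 0, which settles positive and negative \<open>x\<close> together:
  \<open>f' y = y\<^sup>2 / (1 + y)\<close> lies between 0 and \<open>3 * y\<^sup>2\<close>.\<close>

lemma ln_one_plus_taylor2:
  fixes x :: real
  assumes "\<bar>x\<bar> \<le> 1/2"
  shows "\<bar>ln (1 + x) - (x - x\<^sup>2 / 2)\<bar> \<le> \<bar>x\<bar> ^ 3"
proof -
  define f where "f = (\<lambda>x::real. ln (1 + x) - (x - x\<^sup>2 / 2))"
  have f': "(f has_real_derivative y\<^sup>2 / (1 + y)) (at y)" if "\<bar>y\<bar> \<le> 1/2" for y
    unfolding f_def using that
    by (auto intro!: derivative_eq_intros simp: field_simps power2_eq_square)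
  have g': "((\<lambda>x. x ^ 3 - f x) has_real_derivative 3 * y\<^sup>2 - y\<^sup>2 / (1 + y)) (at y)" if "\<bar>y\<bar> \<le> 1/2" for y
    using f'[OF that] by (auto intro!: derivative_eq_intros)
  have mono_f: "f a \<le> f b" if "a \<le> b" "- (1/2) \<le> a" "b \<le> 1/2" for a b
  proof (rule DERIV_nonneg_imp_nondecreasing[OF that(1)])
    fix y assume "a \<le> y" "y \<le> b"
    then have "\<bar>y\<bar> \<le> 1/2" using that by linarith
    then show "\<exists>z. (f has_real_derivative z) (at y) \<and> 0 \<le> z" using f'[of y] by (intro exI[of _ "y\<^sup>2/(1+y)"]) auto
  qed
  have mono_g: "a ^ 3 - f a \<le> b ^ 3 - f b" if "a \<le> b" "- (1/2) \<le> a" "b \<le> 1/2" for a b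
  proof (rule DERIV_nonneg_imp_nondecreasing[OF that(1)])
    fix y assume "a \<le> y" "y \<le> b"
    then have y: "\<bar>y\<bar> \<le> 1/2" using that by linarith
    then have "y\<^sup>2 / (1 + y) \<le> y\<^sup>2 / (1/2)" by (intro divide_left_mono) auto
    also have "\<dots> \<le> 3 * y\<^sup>2" by simp
    finally show "\<exists>z. ((\<lambda>x. x ^ 3 - f x) has_real_derivative z) (at y) \<and> 0 \<le> z" using g'[OF y]
      by (intro exI[of _ "3 * y\<^sup>2 - y\<^sup>2/(1+y)"]) auto
  qed
  have f0: "f 0 = 0" by (simp add: f_def)
  have "\<bar>f x\<bar> \<le> \<bar>x\<bar> ^ 3"
  proof (cases "x \<ge> 0")
    case True
    then show ?thesis using mono_f[of 0 x] mono_g[of 0 x] assms f0 by auto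
  next
    case False
    then have "\<bar>x\<bar> ^ 3 = - (x ^ 3)" by (simp add: abs_if)
    then show ?thesis using mono_f[of x 0] mono_g[of x 0] assms f0 False by auto
  qed
  then show ?thesis by (simp add: f_def)
qed

lemma abs_ln_prod_one_plus_le:
  fixes c :: "'a \<Rightarrow> real"
  assumes "finite I" "\<And>k. k \<in> I \<Longrightarrow> \<bar>c k\<bar> \<le> 1" "\<bar>l\<bar> \<le> 1/2"
  shows "(\<Prod>k\<in>I. 1 + l * c k) > 0"
    and "\<bar>ln (\<Prod>k\<in>I. 1 + l * c k) - (l * (\<Sum>k\<in>I. c k) - l\<^sup>2 / 2 * (\<Sum>k\<in>I. (c k)\<^sup>2))\<bar> \<le> \<bar>l\<bar> ^ 3 * card I"
proof -
  have small: "\<bar>l * c k\<bar> \<le> 1/2" if "k \<in> I" for k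
    using assms(2)[OF that] assms(3) mult_mono[of "\<bar>l\<bar>" "1/2" "\<bar>c k\<bar>" 1] by (simp add: abs_mult)
  then have pos: "1 + l * c k > 0" if "k \<in> I" for k
    using that by (smt (verit) field_sum_of_halves)
  then show "(\<Prod>k\<in>I. 1 + l * c k) > 0" by (simp add: prod_pos)
  have "ln (\<Prod>k\<in>I. 1 + l * c k) = (\<Sum>k\<in>I. ln (1 + l * c k))"
    using pos assms by (intro ln_prod) (auto simp: less_imp_neq[symmetric])
  then have "\<bar>ln (\<Prod>k\<in>I. 1 + l * c k) - (l * (\<Sum>k\<in>I. c k) - l\<^sup>2 / 2 * (\<Sum>k\<in>I. (c k)\<^sup>2))\<bar>
      = \<bar>\<Sum>k\<in>I. ln (1 + l * c k) - (l * c k - (l * c k)\<^sup>2 / 2)\<bar>"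
    by (simp add: sum_subtractf sum_distrib_left power_mult_distrib sum.distrib)
  also have "\<dots> \<le> (\<Sum>k\<in>I. \<bar>ln (1 + l * c k) - (l * c k - (l * c k)\<^sup>2 / 2)\<bar>)" by (rule sum_abs)
  also have "\<dots> \<le> (\<Sum>k\<in>I. \<bar>l\<bar> ^ 3)"
  proof (intro sum_mono)
    fix k assume k: "k \<in> I"
    have "\<bar>ln (1 + l * c k) - (l * c k - (l * c k)\<^sup>2 / 2)\<bar> \<le> \<bar>l * c k\<bar> ^ 3"
      by (rule ln_one_plus_taylor2[OF small[OF k]])
    also have "\<dots> \<le> \<bar>l\<bar> ^ 3"
      using assms(2)[OF k] by (intro power_mono) (auto simp: abs_mult mult_left_le)
    finally show "\<bar>ln (1 + l * c k) - (l * c k - (l * c k)\<^sup>2 / 2)\<bar> \<le> \<bar>l\<bar> ^ 3" .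
  qed
  also have "\<dots> = \<bar>l\<bar> ^ 3 * card I" by simp
  finally show "\<bar>ln (\<Prod>k\<in>I. 1 + l * c k) - (l * (\<Sum>k\<in>I. c k) - l\<^sup>2 / 2 * (\<Sum>k\<in>I. (c k)\<^sup>2))\<bar> \<le> \<bar>l\<bar> ^ 3 * card I" .
qed

section \<open>Integration over the unit interval\<close>

lemma prob_space_unit_interval: "prob_space unit_interval_measure"
  unfolding unit_interval_measure_def
  by (rule prob_space_restrict_space) auto

lemma space_unit_interval [simp]: "space unit_interval_measure = {0..1}"
  by (simp add: unit_interval_measure_def)

lemma measurable_unit_interval [measurable (raw)]:
  "f \<in> borel_measurable borel \<Longrightarrow> f \<in> borel_measurable unit_interval_measure"
  unfolding unit_interval_measure_def by (intro measurable_restrict_space1) simp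

lemma integrable_continuous_unit_interval:
  fixes f :: "real \<Rightarrow> 'b::{banach,second_countable_topology}"
  assumes "continuous_on UNIV f"
  shows "integrable unit_interval_measure f"
proof -
  interpret prob_space unit_interval_measure by (rule prob_space_unit_interval)
  have "compact (f ` {0..1})"
    using assms by (intro compact_continuous_image) (auto intro: continuous_on_subset)
  then obtain B where "\<And>x. x \<in> {0..1} \<Longrightarrow> norm (f x) \<le> B"
    using compact_imp_bounded bounded_iff by (metis image_eqI)
  then show ?thesis
    using assms by (intro integrable_const_bound[of _ B] AE_I2 measurable_unit_interval borel_measurable_continuous_onI) auto
qed

lemma integral_cis_unit_interval:
  fixes j :: int
  shows "(\<E> x. cis (2 * pi * of_int j * x)) = (if j = 0 then 1 else 0)"
proof (cases "j = 0")
  case True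
  interpret prob_space unit_interval_measure by (rule prob_space_unit_interval)
  show ?thesis using True prob_space by simp
next
  case False
  define a where "a = 2 * pi * real_of_int j"
  have a: "a \<noteq> 0" using False by (simp add: a_def)
  have d: "((\<lambda>x. cis (a * x) / (\<i> * a)) has_vector_derivative cis (a * x)) (at x within {0..1})" for x
  proof -
    have "((\<lambda>z. exp (\<i> * complex_of_real a * z) / (\<i> * a)) has_field_derivative exp (\<i> * complex_of_real a * z)) (at z within S)" for z S
      using a by (auto intro!: derivative_eq_intros)
    from has_vector_derivative_real_field[OF this]
    have "((\<lambda>x. exp (\<i> * complex_of_real a * complex_of_real x) / (\<i> * a)) has_vector_derivative exp (\<i> * complex_of_real a * complex_of_real x)) (at x within {0..1})"
      by (simp add: o_def)
    then show ?thesis by (simp add: cis_conv_exp mult.assoc)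
  qed
  have "(\<E> x. cis (a * x)) = (LBINT x:{0..1}. cis (a * x))"
    unfolding unit_interval_measure_def set_lebesgue_integral_def
    by (subst integral_restrict_space) auto
  also have "\<dots> = cis (a * 1) / (\<i> * a) - cis (a * 0) / (\<i> * a)"
    unfolding set_lebesgue_integral_def
    by (rule integral_FTC_atLeastAtMost) (auto intro!: d continuous_intros)
  also have "cis (a * 1) = 1" unfolding a_def using cis_multiple_2pi[of "real_of_int j"] by (simp)
  finally show ?thesis using False by (simp add: a_def)
qed

lemma continuous_on_esum [continuous_intros]:
  fixes c :: "'a \<Rightarrow> 'c::topological_space \<Rightarrow> 'b::{real_normed_field}"
  shows "(\<And>k. k \<in> I \<Longrightarrow> continuous_on S (c k)) \<Longrightarrow> continuous_on S (\<lambda>x. esum (\<lambda>k. c k x) I p)"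
  unfolding esum_def by (auto intro!: continuous_intros)

lemma continuous_on_tsum [continuous_intros]:
  fixes c :: "'a \<Rightarrow> 'c::topological_space \<Rightarrow> 'b::{real_normed_field}"
  shows "(\<And>k. k \<in> I \<Longrightarrow> continuous_on S (c k)) \<Longrightarrow> continuous_on S (\<lambda>x. tsum (\<lambda>k. c k x) I D z)"
  unfolding tsum_def by (auto intro!: continuous_intros)

lemma tsum_eq_sum_subsets:
  assumes "finite I"
  shows "tsum c I D z = (\<Sum>A | A \<subseteq> I \<and> card A \<le> D. \<Prod>k\<in>A. z * c k)"
proof -
  have "(\<Sum>A | A \<subseteq> I \<and> card A \<le> D. \<Prod>k\<in>A. z * c k) =
      (\<Sum>p\<le>D. \<Sum>A | A \<in> {A. A \<subseteq> I \<and> card A \<le> D} \<and> card A = p. \<Prod>k\<in>A. z * c k)"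
    using assms by (intro sum.group [symmetric]) auto
  also have "\<dots> = (\<Sum>p\<le>D. esum (\<lambda>k. z * c k) I p)"
    unfolding esum_def by (intro sum.cong) auto
  finally show ?thesis by (simp add: tsum_def esum_scale)
qed

text \<open>A union of subsets of two disjoint blocks determines both parts, so the product is again
  a multilinear sum over one family of subsets, with weights depending on the block. The mean square
  bound for such sums then applies to pairs of blocks; this is why it allows a weight
  \<open>w k\<close> for each index.\<close>

lemma tsum_mult_tsum:
  fixes c :: "'a \<Rightarrow> 'b::comm_semiring_1"
  assumes "finite I" "finite J" "I \<inter> J = {}"
  shows "tsum c I D y * tsum c J D z =
    (\<Sum>A | A \<subseteq> I \<union> J \<and> card (A \<inter> I) \<le> D \<and> card (A \<inter> J) \<le> D. \<Prod>k\<in>A. (if k \<in> I then y else z) * c k)"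
proof -
  let ?X = "{A. A \<subseteq> I \<and> card A \<le> D}" and ?Y = "{A. A \<subseteq> J \<and> card A \<le> D}"
  have "tsum c I D y * tsum c J D z = (\<Sum>(A,B)\<in>?X \<times> ?Y. (\<Prod>k\<in>A. y * c k) * (\<Prod>k\<in>B. z * c k))"
    unfolding tsum_eq_sum_subsets[OF assms(1)] tsum_eq_sum_subsets[OF assms(2)]
    by (simp add: sum_product sum.cartesian_product)
  also have "\<dots> = (\<Sum>A | A \<subseteq> I \<union> J \<and> card (A \<inter> I) \<le> D \<and> card (A \<inter> J) \<le> D. \<Prod>k\<in>A. (if k \<in> I then y else z) * c k)"
  proof (rule sum.reindex_bij_witness[where j = "\<lambda>(A,B). A \<union> B" and i = "\<lambda>A. (A \<inter> I, A \<inter> J)"])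
    fix a assume "a \<in> ?X \<times> ?Y"
    then obtain A B where a: "a = (A,B)" "A \<subseteq> I" "B \<subseteq> J" "card A \<le> D" "card B \<le> D" by auto
    have *: "(A \<union> B) \<inter> I = A" "(A \<union> B) \<inter> J = B" using a assms by auto
    show "((case a of (A,B) \<Rightarrow> A \<union> B) \<inter> I, (case a of (A,B) \<Rightarrow> A \<union> B) \<inter> J) = a"
      using * a by simp
    show "(case a of (A,B) \<Rightarrow> A \<union> B) \<in> {A. A \<subseteq> I \<union> J \<and> card (A \<inter> I) \<le> D \<and> card (A \<inter> J) \<le> D}"
      using a by (auto simp: *)
    have fin: "finite A" "finite B" "A \<inter> B = {}" using a assms by (auto intro: finite_subset)
    have "(\<Prod>k\<in>A \<union> B. (if k \<in> I then y else z) * c k) =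
       (\<Prod>k\<in>A. (if k \<in> I then y else z) * c k) * (\<Prod>k\<in>B. (if k \<in> I then y else z) * c k)"
      by (rule prod.union_disjoint[OF fin])
    also have "(\<Prod>k\<in>A. (if k \<in> I then y else z) * c k) = (\<Prod>k\<in>A. y * c k)"
      using a by (intro prod.cong) auto
    also have "(\<Prod>k\<in>B. (if k \<in> I then y else z) * c k) = (\<Prod>k\<in>B. z * c k)"
      using a assms by (intro prod.cong) auto
    finally show "(\<Prod>k\<in>(case a of (A,B) \<Rightarrow> A \<union> B). (if k \<in> I then y else z) * c k) =
        (case a of (A,B) \<Rightarrow> (\<Prod>k\<in>A. y * c k) * (\<Prod>k\<in>B. z * c k))"
      using a by simp
  qed (use assms in auto)
  finally show ?thesis .
qed

lemma cis_sum: "finite I \<Longrightarrow> cis (\<Sum>k\<in>I. f k) = (\<Prod>k\<in>I. cis (f k))"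
  by (induction I rule: finite_induct) (auto simp: cis_mult [symmetric])

section \<open>Square means of cosine products\<close>

definition cosf :: "(nat \<Rightarrow> nat) \<Rightarrow> nat \<Rightarrow> real \<Rightarrow> real" where
  "cosf m k x = cos (2 * pi * real (m k) * x)"

lemma continuous_on_cosf [continuous_intros]: "continuous_on S (cosf m k)"
  unfolding cosf_def by (intro continuous_intros)

lemma abs_cosf_le_1: "\<bar>cosf m k x\<bar> \<le> 1"
  by (simp add: cosf_def)

definition freq :: "(nat \<Rightarrow> nat) \<Rightarrow> nat set \<Rightarrow> (nat \<Rightarrow> int) \<Rightarrow> int" where
  "freq m I v = (\<Sum>k\<in>I. v k * int (m k))"

definition supp_on :: "nat set \<Rightarrow> (nat \<Rightarrow> int) \<Rightarrow> nat set" where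
  "supp_on I v = {k\<in>I. v k \<noteq> 0}"

text \<open>Linear relations with a prescribed number of terms. The range \<open>{-2..2}\<close>
  holds the sums of two sign vectors; extensional functions make each relation a single object, so
  that counting is meaningful.\<close>

definition rels :: "(nat \<Rightarrow> nat) \<Rightarrow> nat set \<Rightarrow> nat \<Rightarrow> (nat \<Rightarrow> int) set" where
  "rels m I r = {u \<in> I \<rightarrow>\<^sub>E {-2..2}. freq m I u = 0 \<and> card (supp_on I u) = r}"

lemma finite_rels: "finite I \<Longrightarrow> finite (rels m I r)"
  unfolding rels_def by (rule finite_subset[of _ "I \<rightarrow>\<^sub>E {-2..2}"]) (auto intro!: finite_PiE)

text \<open>Index set of the exponentials in a sum of cosine products over the sets of
  \<open>\<A>\<close>: the support of \<open>v\<close> is the set that is multiplied, and the sign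
  selects one of the two exponentials in each cosine.\<close>

definition signs :: "nat set \<Rightarrow> nat set set \<Rightarrow> (nat \<Rightarrow> int) set" where
  "signs I \<A> = {v \<in> I \<rightarrow>\<^sub>E {-1,0,1}. supp_on I v \<in> \<A>}"

lemma finite_signs: "finite I \<Longrightarrow> finite (signs I \<A>)"
  unfolding signs_def by (rule finite_subset[of _ "I \<rightarrow>\<^sub>E {-1,0,1}"]) (auto intro!: finite_PiE)

definition sign_weight :: "(nat \<Rightarrow> real) \<Rightarrow> nat set \<Rightarrow> (nat \<Rightarrow> int) \<Rightarrow> real" where
  "sign_weight w I v = (\<Prod>k\<in>I. if v k = 0 then 1 else w k / 2)"

lemma cos_product_expansion:
  assumes "finite I" "\<A> \<subseteq> Pow I"
  shows "complex_of_real (\<Sum>A\<in>\<A>. \<Prod>k\<in>A. w k * cosf m k x) =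
    (\<Sum>v\<in>signs I \<A>. of_real (sign_weight w I v) * cis (2 * pi * of_int (freq m I v) * x))"
proof -
  let ?h = "\<lambda>k a. complex_of_real (if a = 0 then 1 else w k / 2) * cis (2 * pi * of_int a * real (m k) * x)"
  let ?g = "\<lambda>v. complex_of_real (sign_weight w I v) * cis (2 * pi * of_int (freq m I v) * x)"
  have g: "?g v = (\<Prod>k\<in>I. ?h k (v k))" for v
  proof -
    have "cis (2 * pi * of_int (freq m I v) * x) = cis (\<Sum>k\<in>I. 2 * pi * of_int (v k) * real (m k) * x)"
      by (simp add: freq_def sum_distrib_left sum_distrib_right mult_ac)
    then show ?thesis
      unfolding sign_weight_def cis_sum[OF assms(1)] prod.distrib of_real_prod by simp
  qed
  have "(\<Sum>v\<in>signs I \<A>. ?g v) = (\<Sum>A\<in>\<A>. \<Sum>v | v \<in> signs I \<A> \<and> supp_on I v = A. ?g v)"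
    using assms finite_signs[of I \<A>] by (intro sum.group [symmetric]) (auto simp: signs_def intro: finite_subset)
  also have "\<dots> = (\<Sum>A\<in>\<A>. complex_of_real (\<Prod>k\<in>A. w k * cosf m k x))"
  proof (intro sum.cong refl)
    fix A assume A: "A \<in> \<A>"
    \<comment> \<open>The sign vectors with support exactly \<open>A\<close> form a product set, so
      the sum over them factorises into one factor per index.\<close>
    let ?B = "\<lambda>k. if k \<in> A then {-1,1} else {0::int}"
    have *: "{v. v \<in> signs I \<A> \<and> supp_on I v = A} = PiE I ?B"
    proof (intro equalityI subsetI)
      fix v assume "v \<in> {v. v \<in> signs I \<A> \<and> supp_on I v = A}"
      then show "v \<in> PiE I ?B" by (auto simp: signs_def supp_on_def PiE_iff)
    next
      fix v assume v: "v \<in> PiE I ?B"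
      then have "v k \<noteq> 0 \<longleftrightarrow> k \<in> A" if "k \<in> I" for k
        using that by (auto simp: PiE_iff split: if_splits dest!: bspec[of _ _ k])
      then have "supp_on I v = A" using A assms by (auto simp: supp_on_def)
      then show "v \<in> {v. v \<in> signs I \<A> \<and> supp_on I v = A}"
        using v A by (auto simp: signs_def PiE_iff split: if_splits)
    qed
    have "(\<Sum>v | v \<in> signs I \<A> \<and> supp_on I v = A. ?g v) = (\<Sum>v\<in>PiE I ?B. \<Prod>k\<in>I. ?h k (v k))"
      unfolding * g by simp
    also have "\<dots> = (\<Prod>k\<in>I. \<Sum>a\<in>?B k. ?h k a)"
      using assms by (intro prod_sum_PiE [symmetric]) auto
    also have "\<dots> = (\<Prod>k\<in>I. if k \<in> A then complex_of_real (w k * cosf m k x) else 1)"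
    proof (intro prod.cong refl)
      fix k
      have "cis (2 * pi * real (m k) * x) + cis (- (2 * pi * real (m k) * x)) = complex_of_real (2 * cosf m k x)"
        by (simp add: complex_eq_iff cosf_def)
      then show "(\<Sum>a\<in>?B k. ?h k a) = (if k \<in> A then complex_of_real (w k * cosf m k x) else 1)"
        by (auto simp: add.commute simp flip: distrib_left add_divide_distrib)
    qed
    also have "\<dots> = complex_of_real (\<Prod>k\<in>A. w k * cosf m k x)"
    proof -
      have "I \<inter> A = A" using A assms by auto
      then show ?thesis using assms by (simp add: prod.If_cases)
    qed
    finally show "(\<Sum>v | v \<in> signs I \<A> \<and> supp_on I v = A. ?g v) = complex_of_real (\<Prod>k\<in>A. w k * cosf m k x)" .
  qed
  finally show ?thesis by simp
qed

lemma integral_cos_products: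
  assumes "finite I" "\<A> \<subseteq> Pow I"
  shows "(\<E> x. (\<Sum>A\<in>\<A>. \<Prod>k\<in>A. w k * cosf m k x)) =
    (\<Sum>v | v \<in> signs I \<A> \<and> freq m I v = 0. sign_weight w I v)"
proof -
  have "complex_of_real (\<E> x. (\<Sum>A\<in>\<A>. \<Prod>k\<in>A. w k * cosf m k x)) =
    (\<E> x. (\<Sum>v\<in>signs I \<A>. of_real (sign_weight w I v) * cis (2 * pi * of_int (freq m I v) * x)))"
    unfolding cos_product_expansion[OF assms, symmetric] by (rule integral_complex_of_real [symmetric])
  also have "\<dots> = (\<Sum>v\<in>signs I \<A>. of_real (sign_weight w I v) * (if freq m I v = 0 then 1 else 0))"
    by (subst Bochner_Integration.integral_sum)
      (auto simp: integral_cis_unit_interval intro!: integrable_continuous_unit_interval continuous_intros)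
  also have "\<dots> = of_real (\<Sum>v | v \<in> signs I \<A> \<and> freq m I v = 0. sign_weight w I v)"
    using finite_signs[OF assms(1)] by (simp add: sum.If_cases if_distrib Int_def cong: if_cong)
  finally show ?thesis by (simp only: of_real_eq_iff)
qed

lemma integral_cos_products_square:
  assumes "finite I" "\<A> \<subseteq> Pow I"
  shows "(\<E> x. (\<Sum>A\<in>\<A>. \<Prod>k\<in>A. w k * cosf m k x)\<^sup>2) =
    (\<Sum>v\<in>signs I \<A>. \<Sum>v'\<in>signs I \<A>. if freq m I v + freq m I v' = 0 then sign_weight w I v * sign_weight w I v' else 0)"
proof -
  have "complex_of_real (\<E> x. (\<Sum>A\<in>\<A>. \<Prod>k\<in>A. w k * cosf m k x)\<^sup>2) =
    (\<E> x. (\<Sum>v\<in>signs I \<A>. of_real (sign_weight w I v) * cis (2 * pi * of_int (freq m I v) * x))\<^sup>2)"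
    unfolding cos_product_expansion[OF assms, symmetric] of_real_power [symmetric]
    by (rule integral_complex_of_real [symmetric])
  also have "\<dots> = (\<E> x. (\<Sum>v\<in>signs I \<A>. \<Sum>v'\<in>signs I \<A>.
       of_real (sign_weight w I v * sign_weight w I v') * cis (2 * pi * of_int (freq m I v + freq m I v') * x)))"
    by (simp add: power2_eq_square sum_product algebra_simps cis_mult [symmetric])
  also have "\<dots> = (\<Sum>v\<in>signs I \<A>. \<Sum>v'\<in>signs I \<A>.
       of_real (sign_weight w I v * sign_weight w I v') * (if freq m I v + freq m I v' = 0 then 1 else 0))"
    by (simp only: Bochner_Integration.integral_sum integrable_continuous_unit_interval continuous_intros
       Bochner_Integration.integral_mult_right_zero integral_cis_unit_interval continuous_on_cis
       continuous_on_sum continuous_on_mult continuous_on_const continuous_on_id)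
  also have "\<dots> = of_real (\<Sum>v\<in>signs I \<A>. \<Sum>v'\<in>signs I \<A>. if freq m I v + freq m I v' = 0 then sign_weight w I v * sign_weight w I v' else 0)"
    unfolding of_real_sum by (intro sum.cong refl) auto
  finally show ?thesis by (simp only: of_real_eq_iff)
qed

section \<open>Means and mean squares from counts of linear relations\<close>

text \<open>All that the analysis retains of Condition R: a bound on the number of relations with
  \<open>r\<close> terms that is uniform in the finite set \<open>I\<close>, hence insensitive to
  \<open>N\<close> and to the order of the frequencies. \<open>K_1\<close> says that a single term
  never vanishes.\<close>

locale cos_system =
  fixes m :: "nat \<Rightarrow> nat" and K :: "nat \<Rightarrow> real"
  assumes card_rels_le: "\<lbrakk>finite I; I \<subseteq> {1..}; r \<ge> 1\<rbrakk> \<Longrightarrow> real (card (rels m I r)) \<le> K r"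
    and K_1: "K (Suc 0) = 0"
begin

text \<open>Total weight of the nontrivial relations when every frequency in the support contributes
  a factor \<open>\<mu>\<close>. The trivial relation is the separate 1 in the bounds of the form
  \<open>1 + rel_series\<close>.\<close>

definition rel_series :: "nat \<Rightarrow> real \<Rightarrow> real" where
  "rel_series D \<mu> = (\<Sum>r=1..D. K r * \<mu> ^ r)"

lemma K_nonneg: "r \<ge> 1 \<Longrightarrow> K r \<ge> 0"
  using card_rels_le[of "{}" r] by simp

lemma rel_series_nonneg: "\<mu> \<ge> 0 \<Longrightarrow> rel_series D \<mu> \<ge> 0"
  unfolding rel_series_def by (intro sum_nonneg mult_nonneg_nonneg K_nonneg) auto

lemma rel_series_mono: "0 \<le> \<mu> \<Longrightarrow> \<mu> \<le> \<nu> \<Longrightarrow> D \<le> E \<Longrightarrow> rel_series D \<mu> \<le> rel_series E \<nu>"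
proof -
  assume a: "0 \<le> \<mu>" "\<mu> \<le> \<nu>" "D \<le> E"
  have "rel_series D \<mu> \<le> rel_series D \<nu>"
    unfolding rel_series_def using a by (intro sum_mono mult_left_mono power_mono K_nonneg) auto
  also have "\<dots> \<le> rel_series E \<nu>"
    unfolding rel_series_def using a by (intro sum_mono2 mult_nonneg_nonneg K_nonneg) auto
  finally show ?thesis .
qed

lemma abs_integral_esum_le:
  assumes "finite I" "I \<subseteq> {1..}" "p \<ge> 1"
  shows "\<bar>\<E> x. esum (\<lambda>k. cosf m k x) I p\<bar> \<le> K p"
proof -
  let ?A = "{A. A \<subseteq> I \<and> card A = p}"
  let ?V = "{v \<in> signs I ?A. freq m I v = 0}"
  have "(\<E> x. esum (\<lambda>k. cosf m k x) I p) = (\<Sum>v\<in>?V. sign_weight (\<lambda>_. 1) I v)"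
    using integral_cos_products[OF assms(1), of ?A "\<lambda>_. 1" m] by (auto simp: esum_def)
  also have "\<bar>\<dots>\<bar> \<le> (\<Sum>v\<in>?V. \<bar>sign_weight (\<lambda>_. 1) I v\<bar>)" by (rule sum_abs)
  also have "\<dots> \<le> (\<Sum>v\<in>?V. 1)"
    unfolding sign_weight_def abs_prod by (intro sum_mono prod_le_1) auto
  also have "\<dots> = real (card ?V)" by simp
  also have "\<dots> \<le> real (card (rels m I p))"
  proof -
    have "?V \<subseteq> rels m I p"
      unfolding signs_def rels_def by (force simp: PiE_iff)
    then show ?thesis using finite_rels[OF assms(1)] by (simp add: card_mono)
  qed
  also have "\<dots> \<le> K p" by (rule card_rels_le[OF assms])
  finally show ?thesis .
qed

lemma sum_supp_power_le:
  assumes "finite I" "I \<subseteq> {1..}" "\<mu> \<ge> 0"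
  shows "(\<Sum>u | u \<in> I \<rightarrow>\<^sub>E {-2..2} \<and> freq m I u = 0 \<and> card (supp_on I u) \<le> D. \<mu> ^ card (supp_on I u)) \<le> 1 + rel_series D \<mu>"
proof -
  let ?U = "{u. u \<in> I \<rightarrow>\<^sub>E {-2..2} \<and> freq m I u = 0 \<and> card (supp_on I u) \<le> D}"
  have fin: "finite ?U"
    by (rule finite_subset[of _ "I \<rightarrow>\<^sub>E {-2..2}"]) (auto intro!: finite_PiE assms)
  have "(\<Sum>u\<in>?U. \<mu> ^ card (supp_on I u)) = (\<Sum>r\<le>D. \<Sum>u | u \<in> ?U \<and> card (supp_on I u) = r. \<mu> ^ card (supp_on I u))"
    using fin by (intro sum.group [symmetric]) auto
  also have "\<dots> = (\<Sum>r\<le>D. real (card (rels m I r)) * \<mu> ^ r)"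
  proof (intro sum.cong refl)
    fix r assume "r \<in> {..D}"
    then have "{u. u \<in> ?U \<and> card (supp_on I u) = r} = rels m I r"
      by (auto simp: rels_def)
    moreover have "(\<Sum>u\<in>rels m I r. \<mu> ^ card (supp_on I u)) = (\<Sum>u\<in>rels m I r. \<mu> ^ r)"
      by (intro sum.cong) (auto simp: rels_def)
    ultimately show "(\<Sum>u | u \<in> ?U \<and> card (supp_on I u) = r. \<mu> ^ card (supp_on I u)) = real (card (rels m I r)) * \<mu> ^ r"
      by simp
  qed
  also have "\<dots> = real (card (rels m I 0)) + (\<Sum>r=1..D. real (card (rels m I r)) * \<mu> ^ r)"
    by (simp add: atMost_atLeast0 sum.atLeast_Suc_atMost)
  also have "\<dots> \<le> 1 + rel_series D \<mu>"
    unfolding rel_series_def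
  proof (intro add_mono sum_mono mult_right_mono card_rels_le assms)
    have "rels m I 0 \<subseteq> {\<lambda>k\<in>I. 0}"
      using assms by (auto simp: rels_def supp_on_def fun_eq_iff PiE_def extensional_def)
    then have "card (rels m I 0) \<le> card {\<lambda>k\<in>I. 0::int}" by (intro card_mono) auto
    then show "real (card (rels m I 0)) \<le> 1" by simp
  qed (use assms in auto)
  finally show ?thesis .
qed

text \<open>Expanding the square over pairs of sign vectors and collecting the pairs by their sum
  \<open>u \<in> {-2..2}\<close>, the diagonal \<open>u = 0\<close> gives the exponential factor, every other \<open>u\<close> is a
  genuine linear relation between the frequencies.\<close>

lemma integral_square_le:
  assumes I: "finite I" "I \<subseteq> {1..}" and \<A>: "\<A> \<subseteq> Pow I" "\<And>A. A \<in> \<A> \<Longrightarrow> card A \<le> D"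
    and w: "\<And>k. k \<in> I \<Longrightarrow> \<bar>w k\<bar> \<le> \<mu>" and \<mu>: "0 \<le> \<mu>" "\<mu> \<le> 1"
  shows "(\<E> x. (\<Sum>A\<in>\<A>. \<Prod>k\<in>A. w k * cosf m k x)\<^sup>2)
    \<le> exp (\<Sum>k\<in>I. (w k)\<^sup>2 / 2) * (1 + rel_series (2 * D) \<mu>)"
proof -
  \<comment> \<open>The value 0 for \<open>\<bar>a\<bar> \<ge> 2\<close> allows
    \<open>W (\<lambda>k. u k - v k)\<close> to be written for every \<open>u\<close> and
    \<open>v\<close>: it vanishes when the difference is not a sign vector.\<close>
  define wx where "wx = (\<lambda>k (a::int). if a = 0 then 1 else if \<bar>a\<bar> = 1 then \<bar>w k\<bar> / 2 else 0)"
  define W where "W = (\<lambda>v. \<Prod>k\<in>I. wx k (v k))"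
  define U where "U = {u. u \<in> I \<rightarrow>\<^sub>E {-2..2} \<and> freq m I u = 0 \<and> card (supp_on I u) \<le> 2 * D}"
  let ?V = "signs I \<A>" and ?P = "I \<rightarrow>\<^sub>E {-1,0,1::int}"
  have wx0: "wx k a \<ge> 0" for k a by (simp add: wx_def)
  have W0: "W v \<ge> 0" for v unfolding W_def by (intro prod_nonneg) (simp add: wx0)
  have finU: "finite U"
    unfolding U_def by (rule finite_subset[of _ "I \<rightarrow>\<^sub>E {-2..2}"]) (auto intro!: finite_PiE I)
  have finV: "finite ?V" and finP: "finite ?P" using I by (auto intro: finite_signs finite_PiE)
  have WV: "\<bar>sign_weight w I v\<bar> = W v" if "v \<in> ?V" for v
  proof -
    have "v k = -1 \<or> v k = 0 \<or> v k = 1" if "k \<in> I" for k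
      using \<open>v \<in> ?V\<close> that by (auto simp: signs_def PiE_def Pi_def)
    then show ?thesis unfolding sign_weight_def W_def abs_prod
      by (intro prod.cong refl) (fastforce simp: wx_def)
  qed
  \<comment> \<open>For fixed \<open>v\<close> the map from \<open>v'\<close> to the sum
    \<open>v + v'\<close> is injective, and vanishing of the total frequency makes its image a set
    of relations with at most \<open>2 * D\<close> terms.\<close>
  have step: "(\<Sum>v'\<in>?V. if freq m I v + freq m I v' = 0 then W v' else 0) \<le> (\<Sum>u\<in>U. W (\<lambda>k. u k - v k))"
    if v: "v \<in> ?V" for v
  proof -
    let ?V' = "{v' \<in> ?V. freq m I v + freq m I v' = 0}" and ?h = "\<lambda>v'. \<lambda>k\<in>I. v k + v' k"
    have inj: "inj_on ?h ?V'"
    proof (rule inj_onI)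
      fix a b assume a: "a \<in> ?V'" and b: "b \<in> ?V'" and e: "?h a = ?h b"
      have "a k = b k" if "k \<in> I" for k using fun_cong[OF e, of k] that by simp
      then show "a = b" using a b by (auto simp: signs_def intro: PiE_ext)
    qed
    have sub: "?h ` ?V' \<subseteq> U"
    proof clarify
      fix v' assume v': "v' \<in> ?V" and f: "freq m I v + freq m I v' = 0"
      have r: "v k \<in> {-1,0,1} \<and> v' k \<in> {-1,0,1}" if "k \<in> I" for k
        using v v' that by (auto simp: signs_def PiE_def Pi_def)
      have "?h v' \<in> I \<rightarrow>\<^sub>E {-2..2}" using r by force
      moreover have "freq m I (?h v') = 0"
        using f by (simp add: freq_def sum.distrib [symmetric] distrib_right cong: sum.cong)
      moreover have "card (supp_on I (?h v')) \<le> 2 * D"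
      proof -
        have s: "supp_on I v \<in> \<A>" "supp_on I v' \<in> \<A>" using v v' by (auto simp: signs_def)
        have "supp_on I (?h v') \<subseteq> supp_on I v \<union> supp_on I v'" by (auto simp: supp_on_def)
        then have "card (supp_on I (?h v')) \<le> card (supp_on I v \<union> supp_on I v')"
          using I by (intro card_mono) (auto simp: supp_on_def)
        also have "\<dots> \<le> card (supp_on I v) + card (supp_on I v')" by (rule card_Un_le)
        also have "\<dots> \<le> D + D" using s \<A> by (intro add_mono) auto
        finally show ?thesis by simp
      qed
      ultimately show "?h v' \<in> U" by (simp add: U_def)
    qed
    have "(\<Sum>v'\<in>?V. if freq m I v + freq m I v' = 0 then W v' else 0) = (\<Sum>v'\<in>?V'. W v')"
      using finV by (simp add: sum.inter_filter)
    also have "\<dots> = (\<Sum>v'\<in>?V'. W (\<lambda>k. ?h v' k - v k))"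
      by (intro sum.cong refl) (simp add: W_def cong: prod.cong)
    also have "\<dots> = (\<Sum>u\<in>?h ` ?V'. W (\<lambda>k. u k - v k))"
      by (simp add: sum.reindex[OF inj])
    also have "\<dots> \<le> (\<Sum>u\<in>U. W (\<lambda>k. u k - v k))"
      using finU sub W0 by (intro sum_mono2) auto
    finally show ?thesis .
  qed
  \<comment> \<open>For fixed \<open>u\<close> the sum over \<open>v\<close> factorises. Where
    \<open>u k = 0\<close> the factor is \<open>1 + (w k)\<^sup>2 / 2\<close>, at most an
    exponential; where \<open>u k = 1\<close> or \<open>u k = -1\<close> it is
    \<open>\<bar>w k\<bar>\<close>, otherwise \<open>(w k)\<^sup>2 / 4\<close>, both at most
    \<open>\<mu>\<close>.\<close>
  have conv: "(\<Sum>v\<in>?P. W v * W (\<lambda>k. u k - v k)) \<le> exp (\<Sum>k\<in>I. (w k)\<^sup>2 / 2) * \<mu> ^ card (supp_on I u)"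
    if u: "u \<in> U" for u
  proof -
    have "(\<Sum>v\<in>?P. W v * W (\<lambda>k. u k - v k)) = (\<Sum>v\<in>?P. \<Prod>k\<in>I. wx k (v k) * wx k (u k - v k))"
      by (simp add: W_def prod.distrib)
    also have "\<dots> = (\<Prod>k\<in>I. \<Sum>a\<in>{-1,0,1}. wx k a * wx k (u k - a))"
      using I by (intro prod_sum_PiE [symmetric]) auto
    also have "\<dots> \<le> (\<Prod>k\<in>I. exp ((w k)\<^sup>2 / 2) * (if u k = 0 then 1 else \<mu>))"
    proof (intro prod_mono conjI)
      fix k assume k: "k \<in> I"
      show "0 \<le> (\<Sum>a\<in>{-1,0,1}. wx k a * wx k (u k - a))"
        by (intro sum_nonneg mult_nonneg_nonneg wx0)
      have "u k \<in> {-2..2}" using u k by (auto simp: U_def PiE_def Pi_def)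
      then consider "u k = 0" | "\<bar>u k\<bar> = 1" | "\<bar>u k\<bar> = 2" by fastforce
      then show "(\<Sum>a\<in>{-1,0,1}. wx k a * wx k (u k - a)) \<le> exp ((w k)\<^sup>2 / 2) * (if u k = 0 then 1 else \<mu>)"
      proof cases
        case 1
        then show ?thesis
          using exp_ge_add_one_self[of "(w k)\<^sup>2 / 2"] by (simp add: wx_def power2_eq_square add.commute)
      next
        case 2
        have "\<bar>w k\<bar> \<le> 1 * \<mu>" using w[OF k] by simp
        also have "\<dots> \<le> exp ((w k)\<^sup>2 / 2) * \<mu>" using \<mu> by (intro mult_right_mono) auto
        finally show ?thesis using 2 by (auto simp: wx_def abs_if split: if_splits)
      next
        case 3
        have "\<bar>w k\<bar> / 2 * (\<bar>w k\<bar> / 2) \<le> 1 * \<mu>"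
          using w[OF k] \<mu> by (intro mult_mono) auto
        also have "\<dots> \<le> exp ((w k)\<^sup>2 / 2) * \<mu>" using \<mu> by (intro mult_right_mono) auto
        finally show ?thesis using 3 by (auto simp: wx_def abs_if split: if_splits)
      qed
    qed
    also have "\<dots> = exp (\<Sum>k\<in>I. (w k)\<^sup>2 / 2) * (\<Prod>k\<in>I. if u k = 0 then 1 else \<mu>)"
      using I by (simp add: prod.distrib exp_sum)
    also have "(\<Prod>k\<in>I. if u k = 0 then 1 else \<mu>) = \<mu> ^ card (supp_on I u)"
    proof -
      have "I \<inter> - {k. u k = 0} = supp_on I u" by (auto simp: supp_on_def)
      then show ?thesis using I by (simp add: prod.If_cases)
    qed
    finally show ?thesis .
  qed
  have "(\<E> x. (\<Sum>A\<in>\<A>. \<Prod>k\<in>A. w k * cosf m k x)\<^sup>2) \<le>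
    (\<Sum>v\<in>?V. \<Sum>v'\<in>?V. if freq m I v + freq m I v' = 0 then W v * W v' else 0)"
    unfolding integral_cos_products_square[OF I(1) \<A>(1)]
    by (intro sum_mono) (auto simp: WV [symmetric] abs_mult [symmetric])
  also have "\<dots> = (\<Sum>v\<in>?V. W v * (\<Sum>v'\<in>?V. if freq m I v + freq m I v' = 0 then W v' else 0))"
    unfolding sum_distrib_left by (intro sum.cong refl) auto
  also have "\<dots> \<le> (\<Sum>v\<in>?V. W v * (\<Sum>u\<in>U. W (\<lambda>k. u k - v k)))"
    by (intro sum_mono mult_left_mono step W0)
  \<comment> \<open>Passing from supports in \<open>\<A>\<close> to all sign vectors is possible
    because the terms are nonnegative, and it is what makes the sum over \<open>v\<close> factorise
    over the indices.\<close>
  also have "\<dots> \<le> (\<Sum>v\<in>?P. W v * (\<Sum>u\<in>U. W (\<lambda>k. u k - v k)))"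
    using finP by (intro sum_mono2 mult_nonneg_nonneg sum_nonneg W0) (auto simp: signs_def)
  also have "\<dots> = (\<Sum>u\<in>U. \<Sum>v\<in>?P. W v * W (\<lambda>k. u k - v k))"
    unfolding sum_distrib_left by (rule sum.swap)
  also have "\<dots> \<le> (\<Sum>u\<in>U. exp (\<Sum>k\<in>I. (w k)\<^sup>2 / 2) * \<mu> ^ card (supp_on I u))"
    by (intro sum_mono conv)
  also have "\<dots> = exp (\<Sum>k\<in>I. (w k)\<^sup>2 / 2) * (\<Sum>u\<in>U. \<mu> ^ card (supp_on I u))"
    by (simp add: sum_distrib_left)
  also have "\<dots> \<le> exp (\<Sum>k\<in>I. (w k)\<^sup>2 / 2) * (1 + rel_series (2 * D) \<mu>)"
    unfolding U_def using \<mu> by (intro mult_left_mono sum_supp_power_le I) auto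
  finally show ?thesis .
qed

end

section \<open>Truncated products and moments\<close>

lemma norm_one_plus_le_exp: "cmod (1 + w) \<le> exp (Re w + (cmod w)\<^sup>2 / 2)"
proof -
  have "(cmod (1 + w))\<^sup>2 = 1 + (2 * Re w + (cmod w)\<^sup>2)"
    unfolding cmod_power2 by (simp add: power2_eq_square algebra_simps)
  also have "\<dots> \<le> exp (2 * Re w + (cmod w)\<^sup>2)" by (rule exp_ge_add_one_self)
  also have "\<dots> = (exp (Re w + (cmod w)\<^sup>2 / 2))\<^sup>2" by (simp add: exp_double [symmetric] distrib_left)
  finally show ?thesis by (rule power2_le_imp_le) simp
qed

text \<open>Cauchy's estimate on the circle of radius \<open>\<rho>\<close>, where the product is controlled by its first
  two power sums only.\<close>

lemma abs_esum_power_le: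
  fixes c :: "'a \<Rightarrow> real"
  assumes "finite I" "\<rho> \<ge> 0"
  shows "\<bar>esum c I p\<bar> * \<rho> ^ p \<le> exp (\<rho> * \<bar>\<Sum>k\<in>I. c k\<bar> + \<rho>\<^sup>2 * (\<Sum>k\<in>I. (c k)\<^sup>2) / 2)" (is "_ \<le> ?B")
proof (cases "p \<le> card I")
  case False
  then show ?thesis using assms by (simp add: esum_eq_0)
next
  case True
  interpret prob_space unit_interval_measure by (rule prob_space_unit_interval)
  \<comment> \<open>Here the unit interval parametrises the circle: the mean of \<open>F\<close>
    over the angle extracts the coefficient of degree \<open>p\<close> of the product.\<close>
  define F where "F = (\<lambda>y. (\<Prod>k\<in>I. 1 + (\<rho> * cis (2 * pi * y)) * of_real (c k)) * cis (- (2 * pi * of_int (int p) * y)))"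
  have F: "F y = (\<Sum>q\<le>card I. of_real (\<rho> ^ q * esum c I q) * cis (2 * pi * of_int (int q - int p) * y))" for y
  proof -
    have *: "(cis (2 * pi * y)) ^ q * cis (- (2 * pi * of_int (int p) * y)) = cis (2 * pi * of_int (int q - int p) * y)" for q
      by (simp add: Complex.DeMoivre cis_mult algebra_simps)
    have "F y = (\<Sum>q\<le>card I. of_real (\<rho> ^ q * esum c I q) * ((cis (2 * pi * y)) ^ q * cis (- (2 * pi * of_int (int p) * y))))"
      unfolding F_def prod_one_plus[OF assms(1)] tsum_def esum_of_real sum_distrib_right
      by (intro sum.cong refl) (simp add: power_mult_distrib mult_ac)
    then show ?thesis unfolding * .
  qed
  have cont: "continuous_on UNIV F" unfolding F_def by (intro continuous_intros)
  have "(\<E> y. F y) = (\<Sum>q\<le>card I. of_real (\<rho> ^ q * esum c I q) * (if int q - int p = 0 then 1 else 0))"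
    unfolding F
    by (subst Bochner_Integration.integral_sum)
      (simp_all only: integral_mult_right_zero integral_cis_unit_interval,
       intro integrable_continuous_unit_interval continuous_intros)
  also have "\<dots> = (\<Sum>q\<le>card I. if q = p then of_real (\<rho> ^ q * esum c I q) else 0)"
    by (intro sum.cong refl) auto
  also have "\<dots> = of_real (\<rho> ^ p * esum c I p)" using True by simp
  finally have "\<bar>esum c I p\<bar> * \<rho> ^ p = cmod (\<E> y. F y)"
    using assms(2) by (simp add: norm_mult norm_power abs_mult)
  also have "\<dots> \<le> (\<E> y. cmod (F y))" by (rule integral_norm_bound)
  also have "\<dots> \<le> (\<E> y. ?B)"
  proof (intro integral_mono integrable_continuous_unit_interval continuous_intros cont)
    fix y
    have "cmod (F y) = (\<Prod>k\<in>I. cmod (1 + (\<rho> * cis (2 * pi * y)) * of_real (c k)))"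
      by (simp add: F_def norm_mult prod_norm)
    also have "\<dots> \<le> (\<Prod>k\<in>I. exp (\<rho> * cos (2 * pi * y) * c k + \<rho>\<^sup>2 * (c k)\<^sup>2 / 2))"
    proof (intro prod_mono conjI)
      fix k
      show "cmod (1 + (\<rho> * cis (2 * pi * y)) * of_real (c k)) \<le> exp (\<rho> * cos (2 * pi * y) * c k + \<rho>\<^sup>2 * (c k)\<^sup>2 / 2)"
        using norm_one_plus_le_exp[of "(\<rho> * cis (2 * pi * y)) * of_real (c k)"]
        by (simp add: norm_mult power_mult_distrib)
    qed auto
    also have "\<dots> = exp (\<rho> * cos (2 * pi * y) * (\<Sum>k\<in>I. c k) + \<rho>\<^sup>2 * (\<Sum>k\<in>I. (c k)\<^sup>2) / 2)"
      using assms by (simp add: exp_sum [symmetric] sum.distrib sum_distrib_left sum_divide_distrib)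
    also have "\<dots> \<le> ?B"
    proof -
      have "cos (2 * pi * y) * (\<Sum>k\<in>I. c k) \<le> \<bar>cos (2 * pi * y)\<bar> * \<bar>\<Sum>k\<in>I. c k\<bar>"
        unfolding abs_mult [symmetric] by (rule abs_ge_self)
      also have "\<dots> \<le> 1 * \<bar>\<Sum>k\<in>I. c k\<bar>" by (intro mult_right_mono abs_cos_le_one) auto
      finally have "\<rho> * (cos (2 * pi * y) * (\<Sum>k\<in>I. c k)) \<le> \<rho> * \<bar>\<Sum>k\<in>I. c k\<bar>"
        using assms(2) by (simp add: mult_left_mono)
      then show ?thesis by (simp add: mult.assoc)
    qed
    finally show "cmod (F y) \<le> ?B" .
  qed
  also have "\<dots> = ?B" using prob_space by simp
  finally show ?thesis .
qed

text \<open>Cauchy's estimate on the circle of radius \<open>2 * norm z\<close> gives the term of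
  degree \<open>p\<close> a factor \<open>(1/2) ^ p\<close>, and the tail beyond \<open>D\<close> is
  geometric. The field is left open because \<open>z\<close> is imaginary for the central limit
  theorem and real for the iterated logarithm.\<close>

lemma norm_prod_one_plus_minus_tsum_le:
  fixes c :: "'a \<Rightarrow> real" and z :: "'b::{real_normed_field}"
  assumes "finite I"
  shows "norm ((\<Prod>k\<in>I. 1 + z * of_real (c k)) - tsum (\<lambda>k. of_real (c k)) I D z)
    \<le> (1/2) ^ D * exp (2 * norm z * \<bar>\<Sum>k\<in>I. c k\<bar> + 2 * (norm z)\<^sup>2 * (\<Sum>k\<in>I. (c k)\<^sup>2))"
proof -
  let ?B = "exp (2 * norm z * \<bar>\<Sum>k\<in>I. c k\<bar> + 2 * (norm z)\<^sup>2 * (\<Sum>k\<in>I. (c k)\<^sup>2))"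
  \<comment> \<open>The degree \<open>D\<close> may exceed \<open>card I\<close>; both polynomials
    are padded with zero terms up to the common degree \<open>n\<close>.\<close>
  define n where "n = max D (card I)"
  have "(\<Prod>k\<in>I. 1 + z * of_real (c k)) = (\<Sum>p\<le>n. z ^ p * of_real (esum c I p))"
    unfolding prod_one_plus[OF assms] tsum_def esum_of_real n_def using assms
    by (intro sum.mono_neutral_left) (auto simp: esum_eq_0)
  also have "\<dots> - tsum (\<lambda>k. of_real (c k)) I D z = (\<Sum>p\<in>{..n} - {..D}. z ^ p * of_real (esum c I p))"
    unfolding tsum_def esum_of_real by (subst sum_diff) (auto simp: n_def)
  also have "norm \<dots> \<le> (\<Sum>p\<in>{..n} - {..D}. (1/2) ^ p * ?B)"
  proof (rule order_trans[OF norm_sum], intro sum_mono)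
    fix p
    have "norm (z ^ p * of_real (esum c I p) :: 'b) = (1/2) ^ p * (\<bar>esum c I p\<bar> * (2 * norm z) ^ p)"
      by (simp add: norm_mult norm_power power_mult_distrib power_divide)
    also have "\<dots> \<le> (1/2) ^ p * ?B"
      using abs_esum_power_le[OF assms, of "2 * norm z" c p]
      by (intro mult_left_mono) (auto simp: power_mult_distrib mult_ac)
    finally show "norm (z ^ p * of_real (esum c I p) :: 'b) \<le> (1/2) ^ p * ?B" .
  qed
  also have "\<dots> = (\<Sum>p\<in>{..n} - {..D}. (1/2) ^ p) * ?B" by (simp add: sum_distrib_right)
  also have "(\<Sum>p\<in>{..n} - {..D}. (1/2::real) ^ p) \<le> (1/2) ^ D"
  proof -
    have "{..n} - {..D} = {Suc D..n}" by auto
    moreover have "(\<Sum>p=Suc D..n. (1/2::real) ^ p) \<le> (1/2) ^ D"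
    proof -
      have "D \<le> n" by (simp add: n_def)
      then have "(\<Sum>p=Suc D..n. (1/2::real) ^ p) = (1/2) ^ D - (1/2) ^ n"
      proof (induction n rule: dec_induct)
        case (step k)
        have "(1/2::real) ^ k = (1/2) ^ Suc k + (1/2) ^ Suc k" by simp
        then show ?case using step by (simp del: power_Suc)
      qed simp
      then show ?thesis by simp
    qed
    ultimately show ?thesis by simp
  qed
  finally show ?thesis by (simp add: mult_right_mono)
qed

context cos_system
begin

abbreviation "c x \<equiv> (\<lambda>k. cosf m k x)"

lemma integral_tsum_square_le:
  fixes z :: real
  assumes "finite I" "I \<subseteq> {1..}" "\<bar>z\<bar> \<le> \<mu>" "\<mu> \<le> 1"
  shows "(\<E> x. (tsum (c x) I D z)\<^sup>2) \<le> exp (card I * z\<^sup>2 / 2) * (1 + rel_series (2 * D) \<mu>)"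
proof -
  have "(\<E> x. (\<Sum>A | A \<subseteq> I \<and> card A \<le> D. \<Prod>k\<in>A. z * c x k)\<^sup>2)
    \<le> exp (\<Sum>k\<in>I. z\<^sup>2 / 2) * (1 + rel_series (2 * D) \<mu>)"
    using assms by (intro integral_square_le) auto
  then show ?thesis by (simp add: tsum_eq_sum_subsets[OF assms(1)])
qed

text \<open>Source of the asymptotic independence of disjoint blocks: up to the relation term the
  bound is the product of the bounds for the single blocks. Subsets of the union have size up to
  \<open>2 * D\<close>, and squaring doubles this once more, hence \<open>4 * D\<close>.\<close>

lemma integral_tsum_square_mult_le:
  fixes y z :: real
  assumes I: "finite I" "I \<subseteq> {1..}" "finite J" "J \<subseteq> {1..}" "I \<inter> J = {}" and yz: "\<bar>y\<bar> \<le> \<mu>" "\<bar>z\<bar> \<le> \<mu>" "\<mu> \<le> 1"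
  shows "(\<E> x. (tsum (c x) I D y)\<^sup>2 * (tsum (c x) J D z)\<^sup>2)
    \<le> exp (card I * y\<^sup>2 / 2 + card J * z\<^sup>2 / 2) * (1 + rel_series (4 * D) \<mu>)"
proof -
  let ?A = "{A. A \<subseteq> I \<union> J \<and> card (A \<inter> I) \<le> D \<and> card (A \<inter> J) \<le> D}"
  have "card A \<le> 2 * D" if "A \<in> ?A" for A
  proof -
    have "A = (A \<inter> I) \<union> (A \<inter> J)" using that by auto
    then have "card A \<le> card (A \<inter> I) + card (A \<inter> J)" by (metis card_Un_le)
    then show ?thesis using that by simp
  qed
  then have "(\<E> x. (\<Sum>A\<in>?A. \<Prod>k\<in>A. (if k \<in> I then y else z) * c x k)\<^sup>2)
    \<le> exp (\<Sum>k\<in>I \<union> J. (if k \<in> I then y else z)\<^sup>2 / 2) * (1 + rel_series (2 * (2 * D)) \<mu>)"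
    using I yz by (intro integral_square_le) auto
  also have "(\<Sum>k\<in>I \<union> J. (if k \<in> I then y else z)\<^sup>2 / 2) = card I * y\<^sup>2 / 2 + card J * z\<^sup>2 / 2"
  proof -
    have "(\<Sum>k\<in>J. (if k \<in> I then y else z)\<^sup>2 / 2) = (\<Sum>k\<in>J. z\<^sup>2 / 2)"
      using I by (intro sum.cong) auto
    then show ?thesis using I by (simp add: sum.union_disjoint)
  qed
  finally show ?thesis
    using I by (simp add: tsum_mult_tsum power_mult_distrib [symmetric] mult.assoc [symmetric])
qed

text \<open>By homogeneity a free weight \<open>z\<close> can be attached to each factor; its choice
  balances \<open>z ^ (2 * p)\<close> against the diagonal contribution
  \<open>exp (card I * z\<^sup>2 / 2)\<close>.\<close>

lemma integral_esum_square_le: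
  fixes z :: real
  assumes "finite I" "I \<subseteq> {1..}" "0 \<le> z" "z \<le> 1"
  shows "z ^ (2 * p) * (\<E> x. (esum (c x) I p)\<^sup>2) \<le> exp (card I * z\<^sup>2 / 2) * (1 + rel_series (2 * p) z)"
proof -
  have "(\<E> x. (\<Sum>A | A \<subseteq> I \<and> card A = p. \<Prod>k\<in>A. z * c x k)\<^sup>2)
    \<le> exp (\<Sum>k\<in>I. z\<^sup>2 / 2) * (1 + rel_series (2 * p) z)"
    using assms by (intro integral_square_le) auto
  moreover have "(\<Sum>A | A \<subseteq> I \<and> card A = p. \<Prod>k\<in>A. z * c x k)\<^sup>2 = z ^ (2 * p) * (esum (c x) I p)\<^sup>2" for x
    using esum_scale[of z "c x" I p] by (simp add: esum_def power_mult_distrib power_mult power2_eq_square power_add mult_2)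
  ultimately show ?thesis by simp
qed

lemma norm_integral_tsum_minus_one_le:
  fixes z :: complex
  assumes "finite I" "I \<subseteq> {1..}"
  shows "cmod ((\<E> x. tsum (\<lambda>k. of_real (c x k)) I D z) - 1) \<le> rel_series D (cmod z)"
proof -
  interpret prob_space unit_interval_measure by (rule prob_space_unit_interval)
  let ?e = "\<lambda>p. \<E> x. esum (c x) I p"
  have "(\<E> x. tsum (\<lambda>k. of_real (c x k)) I D z) = (\<Sum>p\<le>D. z ^ p * of_real (?e p))"
    unfolding tsum_def esum_of_real
    by (subst Bochner_Integration.integral_sum)
      (auto simp: intro!: integrable_continuous_unit_interval continuous_intros)
  also have "\<dots> = 1 + (\<Sum>p=1..D. z ^ p * of_real (?e p))"
    using assms prob_space by (simp add: atMost_atLeast0 sum.atLeast_Suc_atMost)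
  finally have "cmod ((\<E> x. tsum (\<lambda>k. of_real (c x k)) I D z) - 1) = cmod (\<Sum>p=1..D. z ^ p * of_real (?e p))"
    by simp
  also have "\<dots> \<le> (\<Sum>p=1..D. K p * cmod z ^ p)"
  proof (rule order_trans[OF norm_sum], intro sum_mono)
    fix p assume "p \<in> {1..D}"
    then show "cmod (z ^ p * of_real (?e p)) \<le> K p * cmod z ^ p"
      using abs_integral_esum_le[OF assms, of p] by (simp add: norm_mult norm_power mult.commute[of _ "cmod z ^ p"] mult_left_mono)
  qed
  finally show ?thesis by (simp add: rel_series_def)
qed

lemma abs_integral_tsum_minus_one_le:
  fixes z :: real
  assumes "finite I" "I \<subseteq> {1..}"
  shows "\<bar>(\<E> x. tsum (c x) I D z) - 1\<bar> \<le> rel_series D \<bar>z\<bar>"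
proof -
  have "complex_of_real ((\<E> x. tsum (c x) I D z) - 1) =
    (\<E> x. tsum (\<lambda>k. of_real (c x k)) I D (of_real z)) - 1"
    by (simp add: tsum_of_real integral_complex_of_real)
  then show ?thesis
    using norm_integral_tsum_minus_one_le[OF assms, of D "of_real z"] by (metis norm_of_real)
qed

text \<open>The absolute values rule out an expansion of the whole sum, so the degrees are separated
  by the Cauchy-Schwarz inequality with weights \<open>(1/2) ^ p\<close>. The loss
  \<open>2 ^ p\<close> is absorbed by doubling \<open>z\<close>, since
  \<open>2 ^ p * z ^ (2 * p) = (1/2) ^ p * (2 * z) ^ (2 * p)\<close>.\<close>

lemma integral_abs_tsum_square_le:
  fixes z :: real
  assumes "finite I" "I \<subseteq> {1..}" "0 \<le> z" "2 * z \<le> 1"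
  shows "(\<E> x. (\<Sum>p\<le>D. z ^ p * \<bar>esum (c x) I p\<bar>)\<^sup>2)
    \<le> 4 * exp (2 * card I * z\<^sup>2) * (1 + rel_series (2 * D) (2 * z))"
proof -
  let ?E = "exp (2 * card I * z\<^sup>2) * (1 + rel_series (2 * D) (2 * z))"
  have E0: "?E \<ge> 0" using rel_series_nonneg[of "2*z" "2*D"] assms by (intro mult_nonneg_nonneg) auto
  have geo: "(\<Sum>p\<le>D. (1/2::real) ^ p) \<le> 2"
    by (subst sum_gp0) (auto simp: field_simps)
  have "(\<E> x. (\<Sum>p\<le>D. z ^ p * \<bar>esum (c x) I p\<bar>)\<^sup>2) \<le>
    (\<E> x. 2 * (\<Sum>p\<le>D. (1/2) ^ p * ((2 * z) ^ (2 * p) * (esum (c x) I p)\<^sup>2)))"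
  proof (intro integral_mono integrable_continuous_unit_interval continuous_intros)
    fix x
    have "(\<Sum>p\<le>D. z ^ p * \<bar>esum (c x) I p\<bar>)\<^sup>2 = (\<Sum>p\<le>D. sqrt ((1/2) ^ p) * (sqrt (2 ^ p) * z ^ p * \<bar>esum (c x) I p\<bar>))\<^sup>2"
      by (simp add: mult.assoc [symmetric] real_sqrt_mult [symmetric] power_mult_distrib [symmetric])
    also have "\<dots> \<le> (\<Sum>p\<le>D. (sqrt ((1/2) ^ p))\<^sup>2) * (\<Sum>p\<le>D. (sqrt (2 ^ p) * z ^ p * \<bar>esum (c x) I p\<bar>)\<^sup>2)"
      by (rule Cauchy_Schwarz_ineq_sum)
    also have "\<dots> \<le> 2 * (\<Sum>p\<le>D. (sqrt (2 ^ p) * z ^ p * \<bar>esum (c x) I p\<bar>)\<^sup>2)"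
      using geo by (intro mult_right_mono sum_nonneg) auto
    also have "(\<Sum>p\<le>D. (sqrt (2 ^ p) * z ^ p * \<bar>esum (c x) I p\<bar>)\<^sup>2) = (\<Sum>p\<le>D. (1/2) ^ p * ((2 * z) ^ (2 * p) * (esum (c x) I p)\<^sup>2))"
    proof (intro sum.cong refl)
      fix p
      have "(2::real) ^ p = (1/2) ^ p * 2 ^ (2 * p)"
        by (simp add: power_mult power_mult_distrib [symmetric])
      then show "(sqrt (2 ^ p) * z ^ p * \<bar>esum (c x) I p\<bar>)\<^sup>2 = (1/2) ^ p * ((2 * z) ^ (2 * p) * (esum (c x) I p)\<^sup>2)"
        by (simp add: power_mult_distrib power_mult [symmetric] mult.commute[of 2 p])
    qed
    finally show "(\<Sum>p\<le>D. z ^ p * \<bar>esum (c x) I p\<bar>)\<^sup>2 \<le> 2 * (\<Sum>p\<le>D. (1/2) ^ p * ((2 * z) ^ (2 * p) * (esum (c x) I p)\<^sup>2))" .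
  qed
  also have "\<dots> = 2 * (\<Sum>p\<le>D. (1/2) ^ p * ((2 * z) ^ (2 * p) * (\<E> x. (esum (c x) I p)\<^sup>2)))"
    by (subst integral_mult_right_zero, subst Bochner_Integration.integral_sum)
      (auto intro!: integrable_continuous_unit_interval continuous_intros)
  also have "\<dots> \<le> 2 * (\<Sum>p\<le>D. (1/2) ^ p * ?E)"
  proof (intro mult_left_mono sum_mono)
    fix p assume p: "p \<in> {..D}"
    have "(2 * z) ^ (2 * p) * (\<E> x. (esum (c x) I p)\<^sup>2) \<le> exp (card I * (2 * z)\<^sup>2 / 2) * (1 + rel_series (2 * p) (2 * z))"
      using assms by (intro integral_esum_square_le) auto
    also have "\<dots> \<le> exp (card I * (2 * z)\<^sup>2 / 2) * (1 + rel_series (2 * D) (2 * z))"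
      using assms p by (intro mult_left_mono add_left_mono rel_series_mono) auto
    finally show "(2 * z) ^ (2 * p) * (\<E> x. (esum (c x) I p)\<^sup>2) \<le> ?E"
      by (simp add: power_mult_distrib mult_ac)
  qed auto
  also have "\<dots> = 2 * ((\<Sum>p\<le>D. (1/2) ^ p) * ?E)" by (simp add: sum_distrib_right)
  also have "\<dots> \<le> 2 * (2 * ?E)" using geo E0 by (intro mult_left_mono mult_right_mono) auto
  finally show ?thesis by simp
qed

text \<open>The constant of the moment of order \<open>2 * q\<close>: \<open>(fact q) ^ 4\<close> is
  the squared cost of Newton's identities, one factor \<open>q + 1\<close> comes from the
  Cauchy-Schwarz inequality and one from the number of degrees, 2 bounds \<open>exp (1/2)\<close>,
  and \<open>rel_series\<close> at 1 adds up the bounds for the relations.\<close>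

definition moment_bound :: "nat \<Rightarrow> real" where
  "moment_bound q = (fact q) ^ 4 * real (Suc q) * (real (Suc q) * (2 * (1 + rel_series (2 * q) 1)))"

lemma moment_bound_nonneg: "moment_bound q \<ge> 0"
  by (simp add: moment_bound_def rel_series_nonneg add_nonneg_nonneg)

lemma integral_sum_power_le:
  assumes "finite I" "I \<subseteq> {1..}"
  shows "(\<E> x. (\<Sum>k\<in>I. c x k) ^ (2 * q)) \<le> moment_bound q * card I ^ q"
proof (cases "I = {}")
  case True
  interpret prob_space unit_interval_measure by (rule prob_space_unit_interval)
  show ?thesis
  proof (cases "q = 0")
    case True
    have "moment_bound 0 \<ge> 1" using rel_series_nonneg[of 1 0] by (simp add: moment_bound_def)
    then show ?thesis using True prob_space by simp
  qed (use True in \<open>simp add: zero_power\<close>)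
next
  case False
  define M where "M = real (card I)"
  have M: "M \<ge> 1" unfolding M_def using False assms by (simp add: Suc_le_eq card_gt_0_iff)
  \<comment> \<open>With this scaling the squares sum to at most 1, as the comparison with symmetric
    polynomials requires, and the diagonal factor \<open>exp (M * z\<^sup>2 / 2)\<close> is the
    constant \<open>exp (1/2)\<close>.\<close>
  define z where "z = 1 / sqrt M"
  have z: "0 < z" "z \<le> 1" "z\<^sup>2 = 1 / M" using M by (auto simp: z_def power_divide)
  have Mz: "M * z\<^sup>2 = 1" using M z by simp
  have pt: "z ^ (2 * q) * (\<Sum>k\<in>I. c x k) ^ (2 * q) \<le> (fact q) ^ 4 * real (Suc q) * (\<Sum>j\<le>q. z ^ (2 * j) * (esum (c x) I j)\<^sup>2)" for x
  proof -
    let ?d = "\<lambda>k. z * c x k"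
    have "(\<Sum>k\<in>I. (?d k)\<^sup>2) \<le> (\<Sum>k\<in>I. z\<^sup>2 * 1)"
      using abs_cosf_le_1[of m _ x] by (intro sum_mono) (auto simp: power_mult_distrib abs_square_le_1 intro!: mult_left_le)
    also have "\<dots> = 1" using Mz by (simp add: M_def)
    finally have "\<bar>\<Sum>k\<in>I. ?d k\<bar> ^ q \<le> (fact q)\<^sup>2 * (\<Sum>j\<le>q. \<bar>esum ?d I j\<bar>)"
      by (rule abs_sum_power_le_esum[OF assms(1)])
    then have "(\<bar>\<Sum>k\<in>I. ?d k\<bar> ^ q)\<^sup>2 \<le> ((fact q)\<^sup>2 * (\<Sum>j\<le>q. \<bar>esum ?d I j\<bar>))\<^sup>2"
      by (rule power_mono) simp
    also have "\<dots> = (fact q) ^ 4 * (\<Sum>j\<le>q. 1 * \<bar>esum ?d I j\<bar>)\<^sup>2" by (simp add: power_mult_distrib power_mult [symmetric])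
    also have "\<dots> \<le> (fact q) ^ 4 * ((\<Sum>j\<le>q. 1\<^sup>2) * (\<Sum>j\<le>q. \<bar>esum ?d I j\<bar>\<^sup>2))"
      by (intro mult_left_mono Cauchy_Schwarz_ineq_sum) auto
    also have "\<dots> = (fact q) ^ 4 * real (Suc q) * (\<Sum>j\<le>q. z ^ (2 * j) * (esum (c x) I j)\<^sup>2)"
      by (simp add: esum_scale power_mult_distrib power_mult [symmetric] mult.commute)
    also have "(\<bar>\<Sum>k\<in>I. ?d k\<bar> ^ q)\<^sup>2 = z ^ (2 * q) * (\<Sum>k\<in>I. c x k) ^ (2 * q)"
      by (simp add: sum_distrib_left [symmetric] power_even_abs power_mult [symmetric] mult.commute[of q 2] power_mult_distrib)
    finally show ?thesis .
  qed
  have "z ^ (2 * q) * (\<E> x. (\<Sum>k\<in>I. c x k) ^ (2 * q)) =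
      (\<E> x. z ^ (2 * q) * (\<Sum>k\<in>I. c x k) ^ (2 * q))" by simp
  also have "\<dots> \<le> (\<E> x. (fact q) ^ 4 * real (Suc q) * (\<Sum>j\<le>q. z ^ (2 * j) * (esum (c x) I j)\<^sup>2))"
    by (intro integral_mono integrable_continuous_unit_interval continuous_intros pt)
  also have "\<dots> = (fact q) ^ 4 * real (Suc q) * (\<Sum>j\<le>q. z ^ (2 * j) * (\<E> x. (esum (c x) I j)\<^sup>2))"
    by (subst integral_mult_right_zero, subst Bochner_Integration.integral_sum)
      (auto intro!: integrable_continuous_unit_interval continuous_intros)
  also have "\<dots> \<le> (fact q) ^ 4 * real (Suc q) * (\<Sum>j\<le>q. 2 * (1 + rel_series (2 * q) 1))"
  proof (intro mult_left_mono sum_mono)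
    fix j assume j: "j \<in> {..q}"
    have "z ^ (2 * j) * (\<E> x. (esum (c x) I j)\<^sup>2) \<le> exp (card I * z\<^sup>2 / 2) * (1 + rel_series (2 * j) z)"
      using assms z by (intro integral_esum_square_le) auto
    also have "exp (card I * z\<^sup>2 / 2) = exp (1/2)" using Mz by (simp add: M_def)
    also have "exp (1/2::real) \<le> 2" using exp_bound_half[of "1/2::real"] by simp
    also have "2 * (1 + rel_series (2 * j) z) \<le> 2 * (1 + rel_series (2 * q) 1)"
      using j z by (intro mult_left_mono add_left_mono rel_series_mono) auto
    finally show "z ^ (2 * j) * (\<E> x. (esum (c x) I j)\<^sup>2) \<le> 2 * (1 + rel_series (2 * q) 1)"
      using z rel_series_nonneg[of z "2 * j"] by (simp add: mult_right_mono)
  qed auto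
  also have "\<dots> = moment_bound q" by (simp add: moment_bound_def)
  finally have "z ^ (2 * q) * (\<E> x. (\<Sum>k\<in>I. c x k) ^ (2 * q)) \<le> moment_bound q" .
  moreover have "z ^ (2 * q) = 1 / M ^ q" by (simp add: power_mult z power_divide)
  ultimately show ?thesis
    using M by (simp add: M_def [symmetric] divide_le_eq mult.commute)
qed

text \<open>Linear relations are homogeneous, so doubled frequencies satisfy the same ones. As a
  squared cosine is \<open>1/2\<close> plus half the cosine of the doubled angle, moment bounds for
  the sum carry over to the centred sum of squares.\<close>

lemma cos_system_double: "cos_system (\<lambda>k. 2 * m k) K"
proof
  fix I :: "nat set" and r :: nat
  assume "finite I" "I \<subseteq> {1..}" "r \<ge> 1"
  moreover have "rels (\<lambda>k. 2 * m k) I r = rels m I r"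
  proof -
    have "freq (\<lambda>k. 2 * m k) I u = 2 * freq m I u" for u
      by (simp add: freq_def sum_distrib_left mult_ac)
    then show ?thesis by (simp add: rels_def)
  qed
  ultimately show "real (card (rels (\<lambda>k. 2 * m k) I r)) \<le> K r" using card_rels_le by simp
qed (rule K_1)

lemma integral_sum_squares_power_le:
  assumes "finite I" "I \<subseteq> {1..}"
  shows "(\<E> x. ((\<Sum>k\<in>I. (c x k)\<^sup>2) - card I / 2) ^ (2 * q)) \<le> moment_bound q * card I ^ q"
proof -
  interpret d: cos_system "\<lambda>k. 2 * m k" K by (rule cos_system_double)
  have *: "(\<Sum>k\<in>I. (c x k)\<^sup>2) - card I / 2 = (\<Sum>k\<in>I. cosf (\<lambda>k. 2 * m k) k x) / 2" for x
  proof -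
    have "(c x k)\<^sup>2 = 1 / 2 + cosf (\<lambda>k. 2 * m k) k x / 2" for k
      using cos_double_cos[of "2 * pi * real (m k) * x"] by (simp add: cosf_def mult_ac diff_divide_distrib)
    then show ?thesis by (simp add: sum.distrib sum_divide_distrib)
  qed
  have "(\<E> x. ((\<Sum>k\<in>I. (c x k)\<^sup>2) - card I / 2) ^ (2 * q)) =
    (\<E> x. (\<Sum>k\<in>I. cosf (\<lambda>k. 2 * m k) k x) ^ (2 * q)) / 2 ^ (2 * q)"
    unfolding * power_divide by simp
  also have "\<dots> \<le> (\<E> x. (\<Sum>k\<in>I. cosf (\<lambda>k. 2 * m k) k x) ^ (2 * q)) / 1"
    by (intro divide_left_mono integral_nonneg_AE AE_I2) (auto simp: zero_le_even_power)
  also have "\<dots> \<le> moment_bound q * card I ^ q"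
    using d.integral_sum_power_le[OF assms, of q] by simp
  finally show ?thesis .
qed

end

section \<open>Central limit theorem\<close>

text \<open>Zero coefficients are absent because a relation is recorded on its support. Coefficients
  up to 2 are admissible exactly when the length is at least 2, so small \<open>r\<close> gets the
  separate value 0.\<close>

definition rel_bound :: "(nat \<Rightarrow> nat) \<Rightarrow> nat \<Rightarrow> real" where
  "rel_bound n r = (if r \<le> 1 then 0 else
     real (\<Sum>as | set as \<subseteq> {-2,-1,1,2} \<and> length as = r. card (sol_set n as)))"

text \<open>A relation for the permuted frequencies is carried by \<open>\<sigma>\<close> to one for
  the original ones. Sorting the image of its support gives an increasing tuple, and this tuple with
  the coefficients read along it determines the relation. The permutation thus disappears from the
  count.\<close>

lemma cos_system_rel_bound:
  assumes pos: "\<And>k. k \<ge> 1 \<Longrightarrow> n k > 0" and R: "condR n" and \<sigma>: "bij_betw \<sigma> {1..} {1..}"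
  shows "cos_system (\<lambda>k. n (\<sigma> k)) (rel_bound n)"
proof
  fix I :: "nat set" and r :: nat
  assume I: "finite I" "I \<subseteq> {1..}" and r: "r \<ge> 1"
  let ?m = "\<lambda>k. n (\<sigma> k)"
  have \<sigma>1: "\<sigma> k \<ge> 1" if "k \<ge> 1" for k using bij_betwE[OF \<sigma>] that by auto
  have inj: "inj_on \<sigma> {1..}" using \<sigma> by (simp add: bij_betw_def)
  define \<tau> where "\<tau> = inv_into {1..} \<sigma>"
  have \<tau>: "\<tau> (\<sigma> k) = k" if "k \<in> I" for k
    unfolding \<tau>_def using I that by (intro inv_into_f_f inj) auto
  show "real (card (rels ?m I r)) \<le> rel_bound n r"
  proof (cases "r = 1")
    case True
    have "rels ?m I r = {}"
    proof (rule ccontr)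
      assume "rels ?m I r \<noteq> {}"
      then obtain u where u: "freq ?m I u = 0" "card (supp_on I u) = 1"
        using True by (auto simp: rels_def)
      then obtain k where k: "supp_on I u = {k}" by (auto simp: card_1_singleton_iff)
      have "freq ?m I u = (\<Sum>j\<in>supp_on I u. u j * int (?m j))"
        unfolding freq_def using I by (intro sum.mono_neutral_right) (auto simp: supp_on_def)
      moreover have "k \<in> I" "u k \<noteq> 0" using k by (auto simp: supp_on_def)
      ultimately show False using u k pos[OF \<sigma>1, of k] I by auto
    qed
    then show ?thesis using True by (simp add: rel_bound_def)
  next
    case False
    then have r2: "r \<ge> 2" using r by simp
    let ?L = "{as::int list. set as \<subseteq> {-2,-1,1,2} \<and> length as = r}"
    have finL: "finite ?L" by (rule finite_lists_length_eq) simp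
    have fin: "finite (sol_set n as)" if "as \<in> ?L" for as
    proof -
      have "admissible_coeffs r as"
        using that r2 unfolding admissible_coeffs_def by auto
      then show ?thesis using R r2 unfolding condR_def by blast
    qed
    \<comment> \<open>Solutions are counted as increasing tuples of original indices, hence the
      sorting after applying \<open>\<sigma>\<close>; \<open>\<tau>\<close> brings the coefficients
      back.\<close>
    define ks where "ks = (\<lambda>u. sorted_list_of_set (\<sigma> ` supp_on I u))"
    define g where "g = (\<lambda>u. (map (\<lambda>k. u (\<tau> k)) (ks u), ks u))"
    have finS: "finite (supp_on I u)" "supp_on I u \<subseteq> I" for u using I by (auto simp: supp_on_def)
    have set_ks: "set (ks u) = \<sigma> ` supp_on I u" for u
      unfolding ks_def using finS by simp
    have inj_g: "inj_on g (rels ?m I r)"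
    proof (rule inj_onI)
      fix u v assume u: "u \<in> rels ?m I r" and v: "v \<in> rels ?m I r" and e: "g u = g v"
      have ks: "ks u = ks v" using e by (simp add: g_def)
      have "\<sigma> ` supp_on I u = \<sigma> ` supp_on I v" using ks set_ks by metis
      then have s: "supp_on I u = supp_on I v"
        using inj_on_image_eq_iff[OF inj] finS(2) I(2) by (metis subset_trans)
      have "u k = v k" if "k \<in> I" for k
      proof (cases "k \<in> supp_on I u")
        case True
        then have "\<sigma> k \<in> set (ks u)" by (simp add: set_ks)
        moreover have "map (\<lambda>k. u (\<tau> k)) (ks u) = map (\<lambda>k. v (\<tau> k)) (ks u)"
          using e ks by (simp add: g_def)
        ultimately have "u (\<tau> (\<sigma> k)) = v (\<tau> (\<sigma> k))" by simp
        then show ?thesis using \<tau> that by simp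
      next
        case False
        then have "k \<notin> supp_on I v" using s by simp
        then show ?thesis using False that by (simp add: supp_on_def)
      qed
      then show "u = v" using u v by (auto simp: rels_def intro: PiE_ext)
    qed
    have "g ` rels ?m I r \<subseteq> Sigma ?L (sol_set n)"
    proof clarify
      fix u as l assume u: "u \<in> rels ?m I r" and gu: "(as, l) = g u"
      then have l: "l = ks u" and as: "as = map (\<lambda>k. u (\<tau> k)) l" by (auto simp: g_def)
      have inj_s: "inj_on \<sigma> (supp_on I u)"
        using finS(2)[of u] I by (intro inj_on_subset[OF inj]) auto
      have len: "length l = r"
        using u inj_s unfolding l ks_def by (simp add: rels_def card_image)
      have d: "sorted_wrt (<) l" "distinct l" unfolding l ks_def by simp_all
      have "set as \<subseteq> {-2,-1,1,2}"
      proof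
        fix a assume "a \<in> set as"
        then obtain k where k: "k \<in> supp_on I u" "a = u k"
          using set_ks[of u] \<tau> finS(2)[of u] by (auto simp: as l)
        then have "a \<noteq> 0" "a \<in> {-2..2}" using u by (auto simp: supp_on_def rels_def PiE_iff)
        then show "a \<in> {-2,-1,1,2}" by auto
      qed
      then have asL: "as \<in> ?L" using len by (simp add: as)
      have "(\<Sum>i<length as. as ! i * int (n (l ! i))) = (\<Sum>i<length l. u (\<tau> (l ! i)) * int (n (l ! i)))"
        by (simp add: as)
      also have "\<dots> = (\<Sum>k\<in>set l. u (\<tau> k) * int (n k))"
        using d(2) by (intro sum.reindex_bij_betw) (rule bij_betw_nth, auto)
      also have "\<dots> = (\<Sum>k\<in>supp_on I u. u (\<tau> (\<sigma> k)) * int (n (\<sigma> k)))"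
        unfolding l set_ks using inj_s by (simp add: sum.reindex)
      also have "\<dots> = (\<Sum>k\<in>supp_on I u. u k * int (n (\<sigma> k)))"
        using \<tau> finS(2)[of u] by (intro sum.cong) auto
      also have "\<dots> = freq ?m I u"
        unfolding freq_def using I by (intro sum.mono_neutral_left) (auto simp: supp_on_def)
      also have "\<dots> = 0" using u by (simp add: rels_def)
      finally have sum0: "(\<Sum>i<length as. as ! i * int (n (l ! i))) = 0" .
      have "\<forall>k\<in>set l. 1 \<le> k"
        unfolding l set_ks using \<sigma>1 finS(2)[of u] I by fastforce
      then have "l \<in> sol_set n as"
        using sum0 d len asL by (simp add: sol_set_def)
      with asL show "(as \<in> ?L) \<and> l \<in> sol_set n as" by simp
    qed
    then have "card (rels ?m I r) \<le> card (Sigma ?L (sol_set n))"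
      using inj_g finL fin by (intro card_inj_on_le[of g]) auto
    also have "\<dots> = (\<Sum>as\<in>?L. card (sol_set n as))"
      using finL fin by (intro card_SigmaI) auto
    finally show ?thesis using r2 by (simp add: rel_bound_def del: of_nat_sum)
  qed
qed (simp add: rel_bound_def)

text \<open>There are \<open>4 ^ r\<close> coefficient vectors, at most \<open>exp (2 * r)\<close>;
  together with the count for each of them this gives the 3 in the exponent. The exponent is rounded
  up to an integer at least 1, so that \<open>r\<close> is itself below
  \<open>r ^ \<alpha>\<close>.\<close>

lemma rel_bound_condRstar:
  assumes "condRstar n"
  shows "\<exists>C \<alpha>. C \<ge> 0 \<and> \<alpha> \<ge> 1 \<and> (\<forall>r\<ge>1. rel_bound n r \<le> C * exp (3 * real r ^ \<alpha>))"
proof -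
  obtain C \<beta> where C: "C > 0" and bd: "\<And>p as. p \<ge> 2 \<Longrightarrow> admissible_coeffs p as \<Longrightarrow>
      real (card (sol_set n as)) \<le> C * exp (real p powr \<beta>)"
    using assms unfolding condRstar_def by auto
  define \<alpha> where "\<alpha> = nat (max 1 \<lceil>\<beta>\<rceil>)"
  have \<alpha>: "\<alpha> \<ge> 1" "real \<alpha> \<ge> \<beta>" unfolding \<alpha>_def by linarith+
  have "rel_bound n r \<le> C * exp (3 * real r ^ \<alpha>)" if "r \<ge> 1" for r
  proof (cases "r = 1")
    case True
    then show ?thesis using C by (simp add: rel_bound_def)
  next
    case False
    then have r: "r \<ge> 2" using that by simp
    let ?L = "{as::int list. set as \<subseteq> {-2,-1,1,2} \<and> length as = r}"
    have r_le: "real r \<le> real r ^ \<alpha>" using \<alpha> r by (intro self_le_power) auto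
    have "rel_bound n r = (\<Sum>as\<in>?L. real (card (sol_set n as)))" using r by (simp add: rel_bound_def)
    also have "\<dots> \<le> (\<Sum>as\<in>?L. C * exp (real r powr \<beta>))"
      using r by (intro sum_mono bd) (auto simp: admissible_coeffs_def)
    also have "\<dots> = 4 ^ r * (C * exp (real r powr \<beta>))"
      using card_lists_length_eq[of "{-2,-1,1,2::int}" r] by simp
    also have "\<dots> \<le> exp (2 * real r ^ \<alpha>) * (C * exp (real r ^ \<alpha>))"
    proof (intro mult_mono)
      have "(4::real) \<le> exp 2"
      proof -
        have "(2::real) \<le> exp 1" using exp_ge_add_one_self[of 1] by simp
        then have "(2::real) * 2 \<le> exp 1 * exp 1" by (intro mult_mono) auto
        then show ?thesis by (simp add: exp_add [symmetric])
      qed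
      then have "(4::real) ^ r \<le> exp 2 ^ r" by (intro power_mono) auto
      also have "\<dots> = exp (2 * real r)" by (simp add: exp_of_nat_mult [symmetric] mult.commute)
      also have "\<dots> \<le> exp (2 * real r ^ \<alpha>)" using r_le by simp
      finally show "(4::real) ^ r \<le> exp (2 * real r ^ \<alpha>)" .
      have "real r powr \<beta> \<le> real r powr real \<alpha>" using \<alpha> r by (intro powr_mono) auto
      then have "real r powr \<beta> \<le> real r ^ \<alpha>" using r by (simp add: powr_realpow)
      then show "exp (real r powr \<beta>) \<le> exp (real r ^ \<alpha>)" by simp
    qed (use C in auto)
    also have "\<dots> = C * exp (3 * real r ^ \<alpha>)" by (simp add: exp_add [symmetric])
    finally show ?thesis .
  qed
  then show ?thesis using C \<alpha> by (intro exI[of _ C] exI[of _ \<alpha>]) auto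
qed

section \<open>Characteristic functions and the central limit theorem\<close>

lemma exp_minus_taylor:
  fixes u :: real
  assumes "u \<ge> 0"
  shows "\<bar>exp (- u) - (1 - u)\<bar> \<le> u\<^sup>2"
proof -
  have "1 \<le> (1 - u + u\<^sup>2) * (1 + u)" using assms by (simp add: algebra_simps power2_eq_square)
  also have "\<dots> \<le> (1 - u + u\<^sup>2) * exp u"
  proof (intro mult_left_mono exp_ge_add_one_self)
    have "1 - u + u\<^sup>2 = (u - 1/2)\<^sup>2 + 3/4" by (simp add: power2_eq_square algebra_simps)
    then show "0 \<le> 1 - u + u\<^sup>2" by simp
  qed
  finally have "exp (- u) \<le> 1 - u + u\<^sup>2" by (simp add: exp_minus field_simps)
  moreover have "exp (- u) \<ge> 1 - u" using exp_ge_add_one_self[of "- u"] by simp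
  ultimately show ?thesis by simp
qed

text \<open>Both expressions have the expansion \<open>1 + \<i> * y - y\<^sup>2 / 2\<close> up to
  third order. Multiplied over the frequencies, this splits the characteristic function into a
  product of factors \<open>1 + \<i> * y\<close> and a nearly deterministic Gaussian factor.\<close>

lemma iexp_approx_product:
  assumes "\<bar>y\<bar> \<le> 1"
  shows "cmod (iexp y - (1 + \<i> * y) * complex_of_real (exp (- y\<^sup>2 / 2))) \<le> 2 * \<bar>y\<bar> ^ 3"
proof -
  have 1: "cmod (iexp y - (1 + \<i> * y - y\<^sup>2 / 2)) \<le> \<bar>y\<bar> ^ 3"
  proof -
    have "cmod (iexp y - (\<Sum>k\<le>2. (\<i> * y) ^ k / fact k)) \<le> \<bar>y\<bar> ^ Suc 2 / fact (Suc 2)"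
      by (rule iexp_approx1)
    also have "\<dots> = \<bar>y\<bar> ^ 3 / 6" by (simp add: eval_nat_numeral)
    also have "\<dots> \<le> \<bar>y\<bar> ^ 3" by simp
    also have "(\<Sum>k\<le>2. (\<i> * complex_of_real y) ^ k / fact k) = 1 + \<i> * y - y\<^sup>2 / 2"
      by (simp add: numeral_eq_Suc power2_eq_square) (simp add: complex_eq_iff)
    finally show ?thesis .
  qed
  have 2: "cmod ((1 + \<i> * y - y\<^sup>2 / 2) - (1 + \<i> * y) * complex_of_real (exp (- y\<^sup>2 / 2))) \<le> \<bar>y\<bar> ^ 3"
  proof -
    let ?r = "exp (- (y\<^sup>2 / 2)) - (1 - y\<^sup>2 / 2)"
    have "(1 + \<i> * y - y\<^sup>2 / 2) - (1 + \<i> * y) * complex_of_real (exp (- y\<^sup>2 / 2)) = \<i> * of_real (y ^ 3 / 2) - (1 + \<i> * y) * of_real ?r"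
      by (simp add: algebra_simps power2_eq_square power3_eq_cube exp_of_real)
    also have "cmod \<dots> \<le> cmod (\<i> * of_real (y ^ 3 / 2)) + cmod (1 + \<i> * y) * \<bar>?r\<bar>"
      by (rule order_trans[OF norm_triangle_ineq4]) (simp add: norm_mult del: of_real_diff of_real_exp)
    also have "cmod (\<i> * of_real (y ^ 3 / 2)) = \<bar>y\<bar> ^ 3 / 2" by (simp add: norm_mult norm_divide norm_power power_abs)
    also have "cmod (1 + \<i> * y) * \<bar>?r\<bar> \<le> 2 * (y\<^sup>2 / 2)\<^sup>2"
    proof (intro mult_mono exp_minus_taylor)
      have "cmod (1 + \<i> * y) \<le> cmod 1 + cmod (\<i> * y)" by (rule norm_triangle_ineq)
      then show "cmod (1 + \<i> * y) \<le> 2" using assms by (simp add: norm_mult)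
    qed auto
    also have "2 * (y\<^sup>2 / 2)\<^sup>2 = \<bar>y\<bar> ^ 3 * \<bar>y\<bar> / 2"
      by (simp add: power2_eq_square power3_eq_cube abs_mult [symmetric])
    also have "\<bar>y\<bar> ^ 3 * \<bar>y\<bar> / 2 \<le> \<bar>y\<bar> ^ 3 / 2" using assms by (simp add: mult_left_le)
    finally show ?thesis by simp
  qed
  show ?thesis using norm_triangle_mono[OF 1 2] by simp
qed

lemma char_normal_density:
  assumes "s > 0"
  shows "char (density lborel (normal_density 0 s)) t = of_real (exp (- (s * t)\<^sup>2 / 2))"
    and "real_distribution (density lborel (normal_density 0 s))"
proof -
  interpret S: prob_space std_normal_distribution
    by (rule prob_space_normal_density) simp
  have "distributed std_normal_distribution lborel (\<lambda>x. x) std_normal_density"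
    unfolding distributed_def by (auto simp: distr_id2 normal_density_nonneg)
  then have "distributed std_normal_distribution lborel (\<lambda>x. s * x) (normal_density 0 s)"
    using assms S.normal_standard_normal_convert[of s "\<lambda>x. s * x" 0] by simp
  then have *: "density lborel (normal_density 0 s) = distr std_normal_distribution lborel (\<lambda>x. s * x)"
    unfolding distributed_def by simp
  have "char (density lborel (normal_density 0 s)) t = (CLINT x|std_normal_distribution. iexp (t * (s * x)))"
    unfolding char_def * by (subst integral_distr) auto
  also have "\<dots> = char std_normal_distribution (s * t)"
    unfolding char_def by (simp add: mult_ac)
  finally show "char (density lborel (normal_density 0 s)) t = of_real (exp (- (s * t)\<^sup>2 / 2))"
    by (simp add: char_std_normal_distribution)
  show "real_distribution (density lborel (normal_density 0 s))"
    unfolding real_distribution_def real_distribution_axioms_def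
    using prob_space_normal_density[OF assms, of 0] by simp
qed


context cos_system
begin

lemma rel_series_tendsto_0: "(\<lambda>N. rel_series D (a / sqrt (real N))) \<longlonglongrightarrow> 0"
proof -
  have "(\<lambda>N. a / sqrt (real N)) \<longlonglongrightarrow> 0" by real_asymp
  then have "(\<lambda>N. K r * (a / sqrt (real N)) ^ r) \<longlonglongrightarrow> K r * 0 ^ r" for r
    by (intro tendsto_intros)
  then have "(\<lambda>N. rel_series D (a / sqrt (real N))) \<longlonglongrightarrow> (\<Sum>r=1..D. K r * 0 ^ r)"
    unfolding rel_series_def by (intro tendsto_sum)
  then show ?thesis by (simp add: zero_power)
qed

text \<open>The truncation \<open>T\<close> at a fixed degree has mean tending to 1 because its
  finitely many relation terms vanish in the limit. The product and \<open>T\<close> are close by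
  Cauchy's estimate where the normalised sum \<open>X\<close> is at most \<open>L\<close>; elsewhere
  the product is bounded, \<open>T\<close> is bounded in mean square, and \<open>X\<close> is rarely
  large.\<close>

lemma integral_riesz_product_tendsto_1:
  "(\<lambda>N. \<E> x. (\<Prod>k\<in>{1..N}. 1 + \<i> * of_real (t / sqrt N) * of_real (c x k))) \<longlonglongrightarrow> 1"
proof (rule LIMSEQ_I)
  fix \<epsilon> :: real assume \<epsilon>: "\<epsilon> > 0"
  interpret prob_space unit_interval_measure by (rule prob_space_unit_interval)
  define B where "B = 2 * exp (t\<^sup>2) + 16 * exp (2 * t\<^sup>2) + moment_bound 1"
  have B: "B \<ge> 0" unfolding B_def using moment_bound_nonneg[of 1] by (intro add_nonneg_nonneg) auto
  \<comment> \<open>The order of choice matters: \<open>L\<close> depends on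
    \<open>\<epsilon>\<close> and on the uniform second moment bound \<open>B\<close>, the degree
    \<open>D\<close> on \<open>L\<close> through \<open>Z\<close>, and finally \<open>N\<close> on
    \<open>D\<close>. Each of the three errors gets \<open>\<epsilon> / 3\<close>.\<close>
  define L where "L = 3 * B / \<epsilon> + 1"
  have L: "L > 0" "B / L < \<epsilon> / 3" using B \<epsilon> by (auto simp: L_def field_simps add_pos_nonneg)
  define Z where "Z = exp (2 * \<bar>t\<bar> * L + 2 * t\<^sup>2)"
  have "(\<lambda>D. (1/2::real) ^ D * Z) \<longlonglongrightarrow> 0 * Z"
    by (intro tendsto_intros LIMSEQ_realpow_zero) auto
  then have "eventually (\<lambda>D. (1/2::real) ^ D * Z < \<epsilon> / 3) sequentially"
    using \<epsilon> by (intro order_tendstoD(2)[of _ "0 * Z"]) auto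
  then obtain D where D: "(1/2::real) ^ D * Z < \<epsilon> / 3" by (auto simp: eventually_sequentially)
  have e1: "eventually (\<lambda>N. rel_series D (\<bar>t\<bar> / sqrt (real N)) < \<epsilon> / 3) sequentially"
    using \<epsilon> by (intro order_tendstoD(2)[OF rel_series_tendsto_0]) auto
  have e2: "eventually (\<lambda>N. rel_series (2 * D) (2 * \<bar>t\<bar> / sqrt (real N)) < 1) sequentially"
    by (intro order_tendstoD(2)[OF rel_series_tendsto_0]) auto
  have e3: "eventually (\<lambda>N. 2 * \<bar>t\<bar> / sqrt (real N) < 1) sequentially"
    by real_asymp
  have "eventually (\<lambda>N. norm ((\<E> x. (\<Prod>k\<in>{1..N}. 1 + \<i> * of_real (t / sqrt N) * of_real (c x k))) - 1) < \<epsilon>) sequentially"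
    using e1 e2 e3 eventually_gt_at_top[of 0]
  proof eventually_elim
    case (elim N)
    define I where "I = {1..N}"
    have I: "finite I" "I \<subseteq> {1..}" "card I = N" by (auto simp: I_def)
    define \<tau> where "\<tau> = \<bar>t\<bar> / sqrt N"
    have \<tau>: "\<tau> \<ge> 0" "2 * \<tau> \<le> 1" "N * \<tau>\<^sup>2 = t\<^sup>2" using elim by (auto simp: \<tau>_def power_divide)
    define z where "z = \<i> * of_real (t / sqrt N)"
    have nz: "cmod z = \<tau>" by (simp add: z_def \<tau>_def norm_mult norm_divide)
    define P where "P = (\<lambda>x. \<Prod>k\<in>I. 1 + z * of_real (c x k))"
    define T where "T = (\<lambda>x. tsum (\<lambda>k. complex_of_real (c x k)) I D z)"
    define A where "A = (\<lambda>x. \<Sum>p\<le>D. \<tau> ^ p * \<bar>esum (c x) I p\<bar>)"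
    define X where "X = (\<lambda>x. (\<Sum>k\<in>I. c x k) / sqrt N)"
    have contP: "continuous_on UNIV P" and contT: "continuous_on UNIV T"
      and contA: "continuous_on UNIV A" and contX: "continuous_on UNIV X"
      unfolding P_def T_def A_def X_def using elim by (auto intro!: continuous_intros)
    have A0: "A x \<ge> 0" for x unfolding A_def using \<tau> by (intro sum_nonneg) auto
    have nT: "cmod (T x) \<le> A x" for x
      unfolding T_def A_def tsum_def esum_of_real
      by (rule order_trans[OF norm_sum]) (simp add: norm_mult norm_power nz)
    have nP: "cmod (P x) \<le> exp (t\<^sup>2 / 2)" for x
    proof -
      have "cmod (P x) = (\<Prod>k\<in>I. cmod (1 + z * of_real (c x k)))" by (simp add: P_def prod_norm)
      also have "\<dots> \<le> (\<Prod>k\<in>I. exp (\<tau>\<^sup>2 / 2))"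
      proof (intro prod_mono conjI)
        fix k
        have "cmod (1 + z * of_real (c x k)) \<le> exp (Re (z * of_real (c x k)) + (cmod (z * of_real (c x k)))\<^sup>2 / 2)"
          by (rule norm_one_plus_le_exp)
        also have "\<dots> = exp (\<tau>\<^sup>2 * (c x k)\<^sup>2 / 2)"
          unfolding norm_mult nz by (simp add: z_def power_mult_distrib)
        also have "\<dots> \<le> exp (\<tau>\<^sup>2 / 2)"
          using abs_cosf_le_1[of m k x] by (simp add: mult_left_le abs_square_le_1)
        finally show "cmod (1 + z * of_real (c x k)) \<le> exp (\<tau>\<^sup>2 / 2)" .
      qed auto
      also have "\<dots> = exp (N * \<tau>\<^sup>2 / 2)" by (simp add: I exp_of_nat_mult [symmetric])
      finally show ?thesis using \<tau> by simp
    qed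
    have diff: "cmod (P x - T x) \<le> (1/2) ^ D * Z + (exp (t\<^sup>2) * 2 + 2 * (A x)\<^sup>2 + (X x)\<^sup>2) / L" for x
    proof (cases "\<bar>X x\<bar> \<le> L")
      case True
      have "cmod (P x - T x) \<le> (1/2) ^ D * exp (2 * cmod z * \<bar>\<Sum>k\<in>I. c x k\<bar> + 2 * (cmod z)\<^sup>2 * (\<Sum>k\<in>I. (c x k)\<^sup>2))"
        unfolding P_def T_def by (rule norm_prod_one_plus_minus_tsum_le[OF I(1)])
      also have "\<dots> \<le> (1/2) ^ D * Z"
      proof -
        have "2 * cmod z * \<bar>\<Sum>k\<in>I. c x k\<bar> = 2 * \<bar>t\<bar> * \<bar>X x\<bar>" by (simp add: nz \<tau>_def X_def)
        also have "\<dots> \<le> 2 * \<bar>t\<bar> * L" using True by (intro mult_left_mono) auto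
        finally have 1: "2 * cmod z * \<bar>\<Sum>k\<in>I. c x k\<bar> \<le> 2 * \<bar>t\<bar> * L" .
        have "(\<Sum>k\<in>I. (c x k)\<^sup>2) \<le> (\<Sum>k\<in>I. 1)"
          using abs_cosf_le_1[of m _ x] by (intro sum_mono) (simp add: abs_square_le_1)
        then have "2 * (cmod z)\<^sup>2 * (\<Sum>k\<in>I. (c x k)\<^sup>2) \<le> 2 * \<tau>\<^sup>2 * N"
          unfolding nz by (intro mult_mono) (auto simp: I intro!: sum_nonneg)
        then have 2: "2 * (cmod z)\<^sup>2 * (\<Sum>k\<in>I. (c x k)\<^sup>2) \<le> 2 * t\<^sup>2" using \<tau>(3) by (simp add: mult_ac)
        show ?thesis unfolding Z_def using add_mono[OF 1 2] by simp
      qed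
      also have "\<dots> \<le> (1/2) ^ D * Z + (exp (t\<^sup>2) * 2 + 2 * (A x)\<^sup>2 + (X x)\<^sup>2) / L"
        using L by simp
      finally show ?thesis .
    next
      case False
      define W where "W = exp (t\<^sup>2 / 2) + A x"
      have W0: "W \<ge> 0" using A0 by (simp add: W_def add_nonneg_nonneg)
      have "cmod (P x - T x) \<le> W"
        unfolding W_def using norm_triangle_ineq4[of "P x" "T x"] nP[of x] nT[of x] by linarith
      \<comment> \<open>Chebyshev's argument in integrated form: outside the range of
        \<open>L\<close> the factor \<open>\<bar>X x\<bar> / L\<close> exceeds 1, and the product
        \<open>W * \<bar>X x\<bar>\<close> then requires only second moments.\<close>
      also have "W \<le> W * \<bar>X x\<bar> / L"
        using False W0 L by (simp add: le_divide_eq mult_left_mono)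
      also have "W * \<bar>X x\<bar> \<le> W\<^sup>2 + \<bar>X x\<bar>\<^sup>2"
        using sum_squares_bound[of W "\<bar>X x\<bar>"] mult_nonneg_nonneg[OF W0 abs_ge_zero[of "X x"]] by linarith
      also have "W\<^sup>2 \<le> exp (t\<^sup>2) * 2 + 2 * (A x)\<^sup>2"
      proof -
        have "W\<^sup>2 \<le> 2 * (exp (t\<^sup>2 / 2))\<^sup>2 + 2 * (A x)\<^sup>2"
          using sum_squares_bound[of "exp (t\<^sup>2 / 2)" "A x"] unfolding W_def by (simp add: power2_sum)
        also have "(exp (t\<^sup>2 / 2))\<^sup>2 = exp (t\<^sup>2)" by (simp add: exp_double [symmetric])
        finally show ?thesis by simp
      qed
      finally have "cmod (P x - T x) \<le> (exp (t\<^sup>2) * 2 + 2 * (A x)\<^sup>2 + (X x)\<^sup>2) / L"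
        using L by (simp add: divide_right_mono)
      also have "\<dots> \<le> (1/2) ^ D * Z + \<dots>" by (simp add: Z_def)
      finally show ?thesis .
    qed
    have EA: "(\<E> x. (A x)\<^sup>2) \<le> 8 * exp (2 * t\<^sup>2)"
    proof -
      have "(\<E> x. (A x)\<^sup>2) \<le> 4 * exp (2 * card I * \<tau>\<^sup>2) * (1 + rel_series (2 * D) (2 * \<tau>))"
        unfolding A_def by (rule integral_abs_tsum_square_le[OF I(1,2) \<tau>(1,2)])
      also have "2 * card I * \<tau>\<^sup>2 = 2 * t\<^sup>2" using \<tau>(3) I by simp
      also have "4 * exp (2 * t\<^sup>2) * (1 + rel_series (2 * D) (2 * \<tau>)) \<le> 4 * exp (2 * t\<^sup>2) * 2"
        using elim by (intro mult_left_mono) (auto simp: \<tau>_def)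
      finally show ?thesis by simp
    qed
    have EX: "(\<E> x. (X x)\<^sup>2) \<le> moment_bound 1"
      using integral_sum_power_le[OF I(1,2), of 1] elim
      by (simp add: X_def power_divide I divide_le_eq)
    have "cmod ((\<E> x. P x) - 1) \<le> cmod ((\<E> x. P x) - (\<E> x. T x)) + cmod ((\<E> x. T x) - 1)"
      using norm_triangle_ineq[of "(\<E> x. P x) - (\<E> x. T x)" "(\<E> x. T x) - 1"] by simp
    also have "cmod ((\<E> x. T x) - 1) \<le> rel_series D \<tau>"
      unfolding T_def nz [symmetric] by (rule norm_integral_tsum_minus_one_le[OF I(1,2)])
    also have "(\<E> x. P x) - (\<E> x. T x) = (\<E> x. P x - T x)"
      by (intro Bochner_Integration.integral_diff [symmetric] integrable_continuous_unit_interval contP contT)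
    also have "cmod \<dots> \<le> (\<E> x. cmod (P x - T x))" by (rule integral_norm_bound)
    also have "\<dots> \<le> (\<E> x. (1/2) ^ D * Z + (exp (t\<^sup>2) * 2 + 2 * (A x)\<^sup>2 + (X x)\<^sup>2) / L)"
      using L by (intro integral_mono diff integrable_continuous_unit_interval continuous_intros contP contT contA contX) auto
    also have "\<dots> = (1/2) ^ D * Z + (exp (t\<^sup>2) * 2 + 2 * (\<E> x. (A x)\<^sup>2) + (\<E> x. (X x)\<^sup>2)) / L"
    proof -
      have ia: "integrable unit_interval_measure (\<lambda>x. (A x)\<^sup>2)" "integrable unit_interval_measure (\<lambda>x. (X x)\<^sup>2)"
        by (intro integrable_continuous_unit_interval continuous_intros contA contX)+
      then show ?thesis using prob_space by simp
    qed
    also have "\<dots> \<le> (1/2) ^ D * Z + B / L"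
      using EA EX L unfolding B_def by (intro add_left_mono divide_right_mono) auto
    finally have "cmod ((\<E> x. P x) - 1) \<le> (1/2) ^ D * Z + B / L + rel_series D \<tau>" by simp
    also have "\<dots> < \<epsilon>" using D L elim(1) unfolding \<tau>_def by linarith
    finally show ?case by (simp add: P_def I_def z_def)
  qed
  then show "\<exists>no. \<forall>N\<ge>no. norm ((\<E> x. (\<Prod>k\<in>{1..N}. 1 + \<i> * of_real (t / sqrt N) * of_real (c x k))) - 1) < \<epsilon>"
    by (simp add: eventually_sequentially)
qed

text \<open>Two errors of order \<open>1 / sqrt N\<close>: the cubic one of the factorwise
  comparison, and the replacement of the random exponent \<open>\<tau>\<^sup>2 * Q x / 2\<close> by
  \<open>t\<^sup>2 / 4\<close>, which costs the fluctuation of \<open>Q\<close> about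
  \<open>N / 2\<close>, of order \<open>sqrt N\<close> in mean square.\<close>

lemma integral_iexp_approx:
  assumes N: "N > 0" "\<bar>t\<bar> \<le> sqrt N"
  shows "cmod ((\<E> x. iexp (t * ((\<Sum>k=1..N. c x k) / sqrt N)))
      - (\<E> x. (\<Prod>k\<in>{1..N}. 1 + \<i> * of_real (t / sqrt N) * of_real (c x k))) * complex_of_real (exp (- (t\<^sup>2) / 4)))
    \<le> (2 * \<bar>t\<bar> ^ 3 + exp (t\<^sup>2 / 2) * (t\<^sup>2 / 2) * (1 + moment_bound 1)) / sqrt N"
proof -
  interpret prob_space unit_interval_measure by (rule prob_space_unit_interval)
  define I where "I = {1..N}"
  have I: "finite I" "I \<subseteq> {1..}" "card I = N" by (auto simp: I_def)
  define \<tau> where "\<tau> = t / sqrt N"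
  have \<tau>: "\<bar>\<tau>\<bar> \<le> 1" "N * \<tau>\<^sup>2 = t\<^sup>2" "N * \<bar>\<tau>\<bar> ^ 3 = \<bar>t\<bar> ^ 3 / sqrt N"
  proof -
    show "\<bar>\<tau>\<bar> \<le> 1" "N * \<tau>\<^sup>2 = t\<^sup>2" using N by (auto simp: \<tau>_def power_divide)
    have "N * \<bar>\<tau>\<bar> ^ 3 = (N * \<tau>\<^sup>2) * \<bar>\<tau>\<bar>" by (simp add: power2_eq_square power3_eq_cube)
    also have "\<dots> = t\<^sup>2 * \<bar>\<tau>\<bar>" using \<open>N * \<tau>\<^sup>2 = t\<^sup>2\<close> by simp
    also have "\<dots> = \<bar>t\<bar> ^ 3 / sqrt N" by (simp add: \<tau>_def power2_eq_square power3_eq_cube abs_mult [symmetric])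
    finally show "N * \<bar>\<tau>\<bar> ^ 3 = \<bar>t\<bar> ^ 3 / sqrt N" .
  qed
  define P where "P = (\<lambda>x. \<Prod>k\<in>I. 1 + \<i> * of_real \<tau> * of_real (c x k))"
  define Q where "Q = (\<lambda>x. \<Sum>k\<in>I. (c x k)\<^sup>2)"
  define Y where "Y = (\<lambda>x. iexp (t * ((\<Sum>k\<in>I. c x k) / sqrt N)))"
  have cont: "continuous_on UNIV P" "continuous_on UNIV Q" "continuous_on UNIV Y"
    unfolding P_def Q_def Y_def using N by (auto intro!: continuous_intros)
  have Q0: "Q x \<ge> 0" for x by (simp add: Q_def sum_nonneg)
  have factor: "cmod (iexp (\<tau> * c x k)) = 1" "cmod ((1 + \<i> * of_real (\<tau> * c x k)) * complex_of_real (exp (- (\<tau> * c x k)\<^sup>2 / 2))) \<le> 1"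
    "cmod (1 + \<i> * of_real (\<tau> * c x k)) \<le> exp ((\<tau> * c x k)\<^sup>2 / 2)" for x k
  proof -
    show "cmod (iexp (\<tau> * c x k)) = 1" by (rule norm_exp_i_times)
    show *: "cmod (1 + \<i> * of_real (\<tau> * c x k)) \<le> exp ((\<tau> * c x k)\<^sup>2 / 2)"
      using norm_one_plus_le_exp[of "\<i> * of_real (\<tau> * c x k)"]
      unfolding norm_mult norm_ii norm_of_real by simp
    have "cmod ((1 + \<i> * of_real (\<tau> * c x k)) * complex_of_real (exp (- (\<tau> * c x k)\<^sup>2 / 2))) =
        cmod (1 + \<i> * of_real (\<tau> * c x k)) * exp (- ((\<tau> * c x k)\<^sup>2 / 2))"
      by (simp add: norm_mult)
    also have "\<dots> \<le> exp ((\<tau> * c x k)\<^sup>2 / 2) * exp (- ((\<tau> * c x k)\<^sup>2 / 2))"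
      using * by (intro mult_right_mono) auto
    also have "\<dots> = 1" by (simp add: exp_add [symmetric])
    finally show "cmod ((1 + \<i> * of_real (\<tau> * c x k)) * complex_of_real (exp (- (\<tau> * c x k)\<^sup>2 / 2))) \<le> 1" .
  qed
  have 1: "cmod (Y x - P x * complex_of_real (exp (- \<tau>\<^sup>2 * Q x / 2))) \<le> 2 * \<bar>t\<bar> ^ 3 / sqrt N" for x
  proof -
    have "Y x = (\<Prod>k\<in>I. iexp (\<tau> * c x k))"
    proof -
      have "\<i> * complex_of_real (t * ((\<Sum>k\<in>I. c x k) / sqrt N)) = (\<Sum>k\<in>I. \<i> * complex_of_real (\<tau> * c x k))"
        by (simp add: \<tau>_def sum_distrib_left sum_divide_distrib)
      then show ?thesis unfolding Y_def using I by (simp only: exp_sum)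
    qed
    moreover have "P x * complex_of_real (exp (- \<tau>\<^sup>2 * Q x / 2)) = (\<Prod>k\<in>I. (1 + \<i> * of_real (\<tau> * c x k)) * complex_of_real (exp (- (\<tau> * c x k)\<^sup>2 / 2)))"
    proof -
      have "exp (- \<tau>\<^sup>2 * Q x / 2) = (\<Prod>k\<in>I. exp (- (\<tau> * c x k)\<^sup>2 / 2))"
        unfolding exp_sum[OF I(1), symmetric] Q_def
        by (simp add: sum_distrib_left sum_divide_distrib power_mult_distrib sum_negf)
      then show ?thesis by (simp add: P_def prod.distrib mult.assoc)
    qed
    \<comment> \<open>All factors have modulus at most 1, so the two products differ by at most the
      sum of the differences of their factors.\<close>
    ultimately have "cmod (Y x - P x * complex_of_real (exp (- \<tau>\<^sup>2 * Q x / 2))) \<le>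
       (\<Sum>k\<in>I. cmod (iexp (\<tau> * c x k) - (1 + \<i> * of_real (\<tau> * c x k)) * complex_of_real (exp (- (\<tau> * c x k)\<^sup>2 / 2))))"
      by (simp only:) (intro norm_prod_diff, simp_all only: factor order_refl)
    also have "\<dots> \<le> (\<Sum>k\<in>I. 2 * \<bar>\<tau>\<bar> ^ 3)"
    proof (intro sum_mono)
      fix k
      have b: "\<bar>\<tau> * c x k\<bar> \<le> \<bar>\<tau>\<bar>" using abs_cosf_le_1[of m k x] by (simp add: abs_mult mult_left_le)
      have "cmod (iexp (\<tau> * c x k) - (1 + \<i> * of_real (\<tau> * c x k)) * complex_of_real (exp (- (\<tau> * c x k)\<^sup>2 / 2))) \<le> 2 * \<bar>\<tau> * c x k\<bar> ^ 3"
        using b \<tau> by (intro iexp_approx_product) auto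
      also have "\<dots> \<le> 2 * \<bar>\<tau>\<bar> ^ 3" using b by (intro mult_left_mono power_mono) auto
      finally show "cmod (iexp (\<tau> * c x k) - (1 + \<i> * of_real (\<tau> * c x k)) * complex_of_real (exp (- (\<tau> * c x k)\<^sup>2 / 2))) \<le> 2 * \<bar>\<tau>\<bar> ^ 3" .
    qed
    also have "\<dots> = 2 * (N * \<bar>\<tau>\<bar> ^ 3)" by (simp add: I)
    finally show ?thesis using \<tau>(3) by simp
  qed
  have nP: "cmod (P x) \<le> exp (t\<^sup>2 / 2)" for x
  proof -
    have "cmod (P x) = (\<Prod>k\<in>I. cmod (1 + \<i> * of_real (\<tau> * c x k)))" by (simp add: P_def prod_norm mult.assoc)
    also have "\<dots> \<le> (\<Prod>k\<in>I. exp (\<tau>\<^sup>2 / 2))"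
    proof (intro prod_mono conjI)
      fix k
      have "(\<tau> * c x k)\<^sup>2 \<le> \<tau>\<^sup>2"
        using abs_cosf_le_1[of m k x] by (simp add: power_mult_distrib mult_left_le abs_square_le_1)
      then have "exp ((\<tau> * c x k)\<^sup>2 / 2) \<le> exp (\<tau>\<^sup>2 / 2)" by simp
      then show "cmod (1 + \<i> * of_real (\<tau> * c x k)) \<le> exp (\<tau>\<^sup>2 / 2)" by (rule order_trans[OF factor(3)])
    qed auto
    also have "\<dots> = exp (N * \<tau>\<^sup>2 / 2)" by (simp add: I exp_of_nat_mult [symmetric])
    finally show ?thesis using \<tau> by simp
  qed
  have lip: "\<bar>exp (- a) - exp (- b)\<bar> \<le> \<bar>a - b\<bar>" if "a \<ge> 0" "b \<ge> 0" for a b :: real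
  proof -
    have *: "exp (- a) - exp (- b) \<le> b - a" if "a \<le> b" "a \<ge> 0" for a b :: real
    proof -
      have "exp (- a) - exp (- b) = exp (- a) * (1 - exp (- (b - a)))" by (simp add: algebra_simps exp_add [symmetric])
      also have "\<dots> \<le> 1 * (b - a)"
      proof (intro mult_mono)
        show "1 - exp (- (b - a)) \<le> b - a" using exp_ge_add_one_self[of "- (b - a)"] by linarith
      qed (use that in auto)
      finally show ?thesis by simp
    qed
    show ?thesis using *[of a b] *[of b a] that by (cases "a \<le> b") auto
  qed
  have 2: "cmod (P x * complex_of_real (exp (- \<tau>\<^sup>2 * Q x / 2)) - P x * complex_of_real (exp (- (t\<^sup>2) / 4))) \<le>
      exp (t\<^sup>2 / 2) * (t\<^sup>2 / 2) / sqrt N * (1 + (Q x - N / 2)\<^sup>2 / N)" for x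
  proof -
    have "cmod (P x * complex_of_real (exp (- \<tau>\<^sup>2 * Q x / 2)) - P x * complex_of_real (exp (- (t\<^sup>2) / 4))) = cmod (P x) * \<bar>exp (- (\<tau>\<^sup>2 * Q x / 2)) - exp (- (t\<^sup>2 / 4))\<bar>"
      unfolding right_diff_distrib [symmetric] norm_mult of_real_diff [symmetric] norm_of_real by simp
    also have "\<dots> \<le> exp (t\<^sup>2 / 2) * \<bar>\<tau>\<^sup>2 * Q x / 2 - t\<^sup>2 / 4\<bar>"
      using Q0 by (intro mult_mono nP lip) auto
    also have "\<tau>\<^sup>2 * Q x / 2 - t\<^sup>2 / 4 = t\<^sup>2 / 2 / sqrt N * ((Q x - N / 2) / sqrt N)"
      using N by (simp add: \<tau>_def power_divide field_simps)
    also have "\<bar>\<dots>\<bar> = t\<^sup>2 / 2 / sqrt N * \<bar>(Q x - N / 2) / sqrt N\<bar>" by (simp add: abs_mult)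
    also have "exp (t\<^sup>2 / 2) * (t\<^sup>2 / 2 / sqrt N * \<bar>(Q x - N / 2) / sqrt N\<bar>) \<le>
        exp (t\<^sup>2 / 2) * (t\<^sup>2 / 2 / sqrt N * (1 + (Q x - N / 2)\<^sup>2 / N))"
    proof (intro mult_left_mono)
      have "\<bar>(Q x - N / 2) / sqrt N\<bar> \<le> 1 + \<bar>(Q x - N / 2) / sqrt N\<bar>\<^sup>2"
        using sum_squares_bound[of 1 "\<bar>(Q x - N / 2) / sqrt N\<bar>"] abs_ge_zero[of "(Q x - N / 2) / sqrt N"]
        unfolding mult_1_right one_power2 by linarith
      then show "\<bar>(Q x - N / 2) / sqrt N\<bar> \<le> 1 + (Q x - N / 2)\<^sup>2 / N" by (simp add: power_divide)
    qed auto
    finally show ?thesis by (simp add: mult_ac)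
  qed
  have EQ: "(\<E> x. (Q x - N / 2)\<^sup>2) / N \<le> moment_bound 1"
    using integral_sum_squares_power_le[OF I(1,2), of 1] N by (simp add: Q_def I divide_le_eq)
  have "(\<E> x. Y x) - (\<E> x. P x) * complex_of_real (exp (- (t\<^sup>2) / 4)) =
    (\<E> x. Y x - P x * complex_of_real (exp (- (t\<^sup>2) / 4)))"
    by (subst Bochner_Integration.integral_diff)
      (auto intro!: integrable_continuous_unit_interval continuous_intros cont)
  also have "cmod \<dots> \<le> (\<E> x. cmod (Y x - P x * complex_of_real (exp (- (t\<^sup>2) / 4))))"
    by (rule integral_norm_bound)
  also have "\<dots> \<le> (\<E> x. 2 * \<bar>t\<bar> ^ 3 / sqrt N + exp (t\<^sup>2 / 2) * (t\<^sup>2 / 2) / sqrt N * (1 + (Q x - N / 2)\<^sup>2 / N))"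
  proof (intro integral_mono integrable_continuous_unit_interval continuous_intros cont)
    show "cmod (Y x - P x * complex_of_real (exp (- (t\<^sup>2) / 4))) \<le> 2 * \<bar>t\<bar> ^ 3 / sqrt N + exp (t\<^sup>2 / 2) * (t\<^sup>2 / 2) / sqrt N * (1 + (Q x - N / 2)\<^sup>2 / N)" for x
      using norm_triangle_mono[OF 1[of x] 2[of x]] by simp
  qed (use N in auto)
  also have "\<dots> = 2 * \<bar>t\<bar> ^ 3 / sqrt N + exp (t\<^sup>2 / 2) * (t\<^sup>2 / 2) / sqrt N * (1 + (\<E> x. (Q x - N / 2)\<^sup>2) / N)"
  proof -
    have "integrable unit_interval_measure (\<lambda>x. (Q x - N / 2)\<^sup>2)"
      by (intro integrable_continuous_unit_interval continuous_intros cont)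
    then show ?thesis using prob_space by simp
  qed
  also have "\<dots> \<le> 2 * \<bar>t\<bar> ^ 3 / sqrt N + exp (t\<^sup>2 / 2) * (t\<^sup>2 / 2) / sqrt N * (1 + moment_bound 1)"
    using EQ by (intro add_left_mono mult_left_mono) auto
  also have "\<dots> = (2 * \<bar>t\<bar> ^ 3 + exp (t\<^sup>2 / 2) * (t\<^sup>2 / 2) * (1 + moment_bound 1)) / sqrt N"
    by (simp add: add_divide_distrib)
  finally show ?thesis by (simp add: Y_def P_def I_def \<tau>_def)
qed

text \<open>Levy's continuity theorem. The limit variance \<open>1/2\<close> is the mean of a
  squared cosine; it enters through the factor \<open>exp (- (t\<^sup>2) / 4)\<close>, while the
  remaining product has mean tending to 1.\<close>

lemma central_limit:
  "weak_conv_m (\<lambda>N. distr unit_interval_measure borel (\<lambda>x. (\<Sum>k=1..N. c x k) / sqrt N))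
     (density lborel (normal_density 0 (sqrt (1/2))))"
proof (rule levy_continuity)
  interpret prob_space unit_interval_measure by (rule prob_space_unit_interval)
  let ?X = "\<lambda>N x. (\<Sum>k=1..N. c x k) / sqrt (real N)"
  have meas: "?X N \<in> borel_measurable unit_interval_measure" for N
  proof -
    have "continuous_on UNIV (\<lambda>x. (\<Sum>k=1..N. c x k) * (1 / sqrt (real N)))" by (intro continuous_intros)
    then have "(\<lambda>x. (\<Sum>k=1..N. c x k) * (1 / sqrt (real N))) \<in> borel_measurable borel"
      by (rule borel_measurable_continuous_onI)
    then show ?thesis by (intro measurable_unit_interval) simp
  qed
  show "real_distribution (distr unit_interval_measure borel (?X N))" for N
    by (rule real_distribution_distr) (use meas in simp)
  show "real_distribution (density lborel (normal_density 0 (sqrt (1/2))))"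
    by (rule char_normal_density) simp
  fix t
  let ?P = "\<lambda>N. \<E> x. (\<Prod>k\<in>{1..N}. 1 + \<i> * of_real (t / sqrt (real N)) * of_real (c x k))"
  have ch: "char (distr unit_interval_measure borel (?X N)) t = (\<E> x. iexp (t * ?X N x))" for N
    unfolding char_def using meas[of N] by (subst integral_distr) auto
  have "(\<lambda>N. (\<E> x. iexp (t * ?X N x)) - ?P N * complex_of_real (exp (- (t\<^sup>2) / 4))) \<longlonglongrightarrow> 0"
  proof (rule Lim_null_comparison)
    have "eventually (\<lambda>N. \<bar>t\<bar> \<le> sqrt (real N)) sequentially" by real_asymp
    then show "eventually (\<lambda>N. norm ((\<E> x. iexp (t * ?X N x)) - ?P N * complex_of_real (exp (- (t\<^sup>2) / 4)))
       \<le> (2 * \<bar>t\<bar> ^ 3 + exp (t\<^sup>2 / 2) * (t\<^sup>2 / 2) * (1 + moment_bound 1)) / sqrt (real N)) sequentially"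
      using eventually_gt_at_top[of 0] by eventually_elim (rule integral_iexp_approx)
    show "(\<lambda>N. (2 * \<bar>t\<bar> ^ 3 + exp (t\<^sup>2 / 2) * (t\<^sup>2 / 2) * (1 + moment_bound 1)) / sqrt (real N)) \<longlonglongrightarrow> 0"
    proof -
      have "(\<lambda>N. a / sqrt (real N)) \<longlonglongrightarrow> 0" for a by real_asymp
      then show ?thesis .
    qed
  qed
  moreover have "(\<lambda>N. ?P N * complex_of_real (exp (- (t\<^sup>2) / 4))) \<longlonglongrightarrow> 1 * complex_of_real (exp (- (t\<^sup>2) / 4))"
    by (intro tendsto_mult integral_riesz_product_tendsto_1 tendsto_const)
  ultimately have "(\<lambda>N. \<E> x. iexp (t * ?X N x)) \<longlonglongrightarrow> exp (- (t\<^sup>2) / 4)"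
    using Lim_transform by fastforce
  moreover have "char (density lborel (normal_density 0 (sqrt (1/2)))) t = exp (- (t\<^sup>2) / 4)"
    by (subst char_normal_density) (auto simp: power_mult_distrib)
  ultimately show "(\<lambda>N. char (distr unit_interval_measure borel (?X N)) t) \<longlonglongrightarrow> char (density lborel (normal_density 0 (sqrt (1/2)))) t"
    unfolding ch by simp
qed

end

section \<open>Exponential moments on the good set\<close>

lemma integrable_indicator_continuous:
  fixes f :: "real \<Rightarrow> real"
  assumes "A \<in> sets borel" "continuous_on UNIV f"
  shows "integrable unit_interval_measure (\<lambda>x. indicator A x * f x)"
proof (rule Bochner_Integration.integrable_bound)
  show "integrable unit_interval_measure f" by (rule integrable_continuous_unit_interval) fact
  have [measurable]: "f \<in> borel_measurable borel" by (rule borel_measurable_continuous_onI) fact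
  show "(\<lambda>x. indicator A x * f x) \<in> borel_measurable unit_interval_measure"
    using assms(1) by (intro measurable_unit_interval) simp
qed (auto simp: indicator_def)

lemma integrable_indicator_unit_interval:
  "A \<in> sets borel \<Longrightarrow> integrable unit_interval_measure (indicat_real A)"
  using integrable_indicator_continuous[of A "\<lambda>_. 1"] by simp

context cos_system
begin

definition csum :: "nat set \<Rightarrow> real \<Rightarrow> real" where "csum I x = (\<Sum>k\<in>I. c x k)"

definition sqsum :: "nat set \<Rightarrow> real \<Rightarrow> real" where "sqsum I x = (\<Sum>k\<in>I. (c x k)\<^sup>2)"

definition riesz :: "nat set \<Rightarrow> real \<Rightarrow> real \<Rightarrow> real" where "riesz I l x = (\<Prod>k\<in>I. 1 + l * c x k)"

lemma continuous_on_csum [continuous_intros]: "continuous_on X (csum I)"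
  and continuous_on_sqsum [continuous_intros]: "continuous_on X (sqsum I)"
  and continuous_on_riesz [continuous_intros]: "continuous_on X (riesz I l)"
  unfolding csum_def sqsum_def riesz_def by (intro continuous_intros)+

lemma sqsum_nonneg: "sqsum I x \<ge> 0"
  by (simp add: sqsum_def sum_nonneg)

lemma sqsum_le_card: "sqsum I x \<le> card I"
proof -
  have "sqsum I x \<le> (\<Sum>k\<in>I. 1)"
    unfolding sqsum_def using abs_cosf_le_1[of m _ x] by (intro sum_mono) (simp add: abs_square_le_1)
  then show ?thesis by simp
qed

end

section \<open>Parameters and approximations for blocks of size at least
  \<open>2 ^ t\<close>\<close>

locale lil_system = cos_system +
  fixes C :: real and \<alpha> :: nat
  assumes C_nonneg: "C \<ge> 0" and \<alpha>_ge_1: "\<alpha> \<ge> 1"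
    and K_le: "r \<ge> 1 \<Longrightarrow> K r \<le> C * exp (3 * real r ^ \<alpha>)"
begin

text \<open>Chosen so that a degree \<open>D\<close> up to \<open>t powr gam\<close> satisfies
  \<open>D ^ \<alpha> \<le> sqrt t\<close>: the growth bound for the number of relations then stays
  at \<open>exp\<close> of a multiple of \<open>sqrt t\<close>, negligible against
  \<open>2 ^ t\<close>.\<close>

definition gam :: real where "gam = 1 / (2 * real \<alpha>)"

definition trunc :: "nat \<Rightarrow> nat" where "trunc t = nat \<lfloor>real t powr gam\<rfloor>"

text \<open>Both bounds are generous compared with the typical sizes \<open>sqrt (card I)\<close>,
  so the complement is tiny. They are still strict enough: the power \<open>gam / 2\<close> is half
  that of the truncation degree, and a deviation \<open>card I powr (3/4)\<close> of the squares is
  negligible after multiplication by \<open>l\<^sup>2\<close>.\<close>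

definition good :: "nat \<Rightarrow> nat set \<Rightarrow> real set" where
  "good t I = {x. \<bar>csum I x\<bar> \<le> real t powr (gam / 2) * sqrt (card I) \<and> \<bar>sqsum I x - card I / 2\<bar> \<le> card I powr (3/4)}"

text \<open>The range of the iterated logarithm: \<open>ln t\<close> is about
  \<open>ln (ln (card I))\<close> when \<open>card I\<close> is near \<open>2 ^ t\<close>. Only a
  lower bound for the size is required, so blocks of different sizes can share one
  \<open>t\<close>.\<close>

definition regime :: "real \<Rightarrow> nat \<Rightarrow> nat set \<Rightarrow> real \<Rightarrow> bool" where
  "regime b t I l \<longleftrightarrow> finite I \<and> I \<subseteq> {1..} \<and> 2 ^ t \<le> real (card I) \<and> l\<^sup>2 * card I \<le> b * ln (real t)"

lemma gam_pos: "gam > 0" and gam_le: "gam \<le> 1"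
  using \<alpha>_ge_1 by (auto simp: gam_def divide_le_eq)

lemma trunc_le: "real (trunc t) \<le> real t powr gam"
  by (simp add: trunc_def)

lemma trunc_ge: "real (trunc t) \<ge> real t powr gam - 1"
  unfolding trunc_def by linarith

lemma trunc_power_le: "t \<ge> 1 \<Longrightarrow> real (trunc t) ^ \<alpha> \<le> sqrt (real t)"
proof -
  assume t: "t \<ge> 1"
  have "real (trunc t) ^ \<alpha> \<le> (real t powr gam) ^ \<alpha>" by (intro power_mono trunc_le) simp
  also have "\<dots> = real t powr (gam * real \<alpha>)" using t by (simp add: powr_powr [symmetric] powr_realpow)
  also have "gam * real \<alpha> = 1/2" using \<alpha>_ge_1 by (simp add: gam_def)
  finally show ?thesis by (simp add: powr_half_sqrt)
qed

lemma trunc_le_self: "t \<ge> 1 \<Longrightarrow> real (trunc t) \<le> real t"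
  using trunc_le[of t] powr_mono[OF gam_le, of "real t"] by simp

lemma good_borel [measurable, simp]: "good t I \<in> sets borel"
proof -
  have [measurable]: "csum I \<in> borel_measurable borel" "sqsum I \<in> borel_measurable borel"
    by (auto intro!: borel_measurable_continuous_onI continuous_intros)
  show ?thesis unfolding good_def by measurable
qed

text \<open>At most \<open>4 * t\<close> terms, each with at most
  \<open>C * exp (a * sqrt t)\<close> relations and weight at most \<open>\<mu>\<^sup>2\<close>,
  which is of order \<open>ln t / 2 ^ t\<close>. The degree \<open>4 * trunc t\<close> covers pairs
  of blocks as well.\<close>

lemma eventually_rel_series_small:
  assumes b: "b > 0" and \<eta>: "\<eta> > 0"
  shows "eventually (\<lambda>t. \<forall>\<mu>. 0 \<le> \<mu> \<and> \<mu>\<^sup>2 * 2 ^ t \<le> b * ln (real t) \<longrightarrow> \<mu> \<le> 1/2 \<and> rel_series (4 * trunc t) \<mu> \<le> \<eta>) sequentially"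
proof -
  \<comment> \<open>The 3 belongs to the growth bound of \<open>K\<close>, and
    \<open>4 ^ \<alpha>\<close> comes from support sizes up to \<open>4 * trunc t\<close>.\<close>
  define a :: real where "a = 3 * 4 ^ \<alpha>"
  have a: "a > 0" by (simp add: a_def)
  have "(\<lambda>t::nat. (4 * C * b) * (real t * exp (a * sqrt (real t)) * ln (real t) / 2 ^ t)) \<longlonglongrightarrow> (4 * C * b) * 0"
    using a by (intro tendsto_mult tendsto_const) real_asymp
  then have e1: "eventually (\<lambda>t. (4 * C * b) * (real t * exp (a * sqrt (real t)) * ln (real t) / 2 ^ t) < \<eta>) sequentially"
    using \<eta> by (intro order_tendstoD(2)) auto
  have "(\<lambda>t::nat. b * ln (real t) / 2 ^ t) \<longlonglongrightarrow> 0" using b by real_asymp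
  then have e2: "eventually (\<lambda>t::nat. b * ln (real t) / 2 ^ t < 1/4) sequentially"
    by (intro order_tendstoD(2)) auto
  show ?thesis
    using e1 e2 eventually_ge_at_top[of 1]
  proof eventually_elim
    case (elim t)
    show ?case
    proof (intro allI impI, elim conjE)
      fix \<mu> :: real assume \<mu>: "0 \<le> \<mu>" "\<mu>\<^sup>2 * 2 ^ t \<le> b * ln (real t)"
      have \<mu>2: "\<mu>\<^sup>2 \<le> b * ln (real t) / 2 ^ t" using \<mu> by (simp add: le_divide_eq)
      also have "\<dots> < 1/4" by (rule elim(2))
      finally have "\<mu>\<^sup>2 \<le> (1/2)\<^sup>2" by (simp add: power_divide)
      then have half: "\<mu> \<le> 1/2" by (rule power2_le_imp_le) simp
      let ?E = "exp (a * sqrt (real t))"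
      have "rel_series (4 * trunc t) \<mu> \<le> (\<Sum>r=1..4 * trunc t. C * ?E * \<mu>\<^sup>2)"
        unfolding rel_series_def
      proof (intro sum_mono)
        fix r assume r: "r \<in> {1..4 * trunc t}"
        show "K r * \<mu> ^ r \<le> C * ?E * \<mu>\<^sup>2"
        \<comment> \<open>One-term relations do not exist, so every contributing term carries at
          least \<open>\<mu>\<^sup>2\<close>.\<close>
        proof (cases "r = 1")
          case True
          then show ?thesis using K_1 C_nonneg by simp
        next
          case False
          have "K r \<le> C * exp (3 * real r ^ \<alpha>)" using r by (intro K_le) auto
          also have "\<dots> \<le> C * ?E"
          proof -
            have "real r \<le> real (4 * trunc t)" using r by (intro of_nat_mono) simp
            then have "real r ^ \<alpha> \<le> (4 * real (trunc t)) ^ \<alpha>" by (intro power_mono) auto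
            also have "\<dots> \<le> 4 ^ \<alpha> * sqrt (real t)" using trunc_power_le[of t] elim by (simp add: power_mult_distrib)
            finally show ?thesis using C_nonneg by (intro mult_left_mono) (auto simp: a_def)
          qed
          finally have "K r \<le> C * ?E" .
          moreover have "\<mu> ^ r \<le> \<mu>\<^sup>2" using r False half \<mu> by (intro power_decreasing) auto
          ultimately show ?thesis using \<mu> C_nonneg by (intro mult_mono) auto
        qed
      qed
      also have "\<dots> = 4 * real (trunc t) * (C * ?E * \<mu>\<^sup>2)" by simp
      also have "\<dots> \<le> 4 * real t * (C * ?E * (b * ln (real t) / 2 ^ t))"
        using trunc_le_self[of t] elim(3) \<mu>2 C_nonneg by (intro mult_mono) auto
      also have "\<dots> = (4 * C * b) * (real t * ?E * ln (real t) / 2 ^ t)" by simp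
      also have "\<dots> \<le> \<eta>" using elim(1) by simp
      finally show "\<mu> \<le> 1/2 \<and> rel_series (4 * trunc t) \<mu> \<le> \<eta>" using half by simp
    qed
  qed
qed

lemma regime_square_le: "regime b t I l \<Longrightarrow> \<bar>l\<bar>\<^sup>2 * 2 ^ t \<le> b * ln (real t)"
  unfolding regime_def power2_abs
  by (elim conjE, rule order_trans[OF mult_left_mono]) auto

text \<open>The cubic error is \<open>(l\<^sup>2 * card I) * \<bar>l\<bar>\<close>; replacing the
  sum of squares by half the cardinality costs \<open>ln t\<close> times
  \<open>(card I) powr (-1/4)\<close>; the truncation error \<open>2 powr (- (t powr gam))\<close>
  beats the exponential of \<open>t powr (gam / 2)\<close> times \<open>sqrt (ln t)\<close> in
  Cauchy's estimate.\<close>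

lemma eventually_good_approx:
  assumes b: "b > 0" and \<eta>: "\<eta> > 0"
  shows "eventually (\<lambda>t. \<forall>I l x. regime b t I l \<and> x \<in> good t I \<longrightarrow>
      riesz I l x > 0 \<and> \<bar>ln (riesz I l x) - (l * csum I x - l\<^sup>2 * card I / 4)\<bar> \<le> \<eta> \<and> \<bar>riesz I l x - tsum (c x) I (trunc t) l\<bar> \<le> \<eta>) sequentially"
proof -
  have "(\<lambda>t::nat. b * ln (real t) * sqrt (b * ln (real t) / 2 ^ t) + b * ln t / 2 * (2 ^ t) powr (-1/4)) \<longlonglongrightarrow> 0"
    using b by real_asymp
  then have e1: "eventually (\<lambda>t::nat. b * ln (real t) * sqrt (b * ln (real t) / 2 ^ t) + b * ln t / 2 * (2 ^ t) powr (-1/4) < \<eta>) sequentially"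
    using \<eta> by (intro order_tendstoD(2)) auto
  have "(\<lambda>t::nat. 2 powr (1 - real t powr gam) * exp (2 * sqrt (b * ln (real t)) * real t powr (gam/2) + 2 * (b * ln (real t)))) \<longlonglongrightarrow> 0"
    using b gam_pos by real_asymp
  then have e2: "eventually (\<lambda>t::nat. 2 powr (1 - real t powr gam) * exp (2 * sqrt (b * ln (real t)) * real t powr (gam/2) + 2 * (b * ln (real t))) < \<eta>) sequentially"
    using \<eta> by (intro order_tendstoD(2)) auto
  show ?thesis
    using e1 e2 eventually_rel_series_small[OF b \<eta>] eventually_ge_at_top[of 1]
  proof eventually_elim
    case (elim t)
    show ?case
    proof (intro allI impI, elim conjE)
      fix I l x assume reg: "regime b t I l" and x: "x \<in> good t I"
      define M where "M = real (card I)"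
      have I: "finite I" "2 ^ t \<le> M" "l\<^sup>2 * M \<le> b * ln (real t)" using reg by (auto simp: regime_def M_def)
      have M1: "M > 0" using I(2) by (smt (verit) zero_less_power)
      have l2: "\<bar>l\<bar>\<^sup>2 * 2 ^ t \<le> b * ln (real t)" by (rule regime_square_le[OF reg])
      have half: "\<bar>l\<bar> \<le> 1/2" using elim(3) l2 by auto
      have lsq: "\<bar>l\<bar> \<le> sqrt (b * ln (real t) / 2 ^ t)"
        using l2 by (intro real_le_rsqrt) (simp add: le_divide_eq)
      have lM: "\<bar>l\<bar> * sqrt M \<le> sqrt (b * ln (real t))"
        using I(3) M1 by (intro real_le_rsqrt) (simp add: power_mult_distrib)
      have xS: "\<bar>csum I x\<bar> \<le> real t powr (gam / 2) * sqrt M" and xQ: "\<bar>sqsum I x - M / 2\<bar> \<le> M powr (3/4)"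
        using x by (auto simp: good_def M_def)
      have c1: "\<bar>c x k\<bar> \<le> 1" for k by (rule abs_cosf_le_1)
      note lnP = abs_ln_prod_one_plus_le[OF I(1) c1 half]
      have pos: "riesz I l x > 0" using lnP(1) by (simp add: riesz_def)
      have "\<bar>ln (riesz I l x) - (l * csum I x - l\<^sup>2 / 2 * sqsum I x)\<bar> \<le> \<bar>l\<bar> ^ 3 * M"
        using lnP(2) by (simp add: riesz_def csum_def sqsum_def M_def)
      moreover have "\<bar>l\<^sup>2 / 2 * sqsum I x - l\<^sup>2 * M / 4\<bar> \<le> b * ln (real t) / 2 * (2 ^ t) powr (-1/4)"
      proof -
        have e: "l\<^sup>2 / 2 * sqsum I x - l\<^sup>2 * M / 4 = l\<^sup>2 / 2 * (sqsum I x - M / 2)" by (simp add: algebra_simps)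
        have "\<bar>l\<^sup>2 / 2 * sqsum I x - l\<^sup>2 * M / 4\<bar> = l\<^sup>2 / 2 * \<bar>sqsum I x - M / 2\<bar>"
          unfolding e by (simp add: abs_mult)
        also have "\<dots> \<le> l\<^sup>2 / 2 * M powr (3/4)" using xQ by (intro mult_left_mono) auto
        also have "M powr (3/4) = M * M powr (-1/4)" using M1 powr_add[of M 1 "-1/4"] by simp
        also have "l\<^sup>2 / 2 * (M * M powr (-1/4)) = (l\<^sup>2 * M) / 2 * M powr (-1/4)" by simp
        also have "\<dots> \<le> (b * ln (real t)) / 2 * (2 ^ t) powr (-1/4)"
        proof (rule mult_mono)
          show "M powr (-1/4) \<le> (2 ^ t) powr (-1/4)" using I by (intro powr_mono2') auto
        qed (use I elim(4) b in auto)
        finally show ?thesis .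
      qed
      moreover have "\<bar>l\<bar> ^ 3 * M \<le> b * ln (real t) * sqrt (b * ln (real t) / 2 ^ t)"
      proof -
        have "\<bar>l\<bar> ^ 3 * M = (l\<^sup>2 * M) * \<bar>l\<bar>" by (simp add: power2_eq_square power3_eq_cube abs_mult [symmetric])
        also have "\<dots> \<le> b * ln (real t) * sqrt (b * ln (real t) / 2 ^ t)"
          by (rule mult_mono) (use I lsq M1 elim(4) b in auto)
        finally show ?thesis .
      qed
      ultimately have A: "\<bar>ln (riesz I l x) - (l * csum I x - l\<^sup>2 * M / 4)\<bar> \<le> \<eta>" using elim(1) by linarith
      have "\<bar>riesz I l x - tsum (c x) I (trunc t) l\<bar> \<le> (1/2) ^ trunc t * exp (2 * \<bar>l\<bar> * \<bar>csum I x\<bar> + 2 * \<bar>l\<bar>\<^sup>2 * sqsum I x)"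
        using norm_prod_one_plus_minus_tsum_le[OF I(1), of l "c x" "trunc t"] by (simp add: riesz_def csum_def sqsum_def)
      also have "\<dots> \<le> 2 powr (1 - real t powr gam) * exp (2 * sqrt (b * ln (real t)) * real t powr (gam/2) + 2 * (b * ln (real t)))"
      proof (intro mult_mono)
        have "(1/2::real) ^ trunc t = 2 powr (- real (trunc t))" by (simp add: powr_minus powr_realpow power_one_over inverse_eq_divide)
        also have "\<dots> \<le> 2 powr (1 - real t powr gam)" using trunc_ge[of t] by (intro powr_mono) auto
        finally show "(1/2::real) ^ trunc t \<le> 2 powr (1 - real t powr gam)" .
        have "\<bar>l\<bar> * \<bar>csum I x\<bar> \<le> \<bar>l\<bar> * (real t powr (gam / 2) * sqrt M)" using xS by (intro mult_left_mono) auto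
        also have "\<dots> = (\<bar>l\<bar> * sqrt M) * real t powr (gam / 2)" by simp
        also have "\<dots> \<le> sqrt (b * ln (real t)) * real t powr (gam / 2)" using lM by (intro mult_right_mono) auto
        finally have 1: "\<bar>l\<bar> * \<bar>csum I x\<bar> \<le> sqrt (b * ln (real t)) * real t powr (gam / 2)" .
        have "l\<^sup>2 * sqsum I x \<le> l\<^sup>2 * M" using sqsum_le_card[of I x] by (intro mult_left_mono) (auto simp: M_def)
        then have 2: "l\<^sup>2 * sqsum I x \<le> b * ln (real t)" using I by linarith
        show "exp (2 * \<bar>l\<bar> * \<bar>csum I x\<bar> + 2 * \<bar>l\<bar>\<^sup>2 * sqsum I x) \<le> exp (2 * sqrt (b * ln (real t)) * real t powr (gam/2) + 2 * (b * ln (real t)))"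
          using 1 2 by simp
      qed auto
      also have "\<dots> \<le> \<eta>" using elim(2) by simp
      finally show "riesz I l x > 0 \<and> \<bar>ln (riesz I l x) - (l * csum I x - l\<^sup>2 * card I / 4)\<bar> \<le> \<eta> \<and> \<bar>riesz I l x - tsum (c x) I (trunc t) l\<bar> \<le> \<eta>"
        using A pos by (simp add: M_def)
    qed
  qed
qed

text \<open>Chebyshev's inequality. For the sum, a moment of sufficiently high order beats any
  prescribed power of \<open>t\<close>; for the squares, the second moment already gives
  \<open>(card I) powr (-1/2)\<close>, exponentially small in \<open>t\<close>.\<close>

lemma eventually_bad_small:
  assumes s: "s > 0"
  shows "eventually (\<lambda>t. \<forall>I. finite I \<and> I \<subseteq> {1..} \<and> 2 ^ t \<le> real (card I) \<longrightarrow>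
     (\<E> x. indicator (- good t I) x) \<le> real t powr (- s)) sequentially"
proof -
  \<comment> \<open>The exponent \<open>s + 1\<close> instead of \<open>s\<close> leaves a factor
    \<open>1 / t\<close> that absorbs the moment constant.\<close>
  define q where "q = nat \<lceil>(s + 1) / gam\<rceil>"
  have q: "gam * real q \<ge> s + 1"
  proof -
    have "(s + 1) / gam \<le> real q" unfolding q_def by linarith
    then show ?thesis using gam_pos by (simp add: divide_le_eq mult.commute)
  qed
  have "(\<lambda>t::nat. (moment_bound q * real t powr (-(s+1)) + moment_bound 1 * 2 powr (-real t / 2)) * real t powr s) \<longlonglongrightarrow> 0"
  proof -
    \<comment> \<open>In this limit \<open>A\<close> and \<open>tilt_event\<close> are arbitrary
      real variables taking the place of the two moment constants; the latter has no connection with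
      the event of that name.\<close>
    have "(\<lambda>t::nat. (A * real t powr (-(s+1)) + tilt_event * 2 powr (-real t / 2)) * real t powr s) \<longlonglongrightarrow> 0" for A tilt_event :: real
      using s by real_asymp
    then show ?thesis .
  qed
  then have "eventually (\<lambda>t::nat. (moment_bound q * real t powr (-(s+1)) + moment_bound 1 * 2 powr (-real t / 2)) * real t powr s < 1) sequentially"
    by (intro order_tendstoD(2)) auto
  then show ?thesis
    using eventually_ge_at_top[of 1]
  proof eventually_elim
    case (elim t)
    show ?case
    proof (intro allI impI, elim conjE)
      fix I :: "nat set" assume I: "finite I" "I \<subseteq> {1..}" "2 ^ t \<le> real (card I)"
      define M where "M = real (card I)"
      have M: "M > 0" "2 ^ t \<le> M" using I(3) by (auto simp: M_def intro: less_le_trans[of 0 "2 ^ t"])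
      define h where "h = real t powr (gam / 2) * sqrt M"
      define d where "d = M powr (3/4)"
      have hd: "h > 0" "d > 0" using M elim by (auto simp: h_def d_def)
      have "(\<E> x. indicator (- good t I) x) \<le>
        (\<E> x. (csum I x) ^ (2 * q) / h ^ (2 * q) + (sqsum I x - M / 2) ^ (2 * 1) / d ^ (2 * 1))"
      proof (intro integral_mono integrable_indicator_unit_interval integrable_continuous_unit_interval continuous_intros)
        fix x
        have *: "1 \<le> y ^ (2 * r) / e ^ (2 * r)" if "\<bar>y\<bar> > e" "e > 0" for y e :: real and r
        proof -
          have "1 \<le> (\<bar>y\<bar> / e) ^ (2 * r)" using that by (intro one_le_power) auto
          then show ?thesis by (simp add: power_divide power_even_abs)
        qed
        have nn: "0 \<le> (csum I x) ^ (2 * q) / h ^ (2 * q)" "0 \<le> (sqsum I x - M / 2) ^ (2 * 1) / d ^ (2 * 1)"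
          by (auto simp: power_mult)
        show "indicator (- good t I) x \<le> (csum I x) ^ (2 * q) / h ^ (2 * q) + (sqsum I x - M / 2) ^ (2 * 1) / d ^ (2 * 1)"
        proof (cases "x \<in> good t I")
          case True
          then show ?thesis using nn by simp
        next
          case False
          then have "\<bar>csum I x\<bar> > h \<or> \<bar>sqsum I x - M / 2\<bar> > d" by (auto simp: good_def h_def d_def M_def)
          then have "1 \<le> (csum I x) ^ (2 * q) / h ^ (2 * q) \<or> 1 \<le> (sqsum I x - M / 2) ^ (2 * 1) / d ^ (2 * 1)"
            using *[OF _ hd(1), of "csum I x" q] *[OF _ hd(2), of "sqsum I x - M / 2" 1] by blast
          then have "1 \<le> (csum I x) ^ (2 * q) / h ^ (2 * q) + (sqsum I x - M / 2) ^ (2 * 1) / d ^ (2 * 1)"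
            using nn by linarith
          then show ?thesis using False by simp
        qed
      qed (use hd in auto)
      also have "\<dots> = (\<E> x. (csum I x) ^ (2 * q)) / h ^ (2 * q) + (\<E> x. (sqsum I x - M / 2) ^ (2 * 1)) / d ^ (2 * 1)"
        by (subst Bochner_Integration.integral_add)
          (use hd in \<open>auto intro!: integrable_continuous_unit_interval continuous_intros\<close>)
      also have "\<dots> \<le> (moment_bound q * M ^ q) / h ^ (2 * q) + (moment_bound 1 * M ^ 1) / d ^ (2 * 1)"
        using integral_sum_power_le[OF I(1,2), of q] integral_sum_squares_power_le[OF I(1,2), of 1] hd
        by (intro add_mono divide_right_mono) (auto simp: csum_def sqsum_def M_def)
      also have "(moment_bound q * M ^ q) / h ^ (2 * q) = moment_bound q * real t powr (- (gam * q))"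
      proof -
        have "(real t powr (gam / 2)) ^ (2 * q) = real t powr (gam * q)"
          using elim by (simp add: powr_realpow [symmetric] powr_powr)
        then have "h ^ (2 * q) = real t powr (gam * q) * M ^ q"
          using M by (simp add: h_def power_mult_distrib power_mult)
        then show ?thesis using M by (simp add: powr_minus field_simps)
      qed
      also have "(moment_bound 1 * M ^ 1) / d ^ (2 * 1) = moment_bound 1 * M powr (- 1/2)"
      proof -
        have "d ^ (2 * 1) = M powr (3/2)" using M by (simp add: d_def powr_realpow [symmetric] powr_powr)
        moreover have "M / M powr (3/2) = M powr (-1/2)" using M powr_diff[of M 1 "3/2"] by simp
        ultimately show ?thesis by (simp add: times_divide_eq_right [symmetric] del: times_divide_eq_right)
      qed
      also have "moment_bound q * real t powr (- (gam * q)) + moment_bound 1 * M powr (- 1/2) \<le> moment_bound q * real t powr (-(s+1)) + moment_bound 1 * 2 powr (- real t / 2)"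
      proof (intro add_mono mult_left_mono moment_bound_nonneg)
        show "real t powr (- (gam * q)) \<le> real t powr (-(s+1))" using q elim by (intro powr_mono) auto
        have "M powr (- 1/2) \<le> (2 ^ t) powr (- 1/2)" using M by (intro powr_mono2') auto
        also have "\<dots> = 2 powr (- real t / 2)" by (simp add: powr_realpow [symmetric] powr_powr)
        finally show "M powr (- 1/2) \<le> 2 powr (- real t / 2)" .
      qed
      also have "\<dots> \<le> real t powr (- s)"
        using elim by (simp add: powr_minus field_simps)
      finally show "(\<E> x. indicator (- good t I) x) \<le> real t powr (- s)" .
    qed
  qed
qed

text \<open>Write \<open>exp (l * csum I x)\<close> as the square of the exponential at
  \<open>\<mu> = l / 2\<close>. On the good set that is comparable to
  \<open>exp (\<mu>\<^sup>2 * M / 4)\<close> times the truncated product, whose square is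
  nonnegative everywhere and has mean about \<open>exp (\<mu>\<^sup>2 * M / 2)\<close>. Altogether
  \<open>exp (\<mu>\<^sup>2 * M)\<close> appears, the sharp Gaussian exponent; only the constant 8
  is crude.\<close>

lemma eventually_exp_moment_le:
  assumes b: "b > 0"
  shows "eventually (\<lambda>t. \<forall>I l. regime b t I l \<longrightarrow>
     (\<E> x. indicator (good t I) x * exp (l * csum I x)) \<le> 8 * exp (l\<^sup>2 * card I / 4)) sequentially"
  using eventually_good_approx[OF b, of "1/4", simplified] eventually_rel_series_small[OF b, of "1/4", simplified]
proof eventually_elim
  case (elim t)
  interpret prob_space unit_interval_measure by (rule prob_space_unit_interval)
  show ?case
  proof (intro allI impI)
    fix I l assume reg: "regime b t I l"
    define \<mu> where "\<mu> = l / 2"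
    define M where "M = real (card I)"
    let ?T = "\<lambda>x. tsum (c x) I (trunc t) \<mu>"
    have I: "finite I" "I \<subseteq> {1..}" using reg by (auto simp: regime_def)
    have reg2: "regime b t I \<mu>"
    proof -
      have "\<mu>\<^sup>2 * card I \<le> l\<^sup>2 * card I" by (intro mult_right_mono) (auto simp: \<mu>_def power_divide)
      then show ?thesis using reg by (auto simp: regime_def)
    qed
    have small: "\<bar>\<mu>\<bar> \<le> 1/2" "rel_series (4 * trunc t) \<bar>\<mu>\<bar> \<le> 1/4"
      using elim(2)[rule_format, of "\<bar>\<mu>\<bar>"] regime_square_le[OF reg2] by auto
    have "(\<E> x. indicator (good t I) x * exp (l * csum I x)) \<le>
      (\<E> x. exp (\<mu>\<^sup>2 * M / 2 + 1/2) * (2 * (?T x)\<^sup>2 + 1/8))"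
    proof (intro integral_mono integrable_indicator_continuous integrable_continuous_unit_interval continuous_intros)
      fix x
      show "indicator (good t I) x * exp (l * csum I x) \<le> exp (\<mu>\<^sup>2 * M / 2 + 1/2) * (2 * (?T x)\<^sup>2 + 1/8)"
      proof (cases "x \<in> good t I")
        case True
        then have p: "riesz I \<mu> x > 0" "\<bar>ln (riesz I \<mu> x) - (\<mu> * csum I x - \<mu>\<^sup>2 * M / 4)\<bar> \<le> 1/4" "\<bar>riesz I \<mu> x - ?T x\<bar> \<le> 1/4"
          using elim(1) reg2 by (auto simp: M_def)
        have "exp (l * csum I x) = (exp (\<mu> * csum I x))\<^sup>2" by (simp add: \<mu>_def exp_double [symmetric])
        also have "\<dots> \<le> (exp (ln (riesz I \<mu> x) + \<mu>\<^sup>2 * M / 4 + 1/4))\<^sup>2"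
        proof (intro power_mono)
          have "\<mu> * csum I x \<le> ln (riesz I \<mu> x) + \<mu>\<^sup>2 * M / 4 + 1/4" using p(2) by linarith
          then show "exp (\<mu> * csum I x) \<le> exp (ln (riesz I \<mu> x) + \<mu>\<^sup>2 * M / 4 + 1/4)" by simp
        qed simp
        also have "\<dots> = exp (\<mu>\<^sup>2 * M / 2 + 1/2) * (riesz I \<mu> x)\<^sup>2"
          using p by (simp add: exp_add power_mult_distrib exp_double [symmetric])
        also have "(riesz I \<mu> x)\<^sup>2 \<le> 2 * (?T x)\<^sup>2 + 1/8"
        proof -
          have "(riesz I \<mu> x)\<^sup>2 \<le> 2 * (?T x)\<^sup>2 + 2 * (riesz I \<mu> x - ?T x)\<^sup>2"
            using zero_le_power2[of "riesz I \<mu> x - 2 * ?T x"] by (simp add: power2_eq_square algebra_simps)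
          moreover have "(riesz I \<mu> x - ?T x)\<^sup>2 \<le> (1/4)\<^sup>2" using p(3) by (metis abs_ge_zero power2_abs power_mono)
          ultimately show ?thesis by (simp add: power2_eq_square)
        qed
        finally show ?thesis using True by simp
      next
        case False
        then show ?thesis by (simp add: add_nonneg_nonneg)
      qed
    qed simp
    also have "\<dots> = exp (\<mu>\<^sup>2 * M / 2 + 1/2) * (2 * (\<E> x. (?T x)\<^sup>2) + 1/8)"
    proof -
      have "integrable unit_interval_measure (\<lambda>x. (?T x)\<^sup>2)"
        by (intro integrable_continuous_unit_interval continuous_intros)
      then show ?thesis using prob_space by simp
    qed
    also have "\<dots> \<le> exp (\<mu>\<^sup>2 * M / 2 + 1/2) * (2 * (exp (\<mu>\<^sup>2 * M / 2) * (5/4)) + 1/8 * exp (\<mu>\<^sup>2 * M / 2))"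
    proof (intro mult_left_mono add_mono)
      have "(\<E> x. (?T x)\<^sup>2) \<le> exp (card I * \<mu>\<^sup>2 / 2) * (1 + rel_series (2 * trunc t) \<bar>\<mu>\<bar>)"
        using small by (intro integral_tsum_square_le I) auto
      also have "rel_series (2 * trunc t) \<bar>\<mu>\<bar> \<le> rel_series (4 * trunc t) \<bar>\<mu>\<bar>" by (intro rel_series_mono) auto
      also have "exp (card I * \<mu>\<^sup>2 / 2) * (1 + rel_series (4 * trunc t) \<bar>\<mu>\<bar>) \<le> exp (card I * \<mu>\<^sup>2 / 2) * (5/4)"
        using small by (intro mult_left_mono) auto
      finally show "(\<E> x. (?T x)\<^sup>2) \<le> exp (\<mu>\<^sup>2 * M / 2) * (5/4)"
        by (simp add: M_def mult.commute)
      show "1/8 \<le> 1/8 * exp (\<mu>\<^sup>2 * M / 2)" by (simp add: M_def)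
    qed auto
    also have "\<dots> = exp (1/2) * (21/8) * exp (\<mu>\<^sup>2 * M)"
    proof -
      have "exp (\<mu>\<^sup>2 * M) = exp (\<mu>\<^sup>2 * M / 2) * exp (\<mu>\<^sup>2 * M / 2)" by (simp add: exp_add [symmetric])
      then show ?thesis by (simp add: exp_add algebra_simps)
    qed
    also have "\<dots> \<le> 8 * exp (\<mu>\<^sup>2 * M)"
    proof -
      have "exp (1/2::real) \<le> 2" using exp_bound_half[of "1/2::real"] by simp
      then show ?thesis by (intro mult_right_mono) auto
    qed
    also have "\<mu>\<^sup>2 * M = l\<^sup>2 * card I / 4" by (simp add: \<mu>_def M_def power_divide)
    finally show "(\<E> x. indicator (good t I) x * exp (l * csum I x)) \<le> 8 * exp (l\<^sup>2 * card I / 4)" .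
  qed
qed

end

section \<open>Second moment method for tilted blocks\<close>

text \<open>Second moment method; the pointwise inequality behind it is
  \<open>2 z - z\<^sup>2 \<le> 1\<close> for the average \<open>z\<close> of the \<open>V j\<close>.\<close>

lemma second_moment_union:
  fixes V :: "'i \<Rightarrow> real \<Rightarrow> real"
  assumes F: "finite F" "F \<noteq> {}"
    and int: "\<And>j. j \<in> F \<Longrightarrow> integrable unit_interval_measure (V j)"
    and int2: "\<And>i j. i \<in> F \<Longrightarrow> j \<in> F \<Longrightarrow> integrable unit_interval_measure (\<lambda>x. V i x * V j x)"
    and V0: "\<And>j x. j \<in> F \<Longrightarrow> V j x \<ge> 0" and VR: "\<And>j x. j \<in> F \<Longrightarrow> V j x \<le> R"
    and E1: "\<And>j. j \<in> F \<Longrightarrow> (\<E> x. V j x) \<ge> 1 - \<eta>"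
    and E8: "\<And>j. j \<in> F \<Longrightarrow> (\<E> x. V j x) \<le> 8"
    and E2: "\<And>i j. i \<in> F \<Longrightarrow> j \<in> F \<Longrightarrow> i \<noteq> j \<Longrightarrow> (\<E> x. V i x * V j x) \<le> 1 + \<eta>"
    and A: "\<And>j x. j \<in> F \<Longrightarrow> V j x \<noteq> 0 \<Longrightarrow> x \<in> A j" and Ab: "\<And>j. j \<in> F \<Longrightarrow> A j \<in> sets borel"
    and "\<eta> \<ge> 0"
  shows "(\<E> x. indicator (\<Union>j\<in>F. A j) x) \<ge> 1 - 3 * \<eta> - 8 * R / card F"
proof -
  define n where "n = real (card F)"
  have n: "n \<ge> 1" using F by (simp add: n_def Suc_le_eq card_gt_0_iff)
  have R: "R \<ge> 0" using F V0 VR by (meson all_not_in_conv order_trans)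
  define Z where "Z = (\<lambda>x. \<Sum>j\<in>F. V j x)"
  have Z2: "(Z x)\<^sup>2 = (\<Sum>i\<in>F. \<Sum>j\<in>F. V i x * V j x)" for x
    by (simp add: Z_def power2_eq_square sum_product)
  have intZ: "integrable unit_interval_measure Z" "integrable unit_interval_measure (\<lambda>x. (Z x)\<^sup>2)"
  proof -
    show "integrable unit_interval_measure Z" unfolding Z_def using int by auto
    show "integrable unit_interval_measure (\<lambda>x. (Z x)\<^sup>2)" unfolding Z2 using int2 by auto
  qed
  have EZ: "(\<E> x. Z x) \<ge> n * (1 - \<eta>)"
  proof -
    have "(\<E> x. Z x) = (\<Sum>j\<in>F. \<E> x. V j x)"
      unfolding Z_def using int by (intro Bochner_Integration.integral_sum)
    also have "\<dots> \<ge> (\<Sum>j\<in>F. 1 - \<eta>)" by (intro sum_mono E1)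
    finally show ?thesis by (simp add: n_def)
  qed
  have EZ2: "(\<E> x. (Z x)\<^sup>2) \<le> n\<^sup>2 * (1 + \<eta>) + 8 * R * n"
  proof -
    have "(\<E> x. (Z x)\<^sup>2) = (\<Sum>i\<in>F. \<Sum>j\<in>F. \<E> x. V i x * V j x)"
      unfolding Z2 using int2 by (simp add: Bochner_Integration.integral_sum)
    \<comment> \<open>On the diagonal only the supremum \<open>R\<close> times the mean is
      available; this is harmless as long as \<open>R\<close> is small compared with the number of
      blocks.\<close>
    also have "\<dots> \<le> (\<Sum>i\<in>F. \<Sum>j\<in>F. (1 + \<eta>) + (if i = j then 8 * R else 0))"
    proof (intro sum_mono)
      fix i j assume ij: "i \<in> F" "j \<in> F"
      show "(\<E> x. V i x * V j x) \<le> (1 + \<eta>) + (if i = j then 8 * R else 0)"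
      proof (cases "i = j")
        case True
        have "(\<E> x. V i x * V j x) \<le> (\<E> x. R * V i x)"
          using ij V0 VR True by (intro integral_mono int2 integrable_mult_right int) (auto intro: mult_right_mono)
        also have "\<dots> \<le> R * 8" using E8[OF ij(1)] R by (simp add: mult_left_mono)
        finally show ?thesis using True \<open>\<eta> \<ge> 0\<close> by simp
      qed (use E2 ij in auto)
    qed
    also have "\<dots> = n\<^sup>2 * (1 + \<eta>) + 8 * R * n"
      using F by (simp add: sum.distrib n_def power2_eq_square algebra_simps)
    finally show ?thesis .
  qed
  have "1 - 3 * \<eta> - 8 * R / n \<le> 2 / n * (n * (1 - \<eta>)) - 1 / n\<^sup>2 * (n\<^sup>2 * (1 + \<eta>) + 8 * R * n)"
    using n by (simp add: field_simps power2_eq_square)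
  also have "\<dots> \<le> 2 / n * (\<E> x. Z x) - 1 / n\<^sup>2 * (\<E> x. (Z x)\<^sup>2)"
    using EZ EZ2 n by (intro diff_mono mult_left_mono) auto
  also have "\<dots> = (\<E> x. 2 / n * Z x - 1 / n\<^sup>2 * (Z x)\<^sup>2)"
    using intZ by simp
  also have "\<dots> \<le> (\<E> x. indicator (\<Union>j\<in>F. A j) x)"
  proof (intro integral_mono integrable_indicator_unit_interval Bochner_Integration.integrable_diff integrable_mult_right intZ)
    show "(\<Union>j\<in>F. A j) \<in> sets borel" using F Ab by auto
    fix x
    show "2 / n * Z x - 1 / n\<^sup>2 * (Z x)\<^sup>2 \<le> indicator (\<Union>j\<in>F. A j) x"
    proof (cases "x \<in> (\<Union>j\<in>F. A j)")
      case True
      have "(Z x / n - 1)\<^sup>2 = 1 - (2 / n * Z x - 1 / n\<^sup>2 * (Z x)\<^sup>2)"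
        using n by (simp add: power2_eq_square field_simps)
      then show ?thesis using True zero_le_power2[of "Z x / n - 1"] by simp
    next
      case False
      then have "V j x = 0" if "j \<in> F" for j using A that by blast
      then have "Z x = 0" by (simp add: Z_def)
      then show ?thesis using False by simp
    qed
  qed
  finally show ?thesis by (simp add: n_def)
qed

context lil_system
begin

text \<open>Tilting by \<open>exp (l * csum I x)\<close> shifts the typical value of a sum with
  variance \<open>card I / 2\<close> from 0 to \<open>l * card I / 2\<close>, the centre of this
  window. The lower edge makes the sum large, the upper edge keeps the density bounded.\<close>

definition tilt_event :: "nat \<Rightarrow> nat set \<Rightarrow> real \<Rightarrow> real \<Rightarrow> real set" where
  "tilt_event t I \<delta> l = good t I \<inter> {x. (1 - \<delta>) * l * card I / 2 \<le> csum I x \<and> csum I x \<le> (1 + \<delta>) * l * card I / 2}"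

text \<open>Gaussian normalisation: \<open>l\<^sup>2 * card I / 4\<close> is half of
  \<open>l\<^sup>2\<close> times the variance, so the mean should be close to 1.\<close>

definition tilt :: "nat \<Rightarrow> nat set \<Rightarrow> real \<Rightarrow> real \<Rightarrow> real \<Rightarrow> real" where
  "tilt t I \<delta> l x = indicator (tilt_event t I \<delta> l) x * exp (l * csum I x - l\<^sup>2 * card I / 4)"

lemma tilt_event_borel [measurable, simp]: "tilt_event t I \<delta> l \<in> sets borel"
proof -
  have [measurable]: "csum I \<in> borel_measurable borel"
    by (auto intro!: borel_measurable_continuous_onI continuous_intros)
  show ?thesis unfolding tilt_event_def by measurable
qed

lemma tilt_nonneg: "tilt t I \<delta> l x \<ge> 0"
  by (simp add: tilt_def)

lemma integrable_tilt: "integrable unit_interval_measure (tilt t I \<delta> l)"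
  unfolding tilt_def by (intro integrable_indicator_continuous continuous_intros) auto

lemma integrable_tilt_mult: "integrable unit_interval_measure (\<lambda>x. tilt t I \<delta> l x * tilt t J \<delta> k x)"
proof -
  have "tilt t I \<delta> l x * tilt t J \<delta> k x = indicator (tilt_event t I \<delta> l \<inter> tilt_event t J \<delta> k) x *
      (exp (l * csum I x - l\<^sup>2 * card I / 4) * exp (k * csum J x - k\<^sup>2 * card J / 4))" for x
    by (simp add: tilt_def indicator_inter_arith)
  then show ?thesis by (simp only:) (intro integrable_indicator_continuous continuous_intros, auto)
qed

text \<open>The upper edge of the window turns the exponential density into a bounded function. This
  supplies the supremum in the second moment argument.\<close>

lemma tilt_le: "0 \<le> l \<Longrightarrow> tilt t I \<delta> l x \<le> exp (l\<^sup>2 * card I * (1 + 2 * \<delta>) / 4)"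
proof (cases "x \<in> tilt_event t I \<delta> l")
  case True
  assume l: "0 \<le> l"
  have "l * csum I x \<le> l * ((1 + \<delta>) * l * card I / 2)" using True l by (intro mult_left_mono) (auto simp: tilt_event_def)
  also have "\<dots> - l\<^sup>2 * card I / 4 = l\<^sup>2 * card I * (1 + 2 * \<delta>) / 4" by (simp add: power2_eq_square field_simps)
  finally have "l * csum I x - l\<^sup>2 * card I / 4 \<le> l\<^sup>2 * card I * (1 + 2 * \<delta>) / 4" by simp
  then show ?thesis using True by (simp add: tilt_def)
qed (simp add: tilt_def)

text \<open>The truncated product \<open>?T\<close> has mean close to 1, and on the good set it is
  close to the density. What must be excluded is a large positive contribution of \<open>?T\<close>
  off the good set; there \<open>?T \<le> \<delta> * ?T\<^sup>2 + 1 / \<delta>\<close>, which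
  combines its second moment with the small probability of the bad set.\<close>

lemma eventually_mass_ge:
  assumes b: "b > 0" and \<eta>: "0 < \<eta>" "\<eta> \<le> 1/4"
  shows "eventually (\<lambda>t. \<forall>I l. regime b t I l \<longrightarrow>
     (\<E> x. indicator (good t I) x * exp (l * csum I x - l\<^sup>2 * card I / 4)) \<ge> 1 - 5 * \<eta>) sequentially"
proof -
  have "(\<lambda>t::nat. 2 * real t powr (- b / 2) + real t powr (- b)) \<longlonglongrightarrow> 0" using b by real_asymp
  then have e1: "eventually (\<lambda>t::nat. 2 * real t powr (- b / 2) + real t powr (- b) < 2 * \<eta>) sequentially"
    using \<eta> by (intro order_tendstoD(2)) auto
  have "2 * b > 0" using b by simp
  note e2 = eventually_bad_small[OF this]
  show ?thesis
    using eventually_good_approx[OF b \<eta>(1)] eventually_rel_series_small[OF b \<eta>(1)] e1 e2 eventually_gt_at_top[of 1]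
  proof eventually_elim
    case (elim t)
    interpret prob_space unit_interval_measure by (rule prob_space_unit_interval)
    show ?case
    proof (intro allI impI)
      fix I l assume reg: "regime b t I l"
      define M where "M = real (card I)"
      let ?T = "\<lambda>x. tsum (c x) I (trunc t) l"
      let ?bad = "\<lambda>x. indicat_real (- good t I) x"
      have I: "finite I" "I \<subseteq> {1..}" "2 ^ t \<le> real (card I)" "l\<^sup>2 * M \<le> b * ln (real t)" using reg by (auto simp: regime_def M_def)
      \<comment> \<open>The second moment is at most \<open>2 * t powr (b / 2)\<close> and the bad
        set has probability at most \<open>t powr (- 2 * b)\<close>; with this
        \<open>\<delta>\<close> both \<open>\<delta>\<close> times the former and the latter divided
        by \<open>\<delta>\<close> tend to 0.\<close>
      define \<delta> where "\<delta> = real t powr (- b)"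
      have \<delta>: "\<delta> > 0" using elim(5) by (simp add: \<delta>_def)
      have small: "\<bar>l\<bar> \<le> 1/2" "rel_series (4 * trunc t) \<bar>l\<bar> \<le> \<eta>"
        using elim(2)[rule_format, of "\<bar>l\<bar>"] regime_square_le[OF reg] by auto
      have ET: "(\<E> x. ?T x) \<ge> 1 - \<eta>"
      proof -
        have "\<bar>(\<E> x. ?T x) - 1\<bar> \<le> rel_series (trunc t) \<bar>l\<bar>"
          by (rule abs_integral_tsum_minus_one_le[OF I(1,2)])
        also have "\<dots> \<le> rel_series (4 * trunc t) \<bar>l\<bar>" by (intro rel_series_mono) auto
        finally show ?thesis using small by linarith
      qed
      have ET2: "(\<E> x. (?T x)\<^sup>2) \<le> 2 * real t powr (b / 2)"
      proof -
        have "(\<E> x. (?T x)\<^sup>2) \<le> exp (card I * l\<^sup>2 / 2) * (1 + rel_series (2 * trunc t) \<bar>l\<bar>)"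
          using small by (intro integral_tsum_square_le I) auto
        also have "\<dots> \<le> exp (b / 2 * ln (real t)) * 2"
        proof (intro mult_mono)
          show "exp (card I * l\<^sup>2 / 2) \<le> exp (b / 2 * ln (real t))" using I(4) by (simp add: M_def mult.commute)
          have "rel_series (2 * trunc t) \<bar>l\<bar> \<le> rel_series (4 * trunc t) \<bar>l\<bar>" by (intro rel_series_mono) auto
          then show "1 + rel_series (2 * trunc t) \<bar>l\<bar> \<le> 2" using small \<eta> by linarith
        qed (auto intro!: add_nonneg_nonneg rel_series_nonneg)
        finally show ?thesis using elim(5) by (simp add: powr_def)
      qed
      have EB: "(\<E> x. ?bad x) \<le> real t powr (- (2 * b))"
        using elim(4) I by auto
      have iT: "integrable unit_interval_measure ?T" "integrable unit_interval_measure (\<lambda>x. (?T x)\<^sup>2)"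
        by (intro integrable_continuous_unit_interval continuous_intros)+
      have iB: "integrable unit_interval_measure ?bad"
        by (intro integrable_indicator_unit_interval) auto
      have "1 - 5 * \<eta> \<le> (1 - \<eta>) * (1 - 4 * \<eta>)" using \<eta> by (simp add: algebra_simps)
      also have "\<dots> \<le> exp (- \<eta>) * (1 - 4 * \<eta>)"
        using \<eta> exp_ge_add_one_self[of "- \<eta>"] by (intro mult_right_mono) auto
      also have "\<dots> \<le> exp (- \<eta>) * ((\<E> x. ?T x) - \<eta> - \<delta> * (\<E> x. (?T x)\<^sup>2) - (\<E> x. ?bad x) / \<delta>)"
      proof (intro mult_left_mono)
        have "\<delta> * (\<E> x. (?T x)\<^sup>2) \<le> \<delta> * (2 * real t powr (b / 2))"
          using ET2 \<delta> by (intro mult_left_mono) auto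
        also have "\<dots> = 2 * real t powr (- b / 2)"
          using elim(5) by (simp add: \<delta>_def powr_add [symmetric])
        finally have 1: "\<delta> * (\<E> x. (?T x)\<^sup>2) \<le> 2 * real t powr (- b / 2)" .
        have "(\<E> x. ?bad x) / \<delta> \<le> real t powr (- (2 * b)) / \<delta>"
          using EB \<delta> by (intro divide_right_mono) auto
        also have "\<dots> = real t powr (- b)" by (simp add: \<delta>_def powr_diff [symmetric])
        finally have 2: "(\<E> x. ?bad x) / \<delta> \<le> real t powr (- b)" .
        show "1 - 4 * \<eta> \<le> (\<E> x. ?T x) - \<eta> - \<delta> * (\<E> x. (?T x)\<^sup>2) - (\<E> x. ?bad x) / \<delta>"
          using 1 2 ET elim(3) by linarith
      qed simp
      also have "\<dots> = (\<E> x. exp (- \<eta>) * (?T x - \<eta> - \<delta> * (?T x)\<^sup>2 - ?bad x / \<delta>))"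
        using iT iB prob_space \<delta> by simp
      also have "\<dots> \<le> (\<E> x. indicator (good t I) x * exp (l * csum I x - l\<^sup>2 * M / 4))"
      proof (rule integral_mono)
        show "integrable unit_interval_measure (\<lambda>x. exp (- \<eta>) * (?T x - \<eta> - \<delta> * (?T x)\<^sup>2 - ?bad x / \<delta>))"
          using iT iB \<delta> by auto
        show "integrable unit_interval_measure (\<lambda>x. indicator (good t I) x * exp (l * csum I x - l\<^sup>2 * M / 4))"
          by (intro integrable_indicator_continuous continuous_intros) auto
        fix x
        show "exp (- \<eta>) * (?T x - \<eta> - \<delta> * (?T x)\<^sup>2 - ?bad x / \<delta>) \<le> indicator (good t I) x * exp (l * csum I x - l\<^sup>2 * M / 4)"
        proof (cases "x \<in> good t I")
          case True
          then have p: "riesz I l x > 0" "\<bar>ln (riesz I l x) - (l * csum I x - l\<^sup>2 * M / 4)\<bar> \<le> \<eta>" "\<bar>riesz I l x - ?T x\<bar> \<le> \<eta>"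
            using elim(1) reg by (auto simp: M_def)
          have "0 \<le> \<delta> * (?T x)\<^sup>2" using \<delta> by simp
          then have "?T x - \<eta> - \<delta> * (?T x)\<^sup>2 - ?bad x / \<delta> \<le> riesz I l x" using p True by simp
          then have "exp (- \<eta>) * (?T x - \<eta> - \<delta> * (?T x)\<^sup>2 - ?bad x / \<delta>) \<le> exp (- \<eta>) * riesz I l x"
            by (intro mult_left_mono) auto
          also have "\<dots> = exp (ln (riesz I l x) - \<eta>)" using p(1) by (simp add: exp_diff exp_minus field_simps)
          also have "\<dots> \<le> exp (l * csum I x - l\<^sup>2 * M / 4)" using p(2) unfolding exp_le_cancel_iff by linarith
          finally show ?thesis using True by simp
        next
          case False
          have "?T x \<le> \<delta> * (?T x)\<^sup>2 + 1 / \<delta>"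
          proof -
            have "0 \<le> (\<delta> * ?T x - 1/2)\<^sup>2 + 3/4" by simp
            also have "\<dots> = \<delta> * (\<delta> * (?T x)\<^sup>2 + 1 / \<delta> - ?T x)" using \<delta> by (simp add: power2_eq_square field_simps)
            finally show ?thesis using \<delta> by (simp add: zero_le_mult_iff)
          qed
          then have "?T x - \<eta> - \<delta> * (?T x)\<^sup>2 - ?bad x / \<delta> \<le> 0" using False \<eta> by simp
          then show ?thesis using False by (simp add: mult_nonneg_nonpos)
        qed
      qed
      finally show "1 - 5 * \<eta> \<le> (\<E> x. indicator (good t I) x * exp (l * csum I x - l\<^sup>2 * card I / 4))"
        by (simp add: M_def)
    qed
  qed
qed

text \<open>Chernoff's bound under the tilted weight: the parameter is changed from \<open>l\<close>
  to \<open>l * (1 + \<delta>)\<close> above the window and to \<open>l * (1 - \<delta>)\<close>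
  below it. The quadratic exponents leave a gain of
  \<open>\<delta>\<^sup>2 * l\<^sup>2 * card I / 4\<close> on either side, and the lower bound on
  \<open>l\<^sup>2 * card I\<close> makes it a power of \<open>t\<close>.\<close>

lemma eventually_tilted_tails_le:
  assumes b: "b > 0" and \<delta>: "0 < \<delta>" "\<delta> < 1"
  shows "eventually (\<lambda>t. \<forall>I l. regime b t I l \<and> 0 \<le> l \<and> b' * ln (real t) \<le> l\<^sup>2 * card I \<longrightarrow>
     (\<E> x. indicator (good t I - tilt_event t I \<delta> l) x * exp (l * csum I x - l\<^sup>2 * card I / 4))
       \<le> 16 * exp (- (\<delta>\<^sup>2 * b' / 4 * ln (real t)))) sequentially"
proof -
  \<comment> \<open>The changed parameter is at most \<open>2 * l\<close>, so its square may be four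
    times as large.\<close>
  have "4 * b > 0" using b by simp
  from eventually_exp_moment_le[OF this] show ?thesis
    using eventually_ge_at_top[of 1]
  proof eventually_elim
    case (elim t)
    show ?case
    proof (intro allI impI, elim conjE)
      fix I l assume reg: "regime b t I l" and l: "0 \<le> l" and large: "b' * ln (real t) \<le> l\<^sup>2 * card I"
      define M where "M = real (card I)"
      have moment_bound: "(\<E> x. indicator (good t I) x * exp (l * s * csum I x)) \<le> 8 * exp ((l * s)\<^sup>2 * M / 4)"
        if s: "0 \<le> s" "s \<le> 2" for s
      proof -
        have s4: "s\<^sup>2 \<le> 2\<^sup>2" using s by (intro power_mono) auto
        have "(l * s)\<^sup>2 * M = s\<^sup>2 * (l\<^sup>2 * M)" by (simp add: power_mult_distrib)
        also have "\<dots> \<le> 4 * (l\<^sup>2 * M)" using s4 by (intro mult_right_mono) (auto simp: M_def)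
        also have "\<dots> \<le> 4 * b * ln (real t)" using reg by (simp add: regime_def M_def)
        finally have "regime (4 * b) t I (l * s)" using reg by (simp add: regime_def M_def)
        then show ?thesis using elim(1) by (simp add: M_def)
      qed
      define a1 where "a1 = exp (- (\<delta> * (1 + \<delta>) * l\<^sup>2 * M / 2) - l\<^sup>2 * M / 4)"
      define a2 where "a2 = exp (\<delta> * (1 - \<delta>) * l\<^sup>2 * M / 2 - l\<^sup>2 * M / 4)"
      let ?f = "\<lambda>s x. indicat_real (good t I) x * exp (l * s * csum I x)"
      have intf: "integrable unit_interval_measure (?f s)" for s
        by (intro integrable_indicator_continuous continuous_intros) auto
      have "(\<E> x. indicator (good t I - tilt_event t I \<delta> l) x * exp (l * csum I x - l\<^sup>2 * M / 4))
        \<le> (\<E> x. a1 * ?f (1 + \<delta>) x + a2 * ?f (1 - \<delta>) x)"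
      proof (rule integral_mono)
        show "integrable unit_interval_measure (\<lambda>x. indicator (good t I - tilt_event t I \<delta> l) x * exp (l * csum I x - l\<^sup>2 * M / 4))"
          by (intro integrable_indicator_continuous continuous_intros) auto
        show "integrable unit_interval_measure (\<lambda>x. a1 * ?f (1 + \<delta>) x + a2 * ?f (1 - \<delta>) x)"
          using intf by auto
        fix x
        have nn: "0 \<le> a1 * ?f (1 + \<delta>) x" "0 \<le> a2 * ?f (1 - \<delta>) x" by (auto simp: a1_def a2_def)
        show "indicator (good t I - tilt_event t I \<delta> l) x * exp (l * csum I x - l\<^sup>2 * M / 4) \<le> a1 * ?f (1 + \<delta>) x + a2 * ?f (1 - \<delta>) x"
        proof (cases "x \<in> good t I - tilt_event t I \<delta> l")
          case False
          then show ?thesis using nn by simp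
        next
          case True
          then consider "csum I x > (1 + \<delta>) * l * M / 2" | "csum I x < (1 - \<delta>) * l * M / 2"
            by (auto simp: tilt_event_def M_def not_le)
          then show ?thesis
          proof cases
            case 1
            have "0 \<le> l * \<delta> * (csum I x - (1 + \<delta>) * l * M / 2)" using 1 l \<delta> by (intro mult_nonneg_nonneg) auto
            then have "l * csum I x - l\<^sup>2 * M / 4 \<le> (- (\<delta> * (1 + \<delta>) * l\<^sup>2 * M / 2) - l\<^sup>2 * M / 4) + l * (1 + \<delta>) * csum I x"
              by (simp add: power2_eq_square algebra_simps)
            then have "exp (l * csum I x - l\<^sup>2 * M / 4) \<le> a1 * exp (l * (1 + \<delta>) * csum I x)"
              unfolding a1_def exp_add [symmetric] by simp
            then show ?thesis using True nn by simp
          next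
            case 2
            have "0 \<le> l * \<delta> * ((1 - \<delta>) * l * M / 2 - csum I x)" using 2 l \<delta> by (intro mult_nonneg_nonneg) auto
            then have "l * csum I x - l\<^sup>2 * M / 4 \<le> (\<delta> * (1 - \<delta>) * l\<^sup>2 * M / 2 - l\<^sup>2 * M / 4) + l * (1 - \<delta>) * csum I x"
              by (simp add: power2_eq_square algebra_simps)
            then have "exp (l * csum I x - l\<^sup>2 * M / 4) \<le> a2 * exp (l * (1 - \<delta>) * csum I x)"
              unfolding a2_def exp_add [symmetric] by simp
            then show ?thesis using True nn by simp
          qed
        qed
      qed
      also have "\<dots> = a1 * (\<E> x. ?f (1 + \<delta>) x) + a2 * (\<E> x. ?f (1 - \<delta>) x)"
        using intf by simp
      also have "\<dots> \<le> a1 * (8 * exp ((l * (1 + \<delta>))\<^sup>2 * M / 4)) + a2 * (8 * exp ((l * (1 - \<delta>))\<^sup>2 * M / 4))"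
        using \<delta> by (intro add_mono mult_left_mono moment_bound) (auto simp: a1_def a2_def)
      also have "a1 * (8 * exp ((l * (1 + \<delta>))\<^sup>2 * M / 4)) = 8 * exp (- (\<delta>\<^sup>2 * (l\<^sup>2 * M) / 4))"
        unfolding a1_def by (simp add: exp_add [symmetric]) (simp add: power2_eq_square field_simps)
      also have "a2 * (8 * exp ((l * (1 - \<delta>))\<^sup>2 * M / 4)) = 8 * exp (- (\<delta>\<^sup>2 * (l\<^sup>2 * M) / 4))"
        unfolding a2_def by (simp add: exp_add [symmetric]) (simp add: power2_eq_square field_simps)
      also have "8 * exp (- (\<delta>\<^sup>2 * (l\<^sup>2 * M) / 4)) + 8 * exp (- (\<delta>\<^sup>2 * (l\<^sup>2 * M) / 4)) = 16 * exp (- (\<delta>\<^sup>2 / 4 * (l\<^sup>2 * M)))"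
        by simp
      also have "\<dots> \<le> 16 * exp (- (\<delta>\<^sup>2 / 4 * (b' * ln (real t))))"
      proof -
        have "\<delta>\<^sup>2 / 4 * (b' * ln (real t)) \<le> \<delta>\<^sup>2 / 4 * (l\<^sup>2 * M)" using large by (intro mult_left_mono) (auto simp: M_def)
        then show ?thesis by simp
      qed
      finally show "(\<E> x. indicator (good t I - tilt_event t I \<delta> l) x * exp (l * csum I x - l\<^sup>2 * card I / 4))
         \<le> 16 * exp (- (\<delta>\<^sup>2 * b' / 4 * ln (real t)))"
        by (simp add: M_def mult.assoc)
    qed
  qed
qed

lemma eventually_integral_tilt_ge:
  assumes b: "b > 0" "b' > 0" and \<delta>: "0 < \<delta>" "\<delta> < 1" and \<eta>: "\<eta> > 0"
  shows "eventually (\<lambda>t. \<forall>I l. regime b t I l \<and> 0 \<le> l \<and> b' * ln (real t) \<le> l\<^sup>2 * card I \<longrightarrow>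
     (\<E> x. tilt t I \<delta> l x) \<ge> 1 - \<eta>) sequentially"
proof -
  define \<eta>' where "\<eta>' = min (1/4) (\<eta> / 10)"
  have \<eta>': "0 < \<eta>'" "\<eta>' \<le> 1/4" "5 * \<eta>' \<le> \<eta> / 2" using \<eta> by (auto simp: \<eta>'_def)
  have b2: "\<delta>\<^sup>2 * b' / 4 > 0" using b \<delta> by simp
  have "(\<lambda>t::nat. 16 * exp (- (\<delta>\<^sup>2 * b' / 4 * ln (real t)))) \<longlonglongrightarrow> 0"
  proof -
    have "(\<lambda>t::nat. 16 * exp (- (a * ln (real t)))) \<longlonglongrightarrow> 0" if "a > 0" for a :: real using that by real_asymp
    then show ?thesis using b2 .
  qed
  from order_tendstoD(2)[OF this, of "\<eta> / 2"]
  have e: "eventually (\<lambda>t::nat. 16 * exp (- (\<delta>\<^sup>2 * b' / 4 * ln (real t))) < \<eta> / 2) sequentially"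
    using \<eta> by simp
  show ?thesis
    using e eventually_mass_ge[OF b(1) \<eta>'(1,2)] eventually_tilted_tails_le[OF b(1) \<delta>, of b']
  proof eventually_elim
    case (elim t)
    show ?case
    proof (intro allI impI)
      fix I l assume r: "regime b t I l \<and> 0 \<le> l \<and> b' * ln (real t) \<le> l\<^sup>2 * card I"
      let ?e = "\<lambda>x. exp (l * csum I x - l\<^sup>2 * card I / 4)"
      have i: "integrable unit_interval_measure (\<lambda>x. indicator A x * ?e x)" if "A \<in> sets borel" for A
        using that by (intro integrable_indicator_continuous continuous_intros)
      have "tilt t I \<delta> l x = indicator (good t I) x * ?e x - indicator (good t I - tilt_event t I \<delta> l) x * ?e x" for x
        by (auto simp: tilt_def tilt_event_def indicator_def)
      then have "(\<E> x. tilt t I \<delta> l x) =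
        (\<E> x. indicator (good t I) x * ?e x) - (\<E> x. indicator (good t I - tilt_event t I \<delta> l) x * ?e x)"
        using i by simp
      also have "\<dots> \<ge> (1 - 5 * \<eta>') - 16 * exp (- (\<delta>\<^sup>2 * b' / 4 * ln (real t)))"
        using elim(2,3) r by (intro diff_mono) auto
      finally show "1 - \<eta> \<le> (\<E> x. tilt t I \<delta> l x)" using elim(1) \<eta>' by linarith
    qed
  qed
qed

text \<open>A crude constant suffices, as it serves only the diagonal terms of the second
  moment.\<close>

lemma eventually_integral_tilt_le:
  assumes b: "b > 0"
  shows "eventually (\<lambda>t. \<forall>I l \<delta>. regime b t I l \<longrightarrow> (\<E> x. tilt t I \<delta> l x) \<le> 8) sequentially"
  using eventually_exp_moment_le[OF b]
proof eventually_elim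
  case (elim t)
  show ?case
  proof (intro allI impI)
    fix I l \<delta> assume r: "regime b t I l"
    have "(\<E> x. tilt t I \<delta> l x) \<le>
      (\<E> x. (indicator (good t I) x * exp (l * csum I x)) * exp (- (l\<^sup>2 * card I / 4)))"
    proof (intro integral_mono integrable_tilt integrable_mult_left integrable_indicator_continuous continuous_intros)
      show "tilt t I \<delta> l x \<le> (indicator (good t I) x * exp (l * csum I x)) * exp (- (l\<^sup>2 * card I / 4))" for x
        by (auto simp: tilt_def tilt_event_def indicator_def exp_add [symmetric])
    qed simp
    also have "\<dots> = (\<E> x. indicator (good t I) x * exp (l * csum I x)) * exp (- (l\<^sup>2 * card I / 4))"
      by simp
    also have "\<dots> \<le> 8 * exp (l\<^sup>2 * card I / 4) * exp (- (l\<^sup>2 * card I / 4))"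
      using elim r by (intro mult_right_mono) auto
    also have "\<dots> = 8" by (simp add: exp_minus)
    finally show "(\<E> x. tilt t I \<delta> l x) \<le> 8" .
  qed
qed

text \<open>For products of two blocks the constant has to be close to 1, so the truncation error
  must be small in the relative sense. Inside the window the sum is at least
  \<open>l * card I / 4\<close>, which keeps the product at \<open>l / 2\<close> above
  \<open>1/2\<close> and makes the additive error \<open>\<eta>\<close> a relative one of
  \<open>2 * \<eta>\<close>. The majorant is nonnegative everywhere, so majorants of two blocks can
  be multiplied.\<close>

lemma eventually_tilt_le_square:
  assumes b: "b > 0" and \<eta>: "0 < \<eta>" "\<eta> < 1/2"
  shows "eventually (\<lambda>t. \<forall>I l \<delta> x. regime b t I l \<and> 0 \<le> l \<and> \<delta> \<le> 1/2 \<longrightarrow>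
     tilt t I \<delta> l x \<le> exp (2 * \<eta>) / (1 - 2 * \<eta>)\<^sup>2 * exp (- (card I * (l / 2)\<^sup>2 / 2)) * (tsum (c x) I (trunc t) (l / 2))\<^sup>2) sequentially"
  using eventually_good_approx[OF b \<eta>(1)]
proof eventually_elim
  case (elim t)
  show ?case
  proof (intro allI impI, elim conjE)
    fix I l \<delta> x assume reg: "regime b t I l" and l: "0 \<le> l" and \<delta>: "\<delta> \<le> (1/2::real)"
    define \<mu> where "\<mu> = l / 2"
    define M where "M = real (card I)"
    let ?T = "tsum (c x) I (trunc t) \<mu>"
    have reg2: "regime b t I \<mu>"
    proof -
      have "\<mu>\<^sup>2 * card I \<le> l\<^sup>2 * card I" by (intro mult_right_mono) (auto simp: \<mu>_def power_divide)
      then show ?thesis using reg by (auto simp: regime_def)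
    qed
    show "tilt t I \<delta> l x \<le> exp (2 * \<eta>) / (1 - 2 * \<eta>)\<^sup>2 * exp (- (card I * (l / 2)\<^sup>2 / 2)) * (tsum (c x) I (trunc t) (l / 2))\<^sup>2"
    proof (cases "x \<in> tilt_event t I \<delta> l")
      case False
      then show ?thesis by (simp add: tilt_def)
    next
      case True
      then have p: "riesz I \<mu> x > 0" "\<bar>ln (riesz I \<mu> x) - (\<mu> * csum I x - \<mu>\<^sup>2 * M / 4)\<bar> \<le> \<eta>" "\<bar>riesz I \<mu> x - ?T\<bar> \<le> \<eta>"
        using elim reg2 by (auto simp: M_def tilt_event_def)
      \<comment> \<open>This uses the lower edge of the window together with
        \<open>\<delta> \<le> 1/2\<close>.\<close>
      have "1/2 * (l * M / 2) \<le> (1 - \<delta>) * (l * M / 2)" using \<delta> l by (intro mult_right_mono) (auto simp: M_def)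
      then have "l * M / 4 \<le> csum I x" using True by (simp add: tilt_event_def M_def)
      then have "\<mu> * (l * M / 4) \<le> \<mu> * csum I x" using l by (intro mult_left_mono) (auto simp: \<mu>_def)
      then have "\<mu>\<^sup>2 * M / 2 \<le> \<mu> * csum I x" by (simp add: \<mu>_def power2_eq_square)
      moreover have "0 \<le> \<mu>\<^sup>2 * M" by (simp add: M_def)
      ultimately have "ln (riesz I \<mu> x) \<ge> - \<eta>" using p(2) by linarith
      then have "riesz I \<mu> x \<ge> exp (- \<eta>)" using p(1) by (simp add: ln_ge_iff)
      then have P2: "riesz I \<mu> x \<ge> 1/2" using exp_ge_add_one_self[of "- \<eta>"] \<eta> by linarith
      have "\<eta> * 1 \<le> \<eta> * (2 * riesz I \<mu> x)" using P2 \<eta> by (intro mult_left_mono) auto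
      then have "(1 - 2 * \<eta>) * riesz I \<mu> x \<le> ?T" using p(3) by (simp add: algebra_simps)
      then have "((1 - 2 * \<eta>) * riesz I \<mu> x)\<^sup>2 \<le> ?T\<^sup>2" using \<eta> p(1) by (intro power_mono) auto
      then have PT: "(riesz I \<mu> x)\<^sup>2 \<le> ?T\<^sup>2 / (1 - 2 * \<eta>)\<^sup>2" using \<eta> by (simp add: power_mult_distrib le_divide_eq mult.commute)
      have "tilt t I \<delta> l x = exp (2 * (\<mu> * csum I x) - \<mu>\<^sup>2 * M)"
        using True by (simp add: tilt_def \<mu>_def M_def power_divide)
      also have "\<dots> \<le> exp (ln (riesz I \<mu> x) + ln (riesz I \<mu> x) + (2 * \<eta> - \<mu>\<^sup>2 * M / 2))"
        using p(2) unfolding exp_le_cancel_iff by linarith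
      also have "\<dots> = exp (ln (riesz I \<mu> x)) * exp (ln (riesz I \<mu> x)) * (exp (2 * \<eta>) * exp (- (M * \<mu>\<^sup>2 / 2)))"
        unfolding exp_add [symmetric] by (simp add: mult.commute)
      also have "\<dots> = (riesz I \<mu> x)\<^sup>2 * (exp (2 * \<eta>) * exp (- (M * \<mu>\<^sup>2 / 2)))"
        using p(1) by (simp add: power2_eq_square)
      also have "\<dots> \<le> ?T\<^sup>2 / (1 - 2 * \<eta>)\<^sup>2 * (exp (2 * \<eta>) * exp (- (M * \<mu>\<^sup>2 / 2)))"
        using PT by (intro mult_right_mono) auto
      finally show ?thesis by (simp add: \<mu>_def M_def mult_ac)
    qed
  qed
qed

text \<open>The pointwise square majorants are multiplied, and the joint mean square of the
  truncated products cancels both normalising exponentials. Only relations across the two blocks and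
  the constant \<open>\<kappa>\<^sup>2\<close> remain, all close to 1.\<close>

lemma eventually_integral_tilt_mult_le:
  assumes b: "b > 0" and \<eta>: "0 < \<eta>"
  shows "eventually (\<lambda>t. \<forall>I J l k \<delta>. regime b t I l \<and> 0 \<le> l \<and> regime b t J k \<and> 0 \<le> k \<and> I \<inter> J = {} \<and> \<delta> \<le> 1/2 \<longrightarrow>
     (\<E> x. tilt t I \<delta> l x * tilt t J \<delta> k x) \<le> 1 + \<eta>) sequentially"
proof -
  have "((\<lambda>e::real. (exp (2 * e) / (1 - 2 * e)\<^sup>2)\<^sup>2 * (1 + e)) \<longlongrightarrow> 1) (at_right 0)" by real_asymp
  then have "eventually (\<lambda>e::real. (exp (2 * e) / (1 - 2 * e)\<^sup>2)\<^sup>2 * (1 + e) < 1 + \<eta>) (at_right 0)"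
    using \<eta> by (intro order_tendstoD(2)) auto
  moreover have "eventually (\<lambda>e::real. 0 < e \<and> e < 1/2) (at_right 0)"
    by (auto simp: eventually_at_right_less eventually_conj_iff eventually_at_right[of 0 1] intro!: exI[of _ "1/2"])
  ultimately have "eventually (\<lambda>e::real. (exp (2 * e) / (1 - 2 * e)\<^sup>2)\<^sup>2 * (1 + e) < 1 + \<eta> \<and> 0 < e \<and> e < 1/2) (at_right 0)"
    by eventually_elim auto
  then obtain e :: real where e: "(exp (2 * e) / (1 - 2 * e)\<^sup>2)\<^sup>2 * (1 + e) < 1 + \<eta>" "0 < e" "e < 1/2"
    using eventually_happens'[OF trivial_limit_at_right_real] by blast
  define \<kappa> where "\<kappa> = exp (2 * e) / (1 - 2 * e)\<^sup>2"
  show ?thesis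
    using eventually_tilt_le_square[OF b e(2,3)] eventually_rel_series_small[OF b e(2)]
  proof eventually_elim
    case (elim t)
    show ?case
    proof (intro allI impI, elim conjE)
      fix I J l k \<delta> assume reg: "regime b t I l" "regime b t J k" and l: "0 \<le> l" "0 \<le> k" and disj: "I \<inter> J = {}" and \<delta>: "\<delta> \<le> (1/2::real)"
      have I: "finite I" "I \<subseteq> {1..}" "finite J" "J \<subseteq> {1..}" using reg by (auto simp: regime_def)
      \<comment> \<open>The blocks may carry different tilts; one common bound for all weights is
        what the relation series needs.\<close>
      define \<mu> where "\<mu> = max l k"
      have "\<bar>\<mu>\<bar>\<^sup>2 * 2 ^ t \<le> b * ln (real t)" using regime_square_le[OF reg(1)] regime_square_le[OF reg(2)]
        by (simp add: \<mu>_def max_def)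
      then have small: "\<mu> \<le> 1/2" "rel_series (4 * trunc t) \<mu> \<le> e" "0 \<le> \<mu>"
        using elim(2)[rule_format, of \<mu>] l by (auto simp: \<mu>_def)
      let ?T = "\<lambda>x. (tsum (c x) I (trunc t) (l / 2))\<^sup>2" and ?U = "\<lambda>x. (tsum (c x) J (trunc t) (k / 2))\<^sup>2"
      let ?a = "card I * (l / 2)\<^sup>2 / 2" and ?d = "card J * (k / 2)\<^sup>2 / 2"
      have \<kappa>0: "\<kappa> \<ge> 0" by (simp add: \<kappa>_def)
      have "(\<E> x. tilt t I \<delta> l x * tilt t J \<delta> k x) \<le>
        (\<E> x. \<kappa>\<^sup>2 * exp (- (?a + ?d)) * (?T x * ?U x))"
      proof (intro integral_mono integrable_tilt_mult integrable_continuous_unit_interval continuous_intros)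
        fix x
        have "tilt t I \<delta> l x * tilt t J \<delta> k x \<le> (\<kappa> * exp (- ?a) * ?T x) * (\<kappa> * exp (- ?d) * ?U x)"
          using elim(1) reg l \<delta> \<kappa>0 unfolding \<kappa>_def by (intro mult_mono tilt_nonneg) auto
        also have "\<dots> = \<kappa>\<^sup>2 * exp (- (?a + ?d)) * (?T x * ?U x)"
        proof -
          have e: "exp (- (?a + ?d)) = exp (- ?a) * exp (- ?d)" unfolding exp_add [symmetric] by simp
          show ?thesis unfolding e by (simp add: power2_eq_square mult_ac)
        qed
        finally show "tilt t I \<delta> l x * tilt t J \<delta> k x \<le> \<kappa>\<^sup>2 * exp (- (?a + ?d)) * (?T x * ?U x)" .
      qed
      also have "\<dots> = \<kappa>\<^sup>2 * exp (- (?a + ?d)) * (\<E> x. ?T x * ?U x)" by simp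
      also have "\<dots> \<le> \<kappa>\<^sup>2 * exp (- (?a + ?d)) * (exp (?a + ?d) * (1 + rel_series (4 * trunc t) \<mu>))"
        using small l by (intro mult_left_mono integral_tsum_square_mult_le I disj) (auto simp: \<mu>_def)
      also have "\<dots> = \<kappa>\<^sup>2 * (exp (- (?a + ?d)) * exp (?a + ?d)) * (1 + rel_series (4 * trunc t) \<mu>)"
        by (simp only: mult.assoc)
      also have "exp (- (?a + ?d)) * exp (?a + ?d) = 1" unfolding exp_add [symmetric] by simp
      also have "\<kappa>\<^sup>2 * 1 * (1 + rel_series (4 * trunc t) \<mu>) = \<kappa>\<^sup>2 * (1 + rel_series (4 * trunc t) \<mu>)" by simp
      also have "\<dots> \<le> \<kappa>\<^sup>2 * (1 + e)" using small by (intro mult_left_mono) auto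
      also have "\<dots> \<le> 1 + \<eta>" using e(1) by (simp add: \<kappa>_def)
      finally show "(\<E> x. tilt t I \<delta> l x * tilt t J \<delta> k x) \<le> 1 + \<eta>" .
    qed
  qed
qed

end

section \<open>Law of the iterated logarithm\<close>

lemma AE_mem_of_integral_indicator:
  assumes A: "A \<in> sets borel" and int: "(\<E> x. indicator A x) \<ge> (1::real)"
  shows "AE x in unit_interval_measure. x \<in> A"
proof -
  interpret prob_space unit_interval_measure by (rule prob_space_unit_interval)
  have meas: "A \<inter> {0..1} \<in> sets unit_interval_measure"
    using A by (simp add: unit_interval_measure_def sets_restrict_space_iff)
  have "prob (A \<inter> {0..1}) \<ge> 1" using int by simp
  then have "prob (A \<inter> {0..1}) = 1" using prob_le_1 antisym by blast
  then have "AE x in unit_interval_measure. x \<in> A \<inter> {0..1}"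
    using prob_eq_1[OF meas] by simp
  then show ?thesis by eventually_elim simp
qed

text \<open>Markov's inequality with the Borel-Cantelli lemma. In its uses \<open>f a\<close> is a
  sum of nonnegative terms, each at least 1 on an exceptional event, so that
  \<open>f a x < 1\<close> excludes all these events at once.\<close>

lemma AE_eventually_less_1:
  fixes f :: "nat \<Rightarrow> real \<Rightarrow> real"
  assumes int: "\<And>a. integrable unit_interval_measure (f a)" and nn: "\<And>a x. f a x \<ge> 0"
    and le: "eventually (\<lambda>a. (\<E> x. f a x) \<le> w a) sequentially" and w: "summable w"
  shows "AE x in unit_interval_measure. eventually (\<lambda>a. f a x < 1) sequentially"
proof -
  interpret prob_space unit_interval_measure by (rule prob_space_unit_interval)
  define A where "A = (\<lambda>a. {x \<in> space unit_interval_measure. f a x \<ge> 1})"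
  have [measurable]: "f a \<in> borel_measurable unit_interval_measure" for a
    using int by (rule borel_measurable_integrable)
  have A [measurable]: "A a \<in> sets unit_interval_measure" for a unfolding A_def by measurable
  have mA: "prob (A a) \<le> (\<E> x. f a x)" for a
  proof -
    have "prob (A a) = (\<E> x. indicat_real (A a) x)"
      using sets.sets_into_space[OF A] by (simp add: Int_absorb2)
    also have "\<dots> \<le> (\<E> x. f a x)"
    proof (rule integral_mono)
      show "integrable unit_interval_measure (indicat_real (A a))"
        by (intro integrable_real_indicator A) (auto simp: emeasure_eq_measure)
      show "indicat_real (A a) x \<le> f a x" for x
        using nn[of a x] by (auto simp: A_def split: split_indicator)
    qed (rule int)
    finally show ?thesis .
  qed
  have "summable (\<lambda>a. prob (A a))"
  proof (rule summable_comparison_test_ev[OF _ w])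
    show "eventually (\<lambda>a. norm (prob (A a)) \<le> w a) sequentially"
      using le by eventually_elim (use mA order_trans in fastforce)
  qed
  then have "AE x in unit_interval_measure. eventually (\<lambda>a. x \<in> space unit_interval_measure - A a) sequentially"
    by (intro borel_cantelli_AE1 A) (auto simp: emeasure_eq_measure)
  then show ?thesis
    by eventually_elim (auto simp: A_def elim!: eventually_mono)
qed

lemma Limsup_ge_frequently:
  fixes f :: "nat \<Rightarrow> real"
  assumes "\<And>J. \<exists>N\<ge>J. r \<le> f N"
  shows "ereal r \<le> limsup (\<lambda>N. ereal (f N))"
proof (rule ccontr)
  assume "\<not> ereal r \<le> limsup (\<lambda>N. ereal (f N))"
  then have "eventually (\<lambda>N. ereal (f N) < ereal r) sequentially"
    by (intro Limsup_lessD) simp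
  then obtain J where "\<And>N. N \<ge> J \<Longrightarrow> f N < r" by (auto simp: eventually_sequentially)
  with assms[of J] show False by (meson not_le)
qed

context lil_system
begin

text \<open>The blocks \<open>J, ..., 2 * J - 1\<close> are treated as a batch with the common value
  \<open>t = J\<close>. The tilts satisfy \<open>l\<^sup>2 * card = b * ln J\<close>, so a tilted
  indicator is bounded by a power of \<open>J\<close> below 1, small compared with the
  \<open>J\<close> blocks in the batch; hence one of them is large with probability close to
  1.\<close>

lemma AE_block_sums_large:
  assumes I: "\<And>j. finite (Ib j)" "\<And>j. Ib j \<subseteq> {1..}" "\<And>j. 2 ^ j \<le> real (card (Ib j))"
    and disj: "\<And>i j. i \<noteq> j \<Longrightarrow> Ib i \<inter> Ib j = {}" and \<epsilon>: "0 < \<epsilon>" "\<epsilon> < 1"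
  shows "AE x in unit_interval_measure. \<forall>J. \<exists>j\<ge>J. (1 - \<epsilon>)\<^sup>2 * sqrt (card (Ib j) * ln (real j / 2)) \<le> csum (Ib j) x"
proof -
  define E where "E = (\<lambda>j. {x. (1 - \<epsilon>)\<^sup>2 * sqrt (card (Ib j) * ln (real j / 2)) \<le> csum (Ib j) x})"
  have E [measurable, simp]: "E j \<in> sets borel" for j
  proof -
    have [measurable]: "csum I \<in> borel_measurable borel" for I
      by (auto intro!: borel_measurable_continuous_onI continuous_intros)
    show ?thesis unfolding E_def by measurable
  qed
  define \<delta> where "\<delta> = \<epsilon> / 2"
  define b where "b = 4 * (1 - \<epsilon>)\<^sup>2"
  \<comment> \<open>\<open>1 - a\<close> is the exponent of \<open>J\<close> in the supremum of a
    tilted indicator, namely \<open>b * (1 + 2 * \<delta>) / 4\<close>; positivity of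
    \<open>a\<close> is the reason for aiming slightly below the critical level.\<close>
  define a where "a = 1 - (1 - \<epsilon>)\<^sup>2 * (1 + \<epsilon>)"
  have b: "b > 0" using \<epsilon> by (simp add: b_def)
  have \<delta>: "0 < \<delta>" "\<delta> < 1" "\<delta> \<le> 1/2" using \<epsilon> by (auto simp: \<delta>_def)
  have a: "a > 0"
  proof -
    have "(1 - \<epsilon>)\<^sup>2 * (1 + \<epsilon>) = (1 - \<epsilon>) * (1 - \<epsilon> * \<epsilon>)" by (simp add: power2_eq_square algebra_simps)
    also have "\<dots> < 1 * 1" using \<epsilon> by (intro mult_strict_mono) (auto simp: mult_le_one)
    finally show ?thesis by (simp add: a_def)
  qed
  have union: "eventually (\<lambda>J. (\<E> x. indicat_real (\<Union>j\<in>{J..<2*J}. E j) x) \<ge> 1 - \<eta>) sequentially"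
    if \<eta>: "\<eta> > 0" for \<eta>
  proof -
    define \<eta>' where "\<eta>' = \<eta> / 6"
    have \<eta>': "\<eta>' > 0" using \<eta> by (simp add: \<eta>'_def)
    have "(\<lambda>J::nat. 8 * exp ((1 - a) * ln (real J)) / real J) \<longlonglongrightarrow> 0" using a by real_asymp
    from order_tendstoD(2)[OF this, of "\<eta> / 2"]
    have e: "eventually (\<lambda>J::nat. 8 * exp ((1 - a) * ln (real J)) / real J < \<eta> / 2) sequentially" using \<eta> by simp
    show ?thesis
      using e eventually_integral_tilt_ge[OF b b \<delta>(1,2) \<eta>'] eventually_integral_tilt_le[OF b] eventually_integral_tilt_mult_le[OF b \<eta>'] eventually_ge_at_top[of 2]
    proof eventually_elim
      case (elim J)
      define l where "l = (\<lambda>j. 2 * (1 - \<epsilon>) * sqrt (ln (real J) / card (Ib j)))"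
      have M: "real (card (Ib j)) > 0" for j using I(3)[of j] by (smt (verit) zero_less_power)
      have l0: "l j \<ge> 0" for j using \<epsilon> elim(5) by (simp add: l_def)
      have l2: "(l j)\<^sup>2 * card (Ib j) = b * ln (real J)" for j
        unfolding l_def b_def power_mult_distrib using M[of j] elim(5) by simp
      have reg: "regime b J (Ib j) (l j)" if "j \<ge> J" for j
      proof -
        have "(2::real) ^ J \<le> 2 ^ j" using that by (intro power_increasing) auto
        then have "2 ^ J \<le> real (card (Ib j))" using I(3) by (rule order_trans)
        then show ?thesis unfolding regime_def using I l2 by auto
      qed
      have "1 - 3 * \<eta>' - 8 * exp ((1 - a) * ln (real J)) / card {J..<2*J}
          \<le> (\<E> x. indicat_real (\<Union>j\<in>{J..<2*J}. E j) x)"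
      proof (rule second_moment_union[where V = "\<lambda>j. tilt J (Ib j) \<delta> (l j)"])
        fix j x assume j: "j \<in> {J..<2*J}"
        show "1 - \<eta>' \<le> (\<E> x. tilt J (Ib j) \<delta> (l j) x)"
          using elim(2) reg[of j] l0 l2[of j] j by auto
        show "(\<E> x. tilt J (Ib j) \<delta> (l j) x) \<le> 8"
          using elim(3) reg[of j] j by auto
        have "tilt J (Ib j) \<delta> (l j) x \<le> exp ((l j)\<^sup>2 * card (Ib j) * (1 + 2 * \<delta>) / 4)" by (rule tilt_le[OF l0])
        also have "(l j)\<^sup>2 * card (Ib j) * (1 + 2 * \<delta>) / 4 = (1 - a) * ln (real J)"
          unfolding l2 by (simp add: a_def b_def \<delta>_def)
        finally show "tilt J (Ib j) \<delta> (l j) x \<le> exp ((1 - a) * ln (real J))" .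
        assume "tilt J (Ib j) \<delta> (l j) x \<noteq> 0"
        then have "x \<in> tilt_event J (Ib j) \<delta> (l j)" by (auto simp: tilt_def split: split_indicator_asm)
        then have x: "(1 - \<delta>) * l j * card (Ib j) / 2 \<le> csum (Ib j) x" by (simp add: tilt_event_def)
        \<comment> \<open>Since \<open>j < 2 * J\<close>, the logarithm of \<open>j / 2\<close> is
          at most \<open>ln J\<close>; this is why the threshold is stated with
          \<open>j / 2\<close>.\<close>
        have "(1 - \<epsilon>)\<^sup>2 * sqrt (card (Ib j) * ln (real j / 2)) \<le> (1 - \<epsilon>)\<^sup>2 * sqrt (card (Ib j) * ln (real J))"
          using j elim(5) by (intro mult_left_mono real_sqrt_le_mono) auto
        also have "\<dots> \<le> (1 - \<delta>) * (1 - \<epsilon>) * sqrt (card (Ib j) * ln (real J))"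
          using \<epsilon> elim(5) unfolding power2_eq_square \<delta>_def by (intro mult_right_mono) auto
        also have "\<dots> = (1 - \<delta>) * l j * card (Ib j) / 2"
        proof -
          have "sqrt (ln (real J) / card (Ib j)) * card (Ib j) = sqrt (card (Ib j) * ln (real J))"
            using M[of j] by (simp add: real_sqrt_divide real_sqrt_mult real_div_sqrt field_simps)
          then show ?thesis by (simp add: l_def)
        qed
        finally show "x \<in> E j" using x by (simp add: E_def)
      next
        fix i j assume ij: "i \<in> {J..<2*J}" "j \<in> {J..<2*J}" "i \<noteq> j"
        then show "(\<E> x. tilt J (Ib i) \<delta> (l i) x * tilt J (Ib j) \<delta> (l j) x) \<le> 1 + \<eta>'"
          using elim(4) reg[of i] reg[of j] l0 disj[of i j] \<delta> by auto
      qed (use elim(5) \<eta>' in \<open>auto simp: tilt_nonneg integrable_tilt integrable_tilt_mult\<close>)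
      then show ?case using elim(1) by (simp add: \<eta>'_def mult_2)
    qed
  qed
  \<comment> \<open>A late batch lies beyond any given \<open>J\<close> and has union of probability
    at least \<open>1 - \<eta>\<close> for every positive \<open>\<eta>\<close>, so the full tail
    has probability 1.\<close>
  have "(\<E> x. indicat_real (\<Union>j\<in>{J..}. E j) x) \<ge> 1" for J
  proof (rule field_le_epsilon)
    fix \<eta> :: real assume "\<eta> > 0"
    from eventually_conj[OF union[OF this] eventually_ge_at_top[of J]]
    obtain J' where J': "J' \<ge> J" "(\<E> x. indicat_real (\<Union>j\<in>{J'..<2*J'}. E j) x) \<ge> 1 - \<eta>"
      by (auto simp: eventually_sequentially)
    have "(\<E> x. indicat_real (\<Union>j\<in>{J'..<2*J'}. E j) x) \<le> (\<E> x. indicat_real (\<Union>j\<in>{J..}. E j) x)"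
    proof (intro integral_mono integrable_indicator_unit_interval)
      show "indicat_real (\<Union>j\<in>{J'..<2*J'}. E j) x \<le> indicat_real (\<Union>j\<in>{J..}. E j) x" for x
        using J'(1) by (intro indicator_leI) auto
    qed auto
    then show "1 \<le> (\<E> x. indicat_real (\<Union>j\<in>{J..}. E j) x) + \<eta>" using J' by linarith
  qed
  then have "AE x in unit_interval_measure. x \<in> (\<Union>j\<in>{J..}. E j)" for J
    by (intro AE_mem_of_integral_indicator) auto
  then have "AE x in unit_interval_measure. \<forall>J. x \<in> (\<Union>j\<in>{J..}. E j)"
    by (simp add: AE_all_countable)
  then show ?thesis by eventually_elim (fastforce simp: E_def)
qed


section \<open>Upper half: checkpoints and dyadic blocks between them\<close>

text \<open>There are at most \<open>a powr \<epsilon>\<close> checkpoints between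
  \<open>2 ^ a\<close> and \<open>2 ^ Suc a\<close>. Exceeding the level costs
  \<open>a powr (- ((1 + \<epsilon>)\<^sup>2))\<close> at each by Chernoff's bound, and the union
  over all of them is still summable in \<open>a\<close>. The sign \<open>s\<close> provides bounds
  from both sides.\<close>

lemma AE_checkpoints_small:
  assumes s: "s \<in> {-1, 1::real}" and \<epsilon>: "0 < \<epsilon>" "\<epsilon> \<le> 1"
  shows "AE x in unit_interval_measure. eventually (\<lambda>a. \<forall>i<2 ^ nat \<lfloor>\<epsilon> * log 2 (real a)\<rfloor>.
     let N = 2 ^ a + i * 2 ^ (a - nat \<lfloor>\<epsilon> * log 2 (real a)\<rfloor>) in s * csum {1..N} x \<le> (1 + \<epsilon>) * sqrt (real N * ln (real a))) sequentially"
proof -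
  interpret prob_space unit_interval_measure by (rule prob_space_unit_interval)
  define d where "d = (\<lambda>a. nat \<lfloor>\<epsilon> * log 2 (real a)\<rfloor>)"
  define N where "N = (\<lambda>a i. 2 ^ a + i * 2 ^ (a - d a) :: nat)"
  \<comment> \<open>The optimal Chernoff parameter: twice the level divided by the number of
    terms.\<close>
  define l where "l = (\<lambda>a i. s * (2 * (1 + \<epsilon>) * sqrt (ln (real a) / N a i)))"
  define b where "b = 4 * (1 + \<epsilon>)\<^sup>2"
  have b: "b > 0" using \<epsilon> by (simp add: b_def)
  have Npos: "real (N a i) \<ge> 2 ^ a" for a i by (simp add: N_def)
  have Npos': "real (N a i) > 0" for a i using Npos[of a i] by (smt (verit) zero_less_power)
  have s2: "s\<^sup>2 = 1" using s by auto
  have l2: "(l a i)\<^sup>2 * N a i = b * ln (real a)" if "a \<ge> 1" for a i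
    unfolding l_def b_def power_mult_distrib s2 using Npos'[of a i] that by simp
  \<comment> \<open>Each summand combines the exponential Markov bound on the good set with the
    indicator of the bad set; a value below 1 forces both the good set and the desired
    inequality.\<close>
  define f where "f = (\<lambda>a x. \<Sum>i<2 ^ d a. indicator (good a {1..N a i}) x * exp (l a i * csum {1..N a i} x) * exp (- (b / 2 * ln (real a)))
      + indicator (- good a {1..N a i}) x)"
  have int: "integrable unit_interval_measure (\<lambda>x. indicator (good a {1..N a i}) x * exp (l a i * csum {1..N a i} x))"
     "integrable unit_interval_measure (indicat_real (- good a {1..N a i}))" for a i
    by (auto intro!: integrable_indicator_continuous integrable_indicator_unit_interval continuous_intros)
  have "AE x in unit_interval_measure. eventually (\<lambda>a. f a x < 1) sequentially"
  proof (rule AE_eventually_less_1)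
    show "integrable unit_interval_measure (f a)" for a
      unfolding f_def using int by (intro Bochner_Integration.integrable_sum Bochner_Integration.integrable_add integrable_mult_left)
    show "0 \<le> f a x" for a x unfolding f_def by (intro sum_nonneg add_nonneg_nonneg mult_nonneg_nonneg) auto
    show "summable (\<lambda>a. 8 * real a powr (- (1 + \<epsilon>)) + real a powr (- 2))"
      using \<epsilon> by (intro summable_add summable_mult) (auto simp: summable_real_powr_iff)
    have "(3::real) > 0" by simp
    show "eventually (\<lambda>a. (\<E> x. f a x) \<le> 8 * real a powr (- (1 + \<epsilon>)) + real a powr (- 2)) sequentially"
      using eventually_bad_small[OF \<open>(3::real) > 0\<close>] eventually_exp_moment_le[OF b] eventually_ge_at_top[of 1]
    proof eventually_elim
      case (elim a)
      have reg: "regime b a {1..N a i} (l a i)" for i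
        using Npos[of a i] l2[OF elim(3), of i] by (simp add: regime_def)
      have "(\<E> x. f a x) = (\<Sum>i<2 ^ d a.
          (\<E> x. indicator (good a {1..N a i}) x * exp (l a i * csum {1..N a i} x)) * exp (- (b / 2 * ln (real a)))
           + (\<E> x. indicator (- good a {1..N a i}) x))"
        unfolding f_def using int by (subst Bochner_Integration.integral_sum) (auto intro!: sum.cong)
      also have "\<dots> \<le> (\<Sum>i<(2::nat) ^ d a. 8 * exp (b / 4 * ln (real a)) * exp (- (b / 2 * ln (real a))) + real a powr (- 3))"
      proof (intro sum_mono add_mono mult_right_mono)
        fix i
        have "(\<E> x. indicator (good a {1..N a i}) x * exp (l a i * csum {1..N a i} x))
            \<le> 8 * exp ((l a i)\<^sup>2 * card {1..N a i} / 4)"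
          using elim(2) reg[of i] by blast
        then show "(\<E> x. indicator (good a {1..N a i}) x * exp (l a i * csum {1..N a i} x)) \<le> 8 * exp (b / 4 * ln (real a))"
          using l2[OF elim(3), of i] by simp
        show "(\<E> x. indicator (- good a {1..N a i}) x) \<le> real a powr (- 3)"
          using elim(1) Npos[of a i] by simp
      qed auto
      also have "\<dots> = 2 ^ d a * (8 * real a powr (- (b / 4)) + real a powr (- 3))"
        using elim(3) by (simp add: powr_def exp_add [symmetric])
      also have "\<dots> \<le> real a powr \<epsilon> * (8 * real a powr (- (b / 4)) + real a powr (- 3))"
      proof (intro mult_right_mono)
        have "(2::real) ^ d a = 2 powr real (d a)" by (simp add: powr_realpow)
        also have "\<dots> \<le> 2 powr (\<epsilon> * log 2 (real a))"
          using elim(3) \<epsilon> unfolding d_def by (intro powr_mono) auto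
        also have "\<dots> = real a powr \<epsilon>" using elim(3) by (simp add: powr_powr [symmetric] mult.commute[of \<epsilon>])
        finally show "(2::real) ^ d a \<le> real a powr \<epsilon>" .
      qed auto
      also have "\<dots> = 8 * real a powr (\<epsilon> - b / 4) + real a powr (\<epsilon> - 3)"
        by (simp add: distrib_left powr_add [symmetric])
      also have "\<dots> \<le> 8 * real a powr (- (1 + \<epsilon>)) + real a powr (- 2)"
        using elim(3) \<epsilon> by (intro add_mono mult_left_mono powr_mono) (auto simp: b_def power2_eq_square algebra_simps)
      finally show ?case .
    qed
  qed
  then show ?thesis
  proof eventually_elim
    case (elim x)
    show ?case using elim eventually_ge_at_top[of 2]
    proof eventually_elim
      case (elim a)
      have "s * csum {1..N a i} x \<le> (1 + \<epsilon>) * sqrt (real (N a i) * ln (real a))" if i: "i < 2 ^ d a" for i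
      proof -
        let ?t = "\<lambda>i. indicator (good a {1..N a i}) x * exp (l a i * csum {1..N a i} x) * exp (- (b / 2 * ln (real a)))
          + indicator (- good a {1..N a i}) x"
        have nn: "0 \<le> ?t i" for i by (intro add_nonneg_nonneg mult_nonneg_nonneg) auto
        have "?t i \<le> (\<Sum>i<2 ^ d a. ?t i)" using i nn by (intro member_le_sum) auto
        also have "\<dots> < 1" using elim(1) by (simp add: f_def)
        finally have t1: "?t i < 1" .
        then have "x \<in> good a {1..N a i}" by (auto split: split_indicator_asm)
        then have "exp (l a i * csum {1..N a i} x - b / 2 * ln (real a)) < 1" using t1 by (simp add: exp_diff exp_minus field_simps)
        then have "l a i * csum {1..N a i} x < b / 2 * ln (real a)" by simp
        then have "(2 * (1 + \<epsilon>)) * (sqrt (ln (real a) / N a i) * (s * csum {1..N a i} x)) < (2 * (1 + \<epsilon>)) * ((1 + \<epsilon>) * ln (real a))"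
        proof -
          have "l a i * csum {1..N a i} x = (2 * (1 + \<epsilon>)) * (sqrt (ln (real a) / N a i) * (s * csum {1..N a i} x))"
            by (simp only: l_def mult_ac)
          moreover have "b / 2 * ln (real a) = (2 * (1 + \<epsilon>)) * ((1 + \<epsilon>) * ln (real a))"
            by (simp add: b_def power2_eq_square algebra_simps)
          ultimately show ?thesis using \<open>l a i * csum {1..N a i} x < b / 2 * ln (real a)\<close> by (simp only:)
        qed
        then have *: "sqrt (ln (real a) / N a i) * (s * csum {1..N a i} x) < (1 + \<epsilon>) * ln (real a)"
          using \<epsilon> by (subst (asm) mult_less_cancel_left_pos) auto
        have la: "ln (real a) > 0" using elim(2) by simp
        have "s * csum {1..N a i} x < (1 + \<epsilon>) * ln (real a) / sqrt (ln (real a) / N a i)"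
          using * la Npos'[of a i] by (simp add: less_divide_eq mult.commute)
        also have "\<dots> = (1 + \<epsilon>) * sqrt (real (N a i) * ln (real a))"
        proof -
          have "sqrt (real (N a i) * ln (real a)) * sqrt (ln (real a) / N a i) = sqrt ((ln (real a))\<^sup>2)"
            unfolding real_sqrt_mult [symmetric] using Npos'[of a i] by (simp add: power2_eq_square)
          then have "ln (real a) / sqrt (ln (real a) / N a i) = sqrt (real (N a i) * ln (real a))"
            using la Npos'[of a i] by (simp add: divide_eq_eq)
          then show ?thesis by (metis times_divide_eq_right)
        qed
        finally show ?thesis by simp
      qed
      then show ?case by (simp add: N_def d_def Let_def)
    qed
  qed
qed

text \<open>These blocks may be very short, so polynomial moments are used. There are
  \<open>2 ^ (d + u)\<close> blocks of length \<open>2 ^ (a - d - u)\<close>; with the moment of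
  order \<open>2 * q\<close> the total is at most a constant times
  \<open>2 ^ (- d * (q - 1))\<close> times the power \<open>u\<close> of
  \<open>2 * (50/81) ^ q\<close>. The ratio \<open>9/10\<close> exceeds \<open>sqrt (1/2)\<close>,
  so \<open>50/81 < 1\<close>, and is below 1, so the deviations are summable over the
  scales.\<close>

lemma AE_dyadic_blocks_small:
  assumes \<epsilon>: "0 < \<epsilon>" "\<epsilon> \<le> 1"
  shows "AE x in unit_interval_measure. eventually (\<lambda>a. \<forall>u\<in>{1..a - nat \<lfloor>\<epsilon> * log 2 (real a)\<rfloor>}. \<forall>i<2 ^ (nat \<lfloor>\<epsilon> * log 2 (real a)\<rfloor> + u).
     let L = 2 ^ (a - nat \<lfloor>\<epsilon> * log 2 (real a)\<rfloor> - u) in \<bar>csum {2 ^ a + i * L<..2 ^ a + Suc i * L} x\<bar> \<le> (9/10) ^ u * sqrt (2 ^ a)) sequentially"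
proof -
  define d where "d = (\<lambda>a. nat \<lfloor>\<epsilon> * log 2 (real a)\<rfloor>)"
  define L where "L = (\<lambda>a u. 2 ^ (a - d a - u) :: nat)"
  define Bk where "Bk = (\<lambda>a u i. {2 ^ a + i * L a u<..2 ^ a + Suc i * L a u})"
  define h where "h = (\<lambda>a u. (9/10) ^ u * sqrt (2 ^ a) :: real)"
  \<comment> \<open>The \<open>+ 3\<close> makes \<open>2 * (50/81) ^ q\<close> at most
    \<open>1/2\<close>, for summation over scales; the term \<open>2 / \<epsilon>\<close> makes
    \<open>2 ^ (- d * (q - 1))\<close> of order \<open>a powr (- 2)\<close>, for summation over
    \<open>a\<close>.\<close>
  define q where "q = nat \<lceil>2 / \<epsilon>\<rceil> + 3"
  have q: "q \<ge> 3" "\<epsilon> * real (q - 1) \<ge> 2"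
  proof -
    have "2 / \<epsilon> \<le> real (q - 1)" unfolding q_def by linarith
    then have "2 \<le> real (q - 1) * \<epsilon>" using \<epsilon> by (subst (asm) pos_divide_le_eq)
    then show "\<epsilon> * real (q - 1) \<ge> 2" by (simp only: mult.commute)
  qed (simp add: q_def)
  have hpos: "h a u > 0" for a u by (simp add: h_def)
  have Bk: "finite (Bk a u i)" "Bk a u i \<subseteq> {1..}" "card (Bk a u i) = L a u" for a u i
    by (auto simp: Bk_def)
  define f where "f = (\<lambda>a x. \<Sum>u\<in>{1..a - d a}. \<Sum>i<2 ^ (d a + u). (csum (Bk a u i) x) ^ (2 * q) / (h a u) ^ (2 * q))"
  have int: "integrable unit_interval_measure (\<lambda>x. (csum I x) ^ (2 * q))" for I
    by (intro integrable_continuous_unit_interval continuous_intros)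
  have "AE x in unit_interval_measure. eventually (\<lambda>a. f a x < 1) sequentially"
  proof (rule AE_eventually_less_1)
    show "integrable unit_interval_measure (f a)" for a
      unfolding f_def using int by (intro Bochner_Integration.integrable_sum integrable_divide)
    show "0 \<le> f a x" for a x
      unfolding f_def by (intro sum_nonneg divide_nonneg_nonneg) (auto simp: power_mult)
    show "summable (\<lambda>a. moment_bound q * 2 ^ (q - 1) * real a powr (- 2))"
      by (intro summable_mult) (simp add: summable_real_powr_iff)
    show "eventually (\<lambda>a. (\<E> x. f a x) \<le> moment_bound q * 2 ^ (q - 1) * real a powr (- 2)) sequentially"
      using eventually_ge_at_top[of 1]
    proof eventually_elim
      case (elim a)
      have summand: "real (2 ^ (d a + u)) * (moment_bound q * (real (L a u) ^ q / (h a u) ^ (2 * q))) \<le> moment_bound q * ((1/2) ^ d a) ^ (q - 1) * (1/2) ^ u"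
        if u: "u \<in> {1..a - d a}" for u
      proof -
        have La: "real (L a u) = 2 ^ a * (1/2) ^ (d a + u)"
        proof -
          have "a = (a - d a - u) + (d a + u)" using u by auto
          then have "(2::real) ^ a = 2 ^ (a - d a - u) * 2 ^ (d a + u)" by (metis power_add)
          then show ?thesis by (simp add: L_def power_one_over)
        qed
        have h2: "(h a u) ^ (2 * q) = ((81/100) ^ u) ^ q * (2 ^ a) ^ q"
        proof -
          have "(h a u)\<^sup>2 = (81/100) ^ u * 2 ^ a"
            by (simp add: h_def power_mult_distrib power_mult [symmetric] mult.commute[of u]) (simp add: power_mult power2_eq_square)
          then show ?thesis by (simp add: power_mult power_mult_distrib)
        qed
        have "real (L a u) ^ q / (h a u) ^ (2 * q) = ((1/2) ^ (d a + u)) ^ q * ((100/81) ^ u) ^ q"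
          unfolding La h2 by (simp add: power_mult_distrib power_divide field_simps)
        also have "\<dots> = ((1/2) ^ d a) ^ q * ((50/81) ^ q) ^ u"
        proof -
          have "((1/2::real) ^ u) ^ q * ((100/81) ^ u) ^ q = ((50/81) ^ q) ^ u"
            by (simp add: power_mult_distrib [symmetric] power_mult [symmetric] mult.commute)
          then show ?thesis by (simp add: power_add power_mult_distrib)
        qed
        finally have e: "real (L a u) ^ q / (h a u) ^ (2 * q) = ((1/2) ^ d a) ^ q * ((50/81) ^ q) ^ u" .
        have "real (2 ^ (d a + u)) * (moment_bound q * (real (L a u) ^ q / (h a u) ^ (2 * q))) =
          moment_bound q * (2 ^ d a * ((1/2) ^ d a) ^ q) * (2 ^ u * ((50/81) ^ q) ^ u)"
          unfolding e by (simp add: power_add)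
        also have "2 ^ d a * ((1/2) ^ d a) ^ q = ((1/2::real) ^ d a) ^ (q - 1)"
        proof -
          have "((1/2::real) ^ d a) ^ q = (1/2) ^ d a * ((1/2) ^ d a) ^ (q - 1)"
            using q by (simp add: power_eq_if)
          then show ?thesis by (simp add: power_one_over)
        qed
        also have "2 ^ u * ((50/81) ^ q) ^ u = (2 * (50/81::real) ^ q) ^ u" by (simp add: power_mult_distrib)
        also have "moment_bound q * ((1/2) ^ d a) ^ (q - 1) * (2 * (50/81) ^ q) ^ u \<le> moment_bound q * ((1/2) ^ d a) ^ (q - 1) * (1/2) ^ u"
        proof (intro mult_left_mono power_mono mult_nonneg_nonneg moment_bound_nonneg)
          have "(50/81::real) ^ q \<le> (50/81) ^ 3" using q by (intro power_decreasing) auto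
          also have "\<dots> \<le> 1/4" by (simp add: power3_eq_cube)
          finally show "2 * (50/81::real) ^ q \<le> 1/2" by simp
        qed auto
        finally show ?thesis .
      qed
      have "(\<E> x. f a x) = (\<Sum>u\<in>{1..a - d a}. \<Sum>i<2 ^ (d a + u).
         (\<E> x. (csum (Bk a u i) x) ^ (2 * q)) / (h a u) ^ (2 * q))"
        unfolding f_def using int by (simp add: Bochner_Integration.integral_sum)
      also have "\<dots> \<le> (\<Sum>u\<in>{1..a - d a}. \<Sum>i<(2::nat) ^ (d a + u). (moment_bound q * real (L a u) ^ q) / (h a u) ^ (2 * q))"
      proof (intro sum_mono divide_right_mono)
        fix u i
        show "(\<E> x. (csum (Bk a u i) x) ^ (2 * q)) \<le> moment_bound q * real (L a u) ^ q"
          using integral_sum_power_le[OF Bk(1,2), of a u i q] unfolding Bk(3) by (simp add: csum_def)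
      qed (use hpos in \<open>auto simp: less_imp_le\<close>)
      also have "\<dots> = (\<Sum>u\<in>{1..a - d a}. real (2 ^ (d a + u)) * (moment_bound q * (real (L a u) ^ q / (h a u) ^ (2 * q))))"
        by simp
      also have "\<dots> \<le> (\<Sum>u\<in>{1..a - d a}. moment_bound q * ((1/2) ^ d a) ^ (q - 1) * (1/2) ^ u)"
        by (intro sum_mono summand)
      also have "\<dots> = moment_bound q * ((1/2) ^ d a) ^ (q - 1) * (\<Sum>u=1..a - d a. (1/2) ^ u)" by (simp add: sum_distrib_left)
      also have "\<dots> \<le> moment_bound q * ((1/2) ^ d a) ^ (q - 1) * 1"
      proof (intro mult_left_mono mult_nonneg_nonneg moment_bound_nonneg)
        have "(\<Sum>u=1..n. (1/2::real) ^ u) = 1 - (1/2) ^ n" for n by (induction n) auto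
        then show "(\<Sum>u=1..a - d a. (1/2::real) ^ u) \<le> 1" by simp
      qed auto
      also have "\<dots> \<le> moment_bound q * (2 ^ (q - 1) * real a powr (- 2))"
      proof -
        have "(1/2::real) ^ d a = 2 powr (- real (d a))" by (simp add: powr_minus powr_realpow power_one_over inverse_eq_divide)
        also have "\<dots> \<le> 2 powr (1 - \<epsilon> * log 2 (real a))"
          unfolding d_def by (intro powr_mono) linarith+
        also have "\<dots> = 2 * real a powr (- \<epsilon>)"
        proof -
          have "2 powr (\<epsilon> * log 2 (real a)) = real a powr \<epsilon>" using elim by (simp add: powr_powr [symmetric] mult.commute[of \<epsilon>])
          then show ?thesis by (simp add: powr_diff powr_minus field_simps)
        qed
        finally have "((1/2::real) ^ d a) ^ (q - 1) \<le> (2 * real a powr (- \<epsilon>)) ^ (q - 1)" by (intro power_mono) auto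
        also have "\<dots> = 2 ^ (q - 1) * real a powr (- (\<epsilon> * real (q - 1)))"
          using elim by (simp add: power_mult_distrib powr_powr powr_realpow [symmetric])
        also have "\<dots> \<le> 2 ^ (q - 1) * real a powr (- 2)" using elim q by (intro mult_left_mono powr_mono) auto
        finally show ?thesis by (simp add: mult_left_mono moment_bound_nonneg)
      qed
      finally show ?case by (simp add: mult.assoc)
    qed
  qed
  then show ?thesis
  proof eventually_elim
    case (elim x)
    show ?case using elim
    proof eventually_elim
      case (elim a)
      have "\<bar>csum (Bk a u i) x\<bar> \<le> h a u" if u: "u \<in> {1..a - d a}" and i: "i < 2 ^ (d a + u)" for u i
      proof (rule ccontr)
        assume "\<not> \<bar>csum (Bk a u i) x\<bar> \<le> h a u"
        then have "1 \<le> (\<bar>csum (Bk a u i) x\<bar> / h a u) ^ (2 * q)" using hpos[of a u] by (intro one_le_power) auto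
        also have "\<dots> = (csum (Bk a u i) x) ^ (2 * q) / (h a u) ^ (2 * q)" by (simp add: power_divide power_even_abs)
        also have "\<dots> \<le> (\<Sum>i<2 ^ (d a + u). (csum (Bk a u i) x) ^ (2 * q) / (h a u) ^ (2 * q))"
          using i by (intro member_le_sum divide_nonneg_nonneg) (auto simp: power_mult)
        also have "\<dots> \<le> f a x"
          unfolding f_def using u
          by (intro member_le_sum[of u _ "\<lambda>u. \<Sum>i<2 ^ (d a + u). (csum (Bk a u i) x) ^ (2 * q) / (h a u) ^ (2 * q)"] sum_nonneg divide_nonneg_nonneg)
            (auto simp: power_mult)
        finally show False using elim by simp
      qed
      then show ?case unfolding Let_def by (simp add: Bk_def L_def h_def d_def)
    qed
  qed
qed


lemma csum_split: "n \<le> k \<Longrightarrow> csum {1..k} x = csum {1..n} x + csum {n<..k} x"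
proof -
  assume "n \<le> k"
  then have "{1..k} = {1..n} \<union> {n<..k}" "{1..n} \<inter> {n<..k} = {}" by auto
  then show ?thesis unfolding csum_def by (simp add: sum.union_disjoint)
qed

text \<open>The binary digits of \<open>N - 2 ^ a\<close> lead from a checkpoint to \<open>N\<close> through dyadic blocks,
  one for each scale.\<close>

lemma dyadic_chaining:
  fixes a d N :: nat
  assumes d: "d \<le> a" and N: "2 ^ a \<le> N" "N < 2 ^ Suc a"
    and blocks: "\<And>u i. u \<in> {1..a - d} \<Longrightarrow> i < 2 ^ (d + u) \<Longrightarrow>
      \<bar>csum {2 ^ a + i * 2 ^ (a - d - u)<..2 ^ a + Suc i * 2 ^ (a - d - u)} x\<bar> \<le> (9/10) ^ u * sqrt (2 ^ a)"
  obtains i where "i < 2 ^ d" "2 ^ a + i * 2 ^ (a - d) \<le> N"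
    "\<bar>csum {1..N} x - csum {1..2 ^ a + i * 2 ^ (a - d)} x\<bar> \<le> 9 * sqrt (2 ^ a)"
proof -
  define n where "n = N - 2 ^ a"
  have n: "N = 2 ^ a + n" "n < 2 ^ a" using N by (auto simp: n_def)
  \<comment> \<open>\<open>v u\<close> keeps the leading \<open>d + u\<close> binary digits of the
    offset \<open>n\<close>; it runs from the checkpoint \<open>v 0\<close> to
    \<open>v (a - d) = N\<close>.\<close>
  define v where "v = (\<lambda>u. 2 ^ a + n div 2 ^ (a - d - u) * 2 ^ (a - d - u))"
  have quot: "n div 2 ^ (a - d - u) < 2 ^ (d + u)" if "u \<le> a - d" for u
  proof -
    have "a = (d + u) + (a - d - u)" using that d by simp
    then have "n < 2 ^ (d + u) * 2 ^ (a - d - u)" using n(2) by (metis power_add)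
    then show ?thesis by (simp add: less_mult_imp_div_less)
  qed
  have step: "\<bar>csum {1..v (Suc u)} x - csum {1..v u} x\<bar> \<le> (9/10) ^ Suc u * sqrt (2 ^ a)" if u: "Suc u \<le> a - d" for u
  proof -
    define l where "l = a - d - Suc u"
    have l: "a - d - u = Suc l" using u by (simp add: l_def)
    define i where "i = n div 2 ^ l"
    have half: "n div 2 ^ Suc l = i div 2" by (simp add: i_def mult.commute flip: div_mult2_eq)
    have v1: "v (Suc u) = 2 ^ a + i * 2 ^ l" by (simp add: v_def i_def l_def)
    have v0: "v u = 2 ^ a + (i div 2 * 2) * 2 ^ l" unfolding v_def l half by simp
    show ?thesis
    proof (cases "even i")
      case True
      then have "v (Suc u) = v u" by (simp add: v0 v1)
      then show ?thesis by simp
    next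
      \<comment> \<open>A digit 1 appends exactly one dyadic block, whose index \<open>j\<close> is
        the even predecessor of \<open>i\<close>; a digit 0 appends nothing.\<close>
      case False
      define j where "j = i div 2 * 2"
      have ij: "i = Suc j" using False by (simp add: j_def) (metis odd_two_times_div_two_succ Suc_eq_plus1 mult.commute)
      have "i < 2 ^ (d + Suc u)" using quot[OF u] unfolding i_def l_def .
      then have "j < 2 ^ (d + Suc u)" using ij by simp
      then have blk: "\<bar>csum {2 ^ a + j * 2 ^ l<..2 ^ a + Suc j * 2 ^ l} x\<bar> \<le> (9/10) ^ Suc u * sqrt (2 ^ a)"
        using blocks[of "Suc u" j] u unfolding l_def by auto
      have vu: "v u = 2 ^ a + j * 2 ^ l" "v (Suc u) = 2 ^ a + Suc j * 2 ^ l"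
        by (simp only: v0 j_def, simp only: v1 ij [symmetric])
      have "v u \<le> v (Suc u)" unfolding vu by simp
      note e = csum_split[OF this, of x]
      have "\<bar>csum {v u<..v (Suc u)} x\<bar> \<le> (9/10) ^ Suc u * sqrt (2 ^ a)" using blk unfolding vu .
      then show ?thesis unfolding e by simp
    qed
  qed
  have "\<bar>csum {1..v u} x - csum {1..v 0} x\<bar> \<le> (\<Sum>w=1..u. (9/10) ^ w * sqrt (2 ^ a))" if "u \<le> a - d" for u
    using that
  proof (induction u)
    case (Suc u)
    have "(\<Sum>w=1..Suc u. (9/10) ^ w * sqrt (2 ^ a)) = (\<Sum>w=1..u. (9/10) ^ w * sqrt (2 ^ a)) + (9/10) ^ Suc u * sqrt (2 ^ a)"
      by simp
    then show ?case using step[OF Suc.prems] Suc.IH[OF Suc_leD[OF Suc.prems]] by linarith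
  qed simp
  from this[of "a - d"] have "\<bar>csum {1..v (a - d)} x - csum {1..v 0} x\<bar> \<le> (\<Sum>w=1..a - d. (9/10) ^ w) * sqrt (2 ^ a)"
    by (simp add: sum_distrib_right)
  also have "\<dots> \<le> 9 * sqrt (2 ^ a)"
  proof (intro mult_right_mono)
    have "(\<Sum>w=1..k. (9/10::real) ^ w) = 9 - 9 * (9/10) ^ k" for k by (induction k) auto
    then show "(\<Sum>w=1..a - d. (9/10::real) ^ w) \<le> 9" by simp
  qed simp
  finally have "\<bar>csum {1..v (a - d)} x - csum {1..v 0} x\<bar> \<le> 9 * sqrt (2 ^ a)" .
  moreover have "v (a - d) = N" by (simp add: v_def n)
  moreover have "v 0 = 2 ^ a + n div 2 ^ (a - d) * 2 ^ (a - d)" by (simp add: v_def)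
  moreover have "n div 2 ^ (a - d) < 2 ^ d" using quot[of 0] by simp
  moreover have "2 ^ a + n div 2 ^ (a - d) * 2 ^ (a - d) \<le> N" by (simp add: n)
  ultimately show ?thesis using that[of "n div 2 ^ (a - d)"] by simp
qed

text \<open>The chaining error \<open>9 * sqrt N\<close> is of smaller order than the norming, and
  \<open>ln a\<close> differs from \<open>ln (ln N)\<close> by at most a constant in the relevant
  direction; the second \<open>\<epsilon>\<close> absorbs both.\<close>

lemma AE_upper_bound:
  assumes s: "s \<in> {-1, 1::real}" and \<epsilon>: "0 < \<epsilon>" "\<epsilon> \<le> 1"
  shows "AE x in unit_interval_measure. eventually (\<lambda>N. s * csum {1..N} x \<le> (1 + 2 * \<epsilon>) * sqrt (real N * ln (ln (real N)))) sequentially"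
  using AE_checkpoints_small[OF s \<epsilon>] AE_dyadic_blocks_small[OF \<epsilon>]
proof eventually_elim
  case (elim x)
  define d where "d = (\<lambda>a. nat \<lfloor>\<epsilon> * log 2 (real a)\<rfloor>)"
  have ev: "eventually (\<lambda>a. \<forall>N. 2 ^ a \<le> N \<and> N < 2 ^ Suc a \<longrightarrow> s * csum {1..N} x \<le> (1 + \<epsilon>) * sqrt (real N * ln (real a)) + 9 * sqrt N) sequentially"
    using elim eventually_ge_at_top[of 1]
  proof eventually_elim
    case (elim a)
    show ?case
    proof (intro allI impI, elim conjE)
      fix N :: nat assume N: "2 ^ a \<le> N" "N < 2 ^ Suc a"
      have da: "d a \<le> a"
      proof -
        have "log 2 (real a) \<le> log 2 (2 ^ a)" using elim(3) by (intro log_mono) (auto simp: less_imp_le)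
        then have "log 2 (real a) \<le> real a" by simp
        moreover have "0 \<le> log 2 (real a)" using elim(3) by simp
        ultimately have "\<epsilon> * log 2 (real a) \<le> 1 * real a" using \<epsilon> by (intro mult_mono) auto
        then show ?thesis unfolding d_def by linarith
      qed
      obtain i where i: "i < 2 ^ d a" "2 ^ a + i * 2 ^ (a - d a) \<le> N"
        "\<bar>csum {1..N} x - csum {1..2 ^ a + i * 2 ^ (a - d a)} x\<bar> \<le> 9 * sqrt (2 ^ a)"
        by (rule dyadic_chaining[OF da N, of x]) (use elim(2) in \<open>auto simp: Let_def d_def\<close>)
      define N' where "N' = 2 ^ a + i * 2 ^ (a - d a)"
      have "s * csum {1..N'} x \<le> (1 + \<epsilon>) * sqrt (real N' * ln (real a))"
        using elim(1) i(1) unfolding d_def N'_def Let_def by blast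
      also have "\<dots> \<le> (1 + \<epsilon>) * sqrt (real N * ln (real a))"
        using i(2) elim(3) \<epsilon> by (intro mult_left_mono real_sqrt_le_mono mult_right_mono) (auto simp: N'_def simp flip: of_nat_power of_nat_mult of_nat_add)
      finally have 1: "s * csum {1..N'} x \<le> (1 + \<epsilon>) * sqrt (real N * ln (real a))" .
      have "s * csum {1..N} x - s * csum {1..N'} x \<le> \<bar>csum {1..N} x - csum {1..N'} x\<bar>"
        using s by (auto simp: abs_if)
      also have "\<dots> \<le> 9 * sqrt (2 ^ a)" using i(3) by (simp add: N'_def)
      also have "\<dots> \<le> 9 * sqrt N"
      proof -
        have "real (2 ^ a) \<le> real N" using N(1) by (rule of_nat_mono)
        then show ?thesis by simp
      qed
      finally show "s * csum {1..N} x \<le> (1 + \<epsilon>) * sqrt (real N * ln (real a)) + 9 * sqrt N" using 1 by linarith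
    qed
  qed
  then obtain A where A: "\<And>a N. a \<ge> A \<Longrightarrow> 2 ^ a \<le> N \<Longrightarrow> N < 2 ^ Suc a \<Longrightarrow>
      s * csum {1..N} x \<le> (1 + \<epsilon>) * sqrt (real N * ln (real a)) + 9 * sqrt N"
    by (auto simp: eventually_sequentially)
  have lim: "eventually (\<lambda>N::nat. (1 + \<epsilon>) * sqrt (ln (ln (real N)) - ln (ln 2)) + 9 \<le> (1 + 2 * \<epsilon>) * sqrt (ln (ln (real N)))) sequentially"
    using \<epsilon> by real_asymp
  show ?case
    using lim eventually_ge_at_top[of "2 ^ Suc A"]
  proof eventually_elim
    case (elim N)
    have N2: "N \<ge> 2" using elim(2) by (simp add: order_trans[OF _ elim(2)])
    define a where "a = nat \<lfloor>log 2 (real N)\<rfloor>"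
    have aN: "2 ^ a \<le> N" "N < 2 ^ Suc a"
    proof -
      have l: "0 \<le> log 2 (real N)" using N2 by simp
      have "2 powr real a \<le> 2 powr log 2 (real N)" unfolding a_def using l by (intro powr_mono) auto
      then have "real (2 ^ a) \<le> real N" using N2 by (simp add: powr_realpow)
      then show "2 ^ a \<le> N" by (simp only: of_nat_le_iff)
      have "2 powr log 2 (real N) < 2 powr real (Suc a)" unfolding a_def using l by (intro powr_less_mono) linarith+
      then have "real N < real (2 ^ Suc a)" using N2 by (simp add: powr_realpow [symmetric] powr_add)
      then show "N < 2 ^ Suc a" by (simp only: of_nat_less_iff)
    qed
    have "(2::nat) ^ Suc A < 2 ^ Suc a" using elim(2) aN(2) by (rule le_less_trans)
    then have "Suc A < Suc a" by (rule power_less_imp_less_exp[rotated]) simp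
    then have aA: "a > A" by simp
    have "real a \<le> ln (real N) / ln 2" using N2 unfolding a_def log_def [symmetric] by simp
    then have "ln (real a) \<le> ln (ln (real N) / ln 2)" using aA N2 by (intro ln_mono) auto
    also have "\<dots> = ln (ln (real N)) - ln (ln 2)" using N2 by (simp add: ln_div)
    finally have la: "ln (real a) \<le> ln (ln (real N)) - ln (ln 2)" .
    have "s * csum {1..N} x \<le> (1 + \<epsilon>) * sqrt (real N * ln (real a)) + 9 * sqrt N"
      using A[of a N] aA aN by simp
    also have "\<dots> \<le> (1 + \<epsilon>) * sqrt (real N * (ln (ln (real N)) - ln (ln 2))) + 9 * sqrt N"
      using la \<epsilon> by (intro add_right_mono mult_left_mono real_sqrt_le_mono) auto
    also have "\<dots> = sqrt N * ((1 + \<epsilon>) * sqrt (ln (ln (real N)) - ln (ln 2)) + 9)"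
      unfolding real_sqrt_mult by (simp add: algebra_simps)
    also have "\<dots> \<le> sqrt N * ((1 + 2 * \<epsilon>) * sqrt (ln (ln (real N))))"
      using elim(1) by (intro mult_left_mono) auto
    finally show ?case by (simp add: real_sqrt_mult mult_ac)
  qed
qed

section \<open>Lower half of the law and conclusion\<close>

text \<open>On geometric blocks from \<open>\<theta> ^ j\<close> to \<open>\<theta> ^ Suc j\<close>,
  infinitely many block sums are large. The sum up to \<open>\<theta> ^ j\<close> might cancel them,
  but the upper half for the negated sum limits this to \<open>2 / sqrt \<theta>\<close> of the
  norming, negligible for large \<open>\<theta>\<close>. The factor
  \<open>sqrt (1 - 1 / \<theta>)\<close> is the share of the block in \<open>N\<close>.\<close>

lemma AE_lower_bound:
  assumes \<theta>: "\<theta> \<ge> (4::nat)" and \<epsilon>: "0 < \<epsilon>" "\<epsilon> < 1"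
  shows "AE x in unit_interval_measure. \<forall>J. \<exists>N\<ge>J. N \<ge> 3 \<and>
    ((1 - \<epsilon>) ^ 3 * sqrt (1 - 1 / \<theta>) - 2 / sqrt \<theta>) * sqrt (real N * ln (ln (real N))) \<le> csum {1..N} x"
proof -
  define Ib where "Ib = (\<lambda>j. {\<theta> ^ j<..\<theta> ^ Suc j})"
  have card_Ib: "real (card (Ib j)) = \<theta> ^ Suc j * (1 - 1 / \<theta>)" for j
  proof -
    have "\<theta> ^ j \<le> \<theta> ^ Suc j" using \<theta> by (intro power_increasing) auto
    then have "real (card (Ib j)) = real (\<theta> ^ Suc j) - real (\<theta> ^ j)" by (simp add: Ib_def of_nat_diff)
    then show ?thesis using \<theta> by (simp add: right_diff_distrib)
  qed
  have large: "2 ^ j \<le> real (card (Ib j))" for j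
  proof -
    have "(2::real) ^ j * 1 \<le> real \<theta> ^ j * (real \<theta> - 1)" using \<theta> by (intro mult_mono power_mono) auto
    also have "\<dots> = real (card (Ib j))" unfolding card_Ib using \<theta> by (simp add: field_simps)
    finally show ?thesis by simp
  qed
  have disj: "Ib i \<inter> Ib j = {}" if "i \<noteq> j" for i j
  proof -
    have *: "Ib i \<inter> Ib j = {}" if "i < j" for i j
    proof -
      have "\<theta> ^ Suc i \<le> \<theta> ^ j" using that \<theta> by (intro power_increasing) auto
      then show ?thesis by (auto simp: Ib_def)
    qed
    show ?thesis using *[of i j] *[of j i] that by (cases "i < j") auto
  qed
  have "AE x in unit_interval_measure. \<forall>J. \<exists>j\<ge>J. (1 - \<epsilon>)\<^sup>2 * sqrt (card (Ib j) * ln (real j / 2)) \<le> csum (Ib j) x"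
    by (rule AE_block_sums_large[OF _ _ large disj \<epsilon>]) (auto simp: Ib_def)
  \<comment> \<open>Any fixed constant would do for the initial segment;
    \<open>\<epsilon> = 1/2\<close> gives the round value 2.\<close>
  moreover have "AE x in unit_interval_measure. eventually (\<lambda>N. -1 * csum {1..N} x \<le> (1 + 2 * (1/2)) * sqrt (real N * ln (ln (real N)))) sequentially"
    by (rule AE_upper_bound) auto
  ultimately show ?thesis
  proof eventually_elim
    case (elim x)
    show ?case
    proof
      fix J
      have l\<theta>: "ln (real \<theta>) > 0" using \<theta> by simp
      have "(\<lambda>j::nat. ln (real j / 2) / (ln (real j + 1) + ln (ln (real \<theta>)))) \<longlonglongrightarrow> 1"
      proof -
        have "(\<lambda>j::nat. ln (real j / 2) / (ln (real j + 1) + y)) \<longlonglongrightarrow> 1" for y :: real by real_asymp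
        then show ?thesis .
      qed
      \<comment> \<open>The comparison of \<open>ln (j / 2)\<close> with \<open>ln (ln N)\<close>
        loses \<open>(1 - \<epsilon>)\<^sup>2\<close> under the square root, hence the third factor
        \<open>1 - \<epsilon>\<close> of the final constant.\<close>
      moreover have "(1 - \<epsilon>)\<^sup>2 < 1" using \<epsilon> by (simp add: power_less_one_iff)
      ultimately have e1: "eventually (\<lambda>j::nat. (1 - \<epsilon>)\<^sup>2 < ln (real j / 2) / (ln (real j + 1) + ln (ln (real \<theta>)))) sequentially"
        by (rule order_tendstoD(1))
      obtain N0 where N0: "\<And>N. N \<ge> N0 \<Longrightarrow> - csum {1..N} x \<le> 2 * sqrt (real N * ln (ln (real N)))"
        using elim(2) by (auto simp: eventually_sequentially)
      obtain j1 where j1: "\<And>j. j \<ge> j1 \<Longrightarrow> (1 - \<epsilon>)\<^sup>2 < ln (real j / 2) / (ln (real j + 1) + ln (ln (real \<theta>)))"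
        using e1 by (auto simp: eventually_sequentially)
      obtain j where j: "j \<ge> J + N0 + j1 + 2" "(1 - \<epsilon>)\<^sup>2 * sqrt (card (Ib j) * ln (real j / 2)) \<le> csum (Ib j) x"
        using elim(1) by blast
      have pow_ge: "k \<le> \<theta> ^ k" for k
        using \<theta> by (intro less_imp_le[OF power_gt_expt]) auto
      define N where "N = \<theta> ^ Suc j"
      have N: "N \<ge> J" "N \<ge> 3" using pow_ge[of "Suc j"] j(1) by (auto simp: N_def)
      have N1: "\<theta> ^ j \<ge> N0" using pow_ge[of j] j(1) by simp
      define LL where "LL = ln (ln (real N))"
      have lnN: "ln (real N) = (real j + 1) * ln (real \<theta>)"
        using \<theta> by (simp add: N_def ln_realpow ring_distribs ln_mult)
      have LL: "LL = ln (real j + 1) + ln (ln (real \<theta>))"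
        unfolding LL_def lnN using l\<theta> by (simp add: ln_mult)
      have lnt: "ln (real \<theta>) > 1"
      proof -
        have "exp 1 < (4::real)" using e_less_272 by simp
        then have "exp 1 < real \<theta>" using \<theta> by simp
        then have "exp 1 < exp (ln (real \<theta>))" using \<theta> by simp
        then show ?thesis unfolding exp_less_cancel_iff .
      qed
      then have LL0: "LL > 0" unfolding LL by (intro add_nonneg_pos) auto
      have "(1 - \<epsilon>)\<^sup>2 < ln (real j / 2) / LL" using j1[of j] j(1) unfolding LL by auto
      then have "(1 - \<epsilon>)\<^sup>2 * LL \<le> ln (real j / 2)" using LL0 by (simp add: less_divide_eq)
      then have "sqrt (card (Ib j) * ((1 - \<epsilon>)\<^sup>2 * LL)) \<le> sqrt (card (Ib j) * ln (real j / 2))"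
        by (intro real_sqrt_le_mono mult_left_mono) auto
      also have "sqrt (card (Ib j) * ((1 - \<epsilon>)\<^sup>2 * LL)) = (1 - \<epsilon>) * sqrt (1 - 1 / \<theta>) * sqrt (real N * LL)"
        unfolding card_Ib using \<epsilon> by (simp add: N_def real_sqrt_mult)
      finally have "(1 - \<epsilon>)\<^sup>2 * ((1 - \<epsilon>) * sqrt (1 - 1 / \<theta>) * sqrt (real N * LL)) \<le> (1 - \<epsilon>)\<^sup>2 * sqrt (card (Ib j) * ln (real j / 2))"
        by (intro mult_left_mono) auto
      then have 1: "(1 - \<epsilon>) ^ 3 * sqrt (1 - 1 / \<theta>) * sqrt (real N * LL) \<le> csum (Ib j) x"
        using j(2) by (simp add: power3_eq_cube power2_eq_square mult.assoc)
      have 2: "- csum {1..\<theta> ^ j} x \<le> 2 / sqrt \<theta> * sqrt (real N * LL)"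
      proof -
        have "- csum {1..\<theta> ^ j} x \<le> 2 * sqrt (real (\<theta> ^ j) * ln (ln (real (\<theta> ^ j))))" by (rule N0[OF N1])
        also have "\<dots> \<le> 2 * sqrt (real (\<theta> ^ j) * LL)"
        proof (intro mult_left_mono real_sqrt_le_mono)
          have "\<theta> ^ j \<le> N" unfolding N_def using \<theta> by (intro power_increasing) auto
          moreover have "ln (real (\<theta> ^ j)) > 0" using \<theta> j(1) by (simp add: ln_realpow)
          moreover have "0 < \<theta> ^ j" using \<theta> by simp
          ultimately show "ln (ln (real (\<theta> ^ j))) \<le> LL" unfolding LL_def by (intro ln_mono) (auto simp del: of_nat_power)
        qed auto
        also have "real (\<theta> ^ j) * LL = (real N * LL) / \<theta>" using \<theta> by (simp add: N_def)
        also have "2 * sqrt ((real N * LL) / \<theta>) = 2 / sqrt \<theta> * sqrt (real N * LL)" by (simp add: real_sqrt_divide)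
        finally show ?thesis .
      qed
      have "\<theta> ^ j \<le> N" unfolding N_def using \<theta> by (intro power_increasing) auto
      then have "csum {1..N} x = csum {1..\<theta> ^ j} x + csum (Ib j) x"
        unfolding Ib_def N_def by (rule csum_split)
      then have "((1 - \<epsilon>) ^ 3 * sqrt (1 - 1 / \<theta>) - 2 / sqrt \<theta>) * sqrt (real N * LL) \<le> csum {1..N} x"
        using 1 2 by (simp add: left_diff_distrib)
      then show "\<exists>N\<ge>J. N \<ge> 3 \<and> ((1 - \<epsilon>) ^ 3 * sqrt (1 - 1 / \<theta>) - 2 / sqrt \<theta>) * sqrt (real N * ln (ln (real N))) \<le> csum {1..N} x"
        using N unfolding LL_def by blast
    qed
  qed
qed

text \<open>The parameters run through countable sequences, so the exceptional null sets can be
  united before passing to the limit.\<close>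

lemma iterated_logarithm:
  "AE x in unit_interval_measure. limsup (\<lambda>N. ereal (csum {1..N} x / sqrt (real N * ln (ln (real N))))) = 1"
proof -
  have LL0: "ln (ln (real N)) > 0" if "N \<ge> 3" for N :: nat
  proof -
    have "exp 1 < real N" using e_less_272 that by simp
    then have "exp 1 < exp (ln (real N))" using that by simp
    then have "1 < ln (real N)" unfolding exp_less_cancel_iff .
    then show ?thesis by simp
  qed
  \<comment> \<open>The shift by 2 keeps \<open>\<epsilon> k\<close> strictly between 0 and 1, and
    the shift by 4 in \<open>r\<close> keeps the block ratio \<open>\<theta> = k + 4\<close> in the
    range of the lower bound.\<close>
  define \<epsilon> where "\<epsilon> = (\<lambda>k::nat. 1 / (real k + 2))"
  have \<epsilon>: "0 < \<epsilon> k" "\<epsilon> k < 1" for k by (auto simp: \<epsilon>_def)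
  define r where "r = (\<lambda>k. (1 - \<epsilon> k) ^ 3 * sqrt (1 - 1 / real (k + 4)) - 2 / sqrt (real (k + 4)))"
  have r: "r \<longlonglongrightarrow> 1" unfolding r_def \<epsilon>_def by real_asymp
  have \<epsilon>0: "\<epsilon> \<longlonglongrightarrow> 0" unfolding \<epsilon>_def by real_asymp
  have "AE x in unit_interval_measure. \<forall>k. eventually (\<lambda>N. 1 * csum {1..N} x \<le> (1 + 2 * \<epsilon> k) * sqrt (real N * ln (ln (real N)))) sequentially"
    unfolding AE_all_countable using \<epsilon> by (intro allI AE_upper_bound) (auto simp: less_imp_le)
  moreover have "AE x in unit_interval_measure. \<forall>k J. \<exists>N\<ge>J. N \<ge> 3 \<and> r k * sqrt (real N * ln (ln (real N))) \<le> csum {1..N} x"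
    unfolding r_def by (subst AE_all_countable) (intro allI AE_lower_bound \<epsilon>, simp)
  ultimately show ?thesis
  proof eventually_elim
    case (elim x)
    let ?f = "\<lambda>N. csum {1..N} x / sqrt (real N * ln (ln (real N)))"
    have up: "limsup (\<lambda>N. ereal (?f N)) \<le> ereal (1 + 2 * \<epsilon> k)" for k
    proof (rule Limsup_bounded)
      show "eventually (\<lambda>N. ereal (?f N) \<le> ereal (1 + 2 * \<epsilon> k)) sequentially"
        using elim(1)[rule_format, of k] eventually_ge_at_top[of 3]
      proof eventually_elim
        case (elim N)
        then show ?case using LL0[of N] by (simp add: divide_le_eq)
      qed
    qed
    have low: "ereal (r k) \<le> limsup (\<lambda>N. ereal (?f N))" for k
    proof (rule Limsup_ge_frequently)
      fix J
      obtain N where N: "N \<ge> J" "N \<ge> 3" "r k * sqrt (real N * ln (ln (real N))) \<le> csum {1..N} x"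
        using elim(2) by blast
      then have "r k \<le> ?f N" using LL0[of N] by (simp add: le_divide_eq)
      then show "\<exists>N\<ge>J. r k \<le> ?f N" using N by blast
    qed
    have "(\<lambda>k. ereal (1 + 2 * \<epsilon> k)) \<longlonglongrightarrow> ereal (1 + 2 * 0)"
      by (intro tendsto_intros \<epsilon>0) 
    then have "limsup (\<lambda>N. ereal (?f N)) \<le> ereal (1 + 2 * 0)"
      by (rule LIMSEQ_le_const) (use up in auto)
    moreover have "(\<lambda>k. ereal (r k)) \<longlonglongrightarrow> ereal 1" by (intro tendsto_intros r)
    then have "ereal 1 \<le> limsup (\<lambda>N. ereal (?f N))"
      by (rule LIMSEQ_le_const2) (use low in auto)
    ultimately show ?case by (simp add: one_ereal_def)
  qed
qed

end

lemma trig_sum_eq: "trig_sum n \<sigma> N x = (\<Sum>k=1..N. cosf (\<lambda>k. n (\<sigma> k)) k x)"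
  by (simp add: trig_sum_def cosf_def)

theorem theorem3:
  fixes n :: "nat \<Rightarrow> nat"
  assumes pos: "\<And>k. k \<ge> 1 \<Longrightarrow> n k > 0"
    and R: "condR n"
  shows "(\<forall>\<sigma>. bij_betw \<sigma> {1..} {1..} \<longrightarrow>
            weak_conv_m (\<lambda>N. distr unit_interval_measure borel
                                 (\<lambda>x. trig_sum n \<sigma> N x / sqrt (real N)))
                        (density lborel (normal_density 0 (sqrt (1/2)))))
       \<and> (condRstar n \<longrightarrow>
            (\<forall>\<sigma>. bij_betw \<sigma> {1..} {1..} \<longrightarrow>
               (AE x in unit_interval_measure.
                  limsup (\<lambda>N. ereal (trig_sum n \<sigma> N x / sqrt (real N * ln (ln (real N))))) = 1)))"
proof (intro conjI allI impI)
  fix \<sigma> :: "nat \<Rightarrow> nat" assume \<sigma>: "bij_betw \<sigma> {1..} {1..}"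
  interpret cos_system "\<lambda>k. n (\<sigma> k)" "rel_bound n"
    by (rule cos_system_rel_bound[OF pos R \<sigma>])
  show "weak_conv_m (\<lambda>N. distr unit_interval_measure borel (\<lambda>x. trig_sum n \<sigma> N x / sqrt (real N)))
      (density lborel (normal_density 0 (sqrt (1/2))))"
    unfolding trig_sum_eq by (rule central_limit)
next
  fix \<sigma> :: "nat \<Rightarrow> nat" assume Rs: "condRstar n" and \<sigma>: "bij_betw \<sigma> {1..} {1..}"
  interpret cos_system "\<lambda>k. n (\<sigma> k)" "rel_bound n"
    by (rule cos_system_rel_bound[OF pos R \<sigma>])
  obtain C \<alpha> where C: "C \<ge> 0" "\<alpha> \<ge> 1" "\<And>r. r \<ge> 1 \<Longrightarrow> rel_bound n r \<le> C * exp (3 * real r ^ \<alpha>)"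
    using rel_bound_condRstar[OF Rs] by blast
  interpret lil_system "\<lambda>k. n (\<sigma> k)" "rel_bound n" C \<alpha>
    by unfold_locales (use C in auto)
  show "AE x in unit_interval_measure. limsup (\<lambda>N. ereal (trig_sum n \<sigma> N x / sqrt (real N * ln (ln (real N))))) = 1"
    using iterated_logarithm unfolding trig_sum_eq csum_def .
qed

end
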